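(* Let $(\alpha,\rho)\in\mathcal A$ and let $z\in\mathbb C$, $z\neq 0$, satisfy $|\arg(z)|<\pi\min\left(1-\rho,\tfrac12\right)$. Then $$\frac{d}{dz}\ln(\phi(z;\alpha,\rho))=\frac{1}{2\pi i z}\left[F\left(\pi i\rho-\ln(z);\,i\alpha^{-1}\right)-F\left(-\pi i\rho-\ln(z);\,i\alpha^{-1}\right)\right].$$
   Context: The admissible set is $\mathcal A=\{\alpha\in(0,1),\rho\in(0,1)\}\cup\{\alpha=1,\rho=\frac12\}\cup\{\alpha\in(1,2),\rho\in[1-\alpha^{-1},\alpha^{-1}]\}$. For $(\alpha,\rho)\in\mathcal A$, $X_t$ is the stable Lévy process with $X_0=0$ and $\mathbb E[e^{izX_t}]=e^{-t\Psi(z)}$, $z\in\mathbb R$, where $\Psi(z)=e^{\pi i\gamma/2}|z|^\alpha$ for $z>0$, $\Psi(z)=e^{-\pi i\gamma/2}|z|^\alpha$ for $z<0$, $\Psi(0)=0$, and $\gamma=\alpha(1-2\rho)$ (so that $\rho=\mathbb P(X_1>0)$). Put $S_t=\sup\{X_u:0\le u\le t\}$, let $e(1)$ be a unit-mean exponential random variable independent of $X$, and define $\phi(z)=\phi(z;\alpha,\rho)=\mathbb E[e^{-zS_{e(1)}}]$ for $\mathrm{Re}(z)\ge 0$. Logarithms are principal branches. For $\mathrm{Im}(\tau)>0$ let $\mathcal S(\tau)=\{z\in\mathbb C:|\mathrm{Re}(z\bar\tau)|<\pi\,\mathrm{Im}(\tau)\}$, and for $z\in\mathcal S(\tau)$ define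 $F(z;\tau)=\int_{\mathbb R}\frac{dx}{(1+e^{z+i\tau x})(1+e^{x})}$. *)

theory Defs
  imports "HOL-Probability.Probability"
begin

definition admissible :: "(real \<times> real) set" where
  "admissible =
     {(\<alpha>, \<rho>). 0 < \<alpha> \<and> \<alpha> < 1 \<and> 0 < \<rho> \<and> \<rho> < 1}
     \<union> {(1, 1/2)}
     \<union> {(\<alpha>, \<rho>). 1 < \<alpha> \<and> \<alpha> < 2 \<and> 1 - 1 / \<alpha> \<le> \<rho> \<and> \<rho> \<le> 1 / \<alpha>}"

definition cadlag :: "(real \<Rightarrow> real) \<Rightarrow> bool" where
  "cadlag f \<longleftrightarrow>
     (\<forall>t\<ge>0. continuous (at_right t) f) \<and>
     (\<forall>t>0. \<exists>l. (f \<longlongrightarrow> l) (at_left t))"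

text \<open>Time is \<open>{0..}\<close>; the values \<open>X t\<close> for negative \<open>t\<close> are irrelevant throughout.
  Stationarity compares with \<open>X t\<close> itself because \<open>X 0 = 0\<close>.\<close>

definition levy_process :: "'a measure \<Rightarrow> (real \<Rightarrow> 'a \<Rightarrow> real) \<Rightarrow> bool" where
  "levy_process M X \<longleftrightarrow>
     prob_space M \<and>
     (\<forall>t\<ge>0. X t \<in> borel_measurable M) \<and>
     (AE \<omega> in M. X 0 \<omega> = 0) \<and>
     (\<forall>n (t :: nat \<Rightarrow> real). 0 \<le> t 0 \<and> (\<forall>i<n. t i \<le> t (Suc i)) \<longrightarrow>
        prob_space.indep_vars M (\<lambda>_. borel) (\<lambda>i \<omega>. X (t (Suc i)) \<omega> - X (t i) \<omega>) {..<n}) \<and>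
     (\<forall>s\<ge>0. \<forall>t\<ge>0. distr M borel (\<lambda>\<omega>. X (s + t) \<omega> - X s \<omega>) = distr M borel (X t)) \<and>
     (AE \<omega> in M. cadlag (\<lambda>t. X t \<omega>))"

definition stable_exponent :: "real \<Rightarrow> real \<Rightarrow> real \<Rightarrow> complex" where
  "stable_exponent \<alpha> \<rho> z =
     (let \<gamma> = \<alpha> * (1 - 2 * \<rho>) in
      if z > 0 then exp (pi * \<i> * \<gamma> / 2) * of_real (\<bar>z\<bar> powr \<alpha>)
      else if z < 0 then exp (- pi * \<i> * \<gamma> / 2) * of_real (\<bar>z\<bar> powr \<alpha>)
      else 0)"

definition stable_process ::
    "real \<Rightarrow> real \<Rightarrow> 'a measure \<Rightarrow> (real \<Rightarrow> 'a \<Rightarrow> real) \<Rightarrow> bool" where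
  "stable_process \<alpha> \<rho> M X \<longleftrightarrow>
     levy_process M X \<and>
     (\<forall>t\<ge>0. \<forall>z. char (distr M borel (X t)) z = exp (- of_real t * stable_exponent \<alpha> \<rho> z))"

text \<open>Independence of the random variable \<open>e\<close> and the whole process \<open>X\<close>, that is, of the
  sigma-algebras they generate. (\<open>indep_var\<close> would need both to have the same range type.)\<close>

definition indep_of_process :: "'a measure \<Rightarrow> ('a \<Rightarrow> real) \<Rightarrow> (real \<Rightarrow> 'a \<Rightarrow> real) \<Rightarrow> bool" where
  "indep_of_process M e X \<longleftrightarrow>
     prob_space.indep_set M
       (sets (vimage_algebra (space M) e borel))
       (sets (vimage_algebra (space M) (\<lambda>\<omega>. \<lambda>t\<in>{0..}. X t \<omega>) (Pi\<^sub>M {0..} (\<lambda>_. borel))))"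

definition running_sup :: "(real \<Rightarrow> 'a \<Rightarrow> real) \<Rightarrow> real \<Rightarrow> 'a \<Rightarrow> real" where
  "running_sup X t \<omega> = (SUP u\<in>{0..t}. X u \<omega>)"

text \<open>As paths are only almost surely cadlag, the supremum agrees with a measurable function
  outside a null set but need not be measurable itself; hence the completion. If the supremum
  is measurable, the integral is the one with respect to \<open>M\<close>, see \<open>integral_completion\<close>.\<close>

definition phi ::
    "'a measure \<Rightarrow> (real \<Rightarrow> 'a \<Rightarrow> real) \<Rightarrow> ('a \<Rightarrow> real) \<Rightarrow> complex \<Rightarrow> complex" where
  "phi M X e z = (CLINT \<omega>|completion M. exp (- z * of_real (running_sup X (e \<omega>) \<omega>)))"

definition strip :: "complex \<Rightarrow> complex set" where
  "strip \<tau> = {z. \<bar>Re (z * cnj \<tau>)\<bar> < pi * Im \<tau>}"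

text \<open>Meaningful for \<open>Im \<tau> > 0\<close> and \<open>z \<in> strip \<tau>\<close>, where the integral converges absolutely.\<close>

definition F_integral :: "complex \<Rightarrow> complex \<Rightarrow> complex" where
  "F_integral z \<tau> =
     (CLINT x|lborel. 1 / ((1 + exp (z + \<i> * \<tau> * of_real x)) * (1 + exp (of_real x))))"

lemma admissible_bounds:
  assumes "(\<alpha>, \<rho>) \<in> admissible"
  shows "0 < \<alpha>" "0 < \<rho>" "\<rho> < 1"
proof -
  have "1 < \<alpha> \<longrightarrow> 1 / \<alpha> < 1" by simp
  moreover have "0 < \<alpha> \<and> \<alpha> < 1 \<and> 0 < \<rho> \<and> \<rho> < 1 \<or> \<alpha> = 1 \<and> \<rho> = 1/2
      \<or> 1 < \<alpha> \<and> 1 - 1 / \<alpha> \<le> \<rho> \<and> \<rho> \<le> 1 / \<alpha>"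
    using assms by (auto simp: admissible_def)
  ultimately have "0 < \<alpha> \<and> 0 < \<rho> \<and> \<rho> < 1"
    by (elim disjE) (linarith | simp)+
  then show "0 < \<alpha>" "0 < \<rho>" "\<rho> < 1" by auto
qed

lemma arguments_in_strip:
  assumes "(\<alpha>, \<rho>) \<in> admissible" "z \<noteq> 0" "\<bar>Arg z\<bar> < pi * min (1 - \<rho>) (1/2)"
  shows "pi * \<i> * \<rho> - Ln z \<in> strip (\<i> / of_real \<alpha>)"
    and "- pi * \<i> * \<rho> - Ln z \<in> strip (\<i> / of_real \<alpha>)"
proof -
  note b = admissible_bounds[OF assms(1)]
  have "pi * min (1 - \<rho>) (1/2) \<le> pi * (1 - \<rho>)"
    by (intro mult_left_mono) auto
  then have *: "\<bar>Arg z\<bar> + pi * \<rho> < pi"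
    using assms(3) by (simp add: algebra_simps)
  have Im_div: "Im (\<i> / of_real \<alpha>) = 1 / \<alpha>"
    using b by (simp add: Im_divide power2_eq_square)
  have Re_eq: "Re (w * cnj (\<i> / of_real \<alpha>)) = Im w / \<alpha>" for w
    using b by (simp add: Re_divide Im_divide power2_eq_square)
  have mem: "w \<in> strip (\<i> / of_real \<alpha>)" if "\<bar>Im w\<bar> < pi" for w
    unfolding strip_def using that b
    by (simp only: mem_Collect_eq Re_eq Im_div) (simp add: divide_strict_right_mono)
  have p: "0 < pi * \<rho>" using b by simp
  show "pi * \<i> * \<rho> - Ln z \<in> strip (\<i> / of_real \<alpha>)"
    using * p by (intro mem) (simp add: Arg_eq_Im_Ln assms(2))
  show "- pi * \<i> * \<rho> - Ln z \<in> strip (\<i> / of_real \<alpha>)"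
    using * p by (intro mem) (simp add: Arg_eq_Im_Ln assms(2))
qed

end

theory Submission
  imports Defs "HOL-Complex_Analysis.Complex_Analysis"
begin

text \<open>Write \<open>\<Psi>\<close> for the exponent of the process. The proof passes through the Cauchy integral
\[ \ln\phi(z) - \ln\phi(1) = -\frac{1}{2\pi}\int_{\mathbb R} \ln(1+\Psi(s))
   \Bigl[\frac{1}{z+is}-\frac{1}{1+is}\Bigr]\,ds , \qquad \mathrm{Re}\,z > 0, \]
(lemma \<open>phi_log_formula\<close>), which is the Wiener--Hopf factorisation of \<open>1 / (1 + \<Psi>)\<close> made explicit.
Its derivative in \<open>z\<close> is elementary, and an integration by parts followed by a rotation of the
contour turns it into the function \<open>F\<close>.

\<^bold>\<open>Random walks.\<close> On a grid of mesh \<open>h\<close> the process is a random walk \<open>S\<close> whose steps have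
characteristic function \<open>\<chi> = exp (- h \<Psi>)\<close>, and the exponential time becomes a geometric one with
\<open>q = exp (- h)\<close>. Let \<open>G(z)\<close> be the sum over \<open>n\<close> of \<open>q\<^sup>n\<close> times the Laplace transform at \<open>z\<close> of
\<open>max (S\<^sub>0, \<dots>, S\<^sub>n)\<close>. Three identities on the imaginary axis involve functions that are bounded and analytic
in one of the two half-planes: Lindley's recursion for the reflected walk shows that
\<open>G (1 - q \<chi>)\<close> extends to the left half-plane; stopping at the first positive value of the walk gives
\<open>V (1 - q \<chi>) = 1 - A\<close> with \<open>V\<close> analytic on the left, \<open>A\<close> analytic on the right and \<open>\<bar>A\<bar> \<le> q\<close>; and
splitting each \<open>\<chi>\<^sup>n\<close> into its contributions from positive and nonpositive values of \<open>S\<^sub>n\<close>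
gives \<open>1 - q \<chi> = exp (- P - N)\<close> with \<open>P\<close> analytic on the right and \<open>N\<close> on the left. Whenever a function
analytic on the right agrees on the axis with one analytic on the left, Liouville's theorem makes
both constant. Hence \<open>G (1 - A)\<close> and \<open>G exp (- P)\<close> are constant. The first gives
\<open>Re G > 0\<close> (\<open>killed_max_transform_Re_pos\<close>), which is what makes the principal logarithm of \<open>\<phi>\<close> harmless;
the second is Spitzer's identity (\<open>killed_max_transform_spitzer\<close>). Fourier inversion of the kernel
\<open>exp (- z x) - exp (- x)\<close>, \<open>x > 0\<close>, writes \<open>P(z) - P(1)\<close> as a Cauchy integral of
\<open>ln (1 - q \<chi>)\<close> (\<open>killed_max_transform_formula\<close>).

\<^bold>\<open>The limit.\<close> Rounding the exponential time up to the grid makes the grid maxima converge to the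
supremum along every cadlag path (\<open>grid_max_tendsto_sup\<close>). As \<open>h\<close> tends to \<open>0\<close>,
\<open>(1 - q \<chi>) / h\<close> tends to \<open>1 + \<Psi>\<close>, and dominated convergence gives the displayed formula.

\<^bold>\<open>The function F.\<close> Each of the half-lines \<open>s > 0\<close> and \<open>s < 0\<close> is treated in the variable
\<open>y = ln \<bar>s\<bar>\<close>. There the integral defining \<open>F\<close> runs over a horizontal line, and moving that line vertically by
\<open>\<plusminus> \<pi> (1/2 - \<rho>)\<close>, that is, rotating the ray, replaces the real power \<open>e\<^sup>\<alpha>\<^sup>y\<close> by \<open>\<Psi> (\<plusminus> e\<^sup>y)\<close>
(\<open>F_integral_rotated\<close>, \<open>log_kernel_half_line\<close>). The two half-lines contribute the two values of \<open>F\<close>.\<close>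

section \<open>Differentiation under the integral and shifts of horizontal contours\<close>

lemma integrable_dominated:
  fixes f :: "'a \<Rightarrow> 'b::{banach, second_countable_topology}" and g :: "'a \<Rightarrow> real"
  assumes "integrable M g" "f \<in> borel_measurable M" "\<And>x. norm (f x) \<le> g x"
  shows "integrable M f"
proof (rule Bochner_Integration.integrable_bound[OF assms(1,2)])
  show "AE x in M. norm (f x) \<le> norm (g x)"
    unfolding real_norm_def by (intro AE_I2 order_trans[OF assms(3) abs_ge_self])
qed

text \<open>The bound on the derivative bounds the difference quotients as well, by the mean value
inequality on a ball, so dominated convergence applies to them.\<close>

lemma has_field_derivative_integral_dominated:
  fixes f f' :: "complex \<Rightarrow> 'a \<Rightarrow> complex"
  assumes S: "open S" "z \<in> S"
    and der: "\<And>w x. w \<in> S \<Longrightarrow> ((\<lambda>w. f w x) has_field_derivative f' w x) (at w)"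
    and bound: "\<And>w x. w \<in> S \<Longrightarrow> norm (f' w x) \<le> g x"
    and g: "integrable M g"
    and f: "\<And>w. w \<in> S \<Longrightarrow> integrable M (f w)"
  shows "((\<lambda>w. \<integral>x. f w x \<partial>M) has_field_derivative (\<integral>x. f' z x \<partial>M)) (at z)"
proof -
  obtain r where r: "0 < r" "ball z r \<subseteq> S"
    using S openE by blast
  have quot_lim: "(\<lambda>n. (f (X n) x - f z x) / (X n - z)) \<longlonglongrightarrow> f' z x"
    if X: "\<And>n. X n \<noteq> z" "X \<longlonglongrightarrow> z" for X :: "nat \<Rightarrow> complex" and x
  proof -
    have "((\<lambda>w. (f w x - f z x) / (w - z)) \<longlongrightarrow> f' z x) (at z)"
      using der[OF S(2)] by (simp add: has_field_derivative_iff)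
    then show ?thesis
      using X unfolding tendsto_at_iff_sequentially comp_def by auto
  qed
  have meas: "(\<lambda>x. (f w x - f z x) / (w - z)) \<in> borel_measurable M" if "w \<in> S" for w
    using f[OF that] f[OF S(2)] by (intro borel_measurable_divide borel_measurable_diff) auto
  have inner: "z + of_real (r / (real n + 2)) \<in> S" for n
  proof -
    have "r / (real n + 2) < r" using r by (simp add: field_simps add_pos_nonneg)
    moreover have "dist z (z + of_real (r / (real n + 2))) = r / (real n + 2)"
      using r by (simp only: dist_norm) (simp del: of_real_divide)
    ultimately show ?thesis by (intro subsetD[OF r(2)]) (simp del: of_real_divide)
  qed
  have f'meas: "f' z \<in> borel_measurable M"
  proof (rule borel_measurable_LIMSEQ_metric)
    show "(\<lambda>n. (f (z + of_real (r / (real n + 2))) x - f z x) / ((z + of_real (r / (real n + 2))) - z)) \<longlonglongrightarrow> f' z x" for x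
    proof (rule quot_lim)
      show "z + of_real (r / (real n + 2)) \<noteq> z" for n
        using r by (simp del: of_real_divide)
      have "(\<lambda>n. r / (real n + 2)) \<longlonglongrightarrow> 0" by real_asymp
      then have "(\<lambda>n. z + of_real (r / (real n + 2))) \<longlonglongrightarrow> z + of_real 0"
        by (intro tendsto_intros)
      then show "(\<lambda>n. z + of_real (r / (real n + 2))) \<longlonglongrightarrow> z" by simp
    qed
    show "(\<lambda>x. (f (z + of_real (r / (real n + 2))) x - f z x) / ((z + of_real (r / (real n + 2))) - z))
        \<in> borel_measurable M" for n
      by (rule meas[OF inner])
  qed
  have qbound: "norm ((f w x - f z x) / (w - z)) \<le> g x" if "w \<in> ball z r" for w x
  proof (cases "w = z")
    case True
    then show ?thesis using order_trans[OF norm_ge_zero bound[OF S(2)]] by simp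
  next
    case False
    have "norm (f w x - f z x) \<le> g x * norm (w - z)"
      by (rule field_differentiable_bound[where S = "ball z r" and f' = "\<lambda>w. f' w x"])
         (use that r bound in \<open>auto intro!: has_field_derivative_at_within der\<close>)
    then show ?thesis using False by (simp add: norm_divide divide_le_eq)
  qed
  have "((\<lambda>w. ((\<integral>x. f w x \<partial>M) - (\<integral>x. f z x \<partial>M)) / (w - z)) \<longlongrightarrow> (\<integral>x. f' z x \<partial>M)) (at z)"
    unfolding tendsto_at_iff_sequentially comp_def
  proof (intro allI impI)
    fix X :: "nat \<Rightarrow> complex" assume X: "\<forall>i. X i \<in> UNIV - {z}" "X \<longlonglongrightarrow> z"
    have "eventually (\<lambda>n. X n \<in> ball z r) sequentially"
      using X(2) r(1) by (intro topological_tendstoD) auto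
    then obtain N where N: "\<And>n. n \<ge> N \<Longrightarrow> X n \<in> ball z r"
      unfolding eventually_sequentially by auto
    have XN: "X (n + N) \<in> ball z r" for n by (rule N) simp
    have "(\<lambda>n. \<integral>x. (f (X (n + N)) x - f z x) / (X (n + N) - z) \<partial>M) \<longlonglongrightarrow> (\<integral>x. f' z x \<partial>M)"
    proof (rule integral_dominated_convergence[where w = g])
      show "AE x in M. (\<lambda>n. (f (X (n + N)) x - f z x) / (X (n + N) - z)) \<longlonglongrightarrow> f' z x"
        using X by (intro AE_I2 quot_lim) (auto intro: LIMSEQ_ignore_initial_segment)
      show "AE x in M. norm ((f (X (n + N)) x - f z x) / (X (n + N) - z)) \<le> g x" for n
        by (intro AE_I2 qbound XN)
      show "(\<lambda>x. (f (X (n + N)) x - f z x) / (X (n + N) - z)) \<in> borel_measurable M" for n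
        using XN r by (intro meas) auto
    qed (use g f'meas in auto)
    moreover have "(\<integral>x. (f (X (n + N)) x - f z x) / (X (n + N) - z) \<partial>M)
        = ((\<integral>x. f (X (n + N)) x \<partial>M) - (\<integral>x. f z x \<partial>M)) / (X (n + N) - z)" for n
    proof -
      have "X (n + N) \<in> S" using XN r by auto
      then show ?thesis using f S by simp
    qed
    ultimately have "(\<lambda>n. ((\<integral>x. f (X (n + N)) x \<partial>M) - (\<integral>x. f z x \<partial>M)) / (X (n + N) - z)) \<longlonglongrightarrow> (\<integral>x. f' z x \<partial>M)"
      by (simp only:)
    then show "(\<lambda>n. ((\<integral>x. f (X n) x \<partial>M) - (\<integral>x. f z x \<partial>M)) / (X n - z)) \<longlonglongrightarrow> (\<integral>x. f' z x \<partial>M)"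
      by (rule LIMSEQ_offset)
  qed
  then show ?thesis by (simp add: has_field_derivative_iff)
qed

text \<open>As a function of a complex shift \<open>w\<close>, the integral of \<open>g (x + w)\<close> over real \<open>x\<close> is invariant under real
shifts and holomorphic, so its derivative is zero. The Harnack-type condition on \<open>B\<close> lets Cauchy's
estimate bound \<open>deriv g\<close> by the same integrable majorant; no vertical segments have to be estimated.\<close>

lemma integral_horizontal_line_invariant:
  fixes g :: "complex \<Rightarrow> complex" and B :: "real \<Rightarrow> real"
  assumes holo: "g holomorphic_on {w. a < Im w \<and> Im w < b}"
    and bound: "\<And>w. a < Im w \<Longrightarrow> Im w < b \<Longrightarrow> norm (g w) \<le> B (Re w)"
    and B: "integrable lborel B"
    and harnack: "\<And>x y. \<bar>x - y\<bar> \<le> 1 \<Longrightarrow> B y \<le> K * B x"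
    and s: "a < s" "s < b" and t: "a < t" "t < b"
  shows "(CLINT x|lborel. g (of_real x + \<i> * of_real s)) = (CLINT x|lborel. g (of_real x + \<i> * of_real t))"
proof -
  define U where "U = {w. a < Im w \<and> Im w < b}"
  have "U = {w. a < Im w} \<inter> {w. Im w < b}" by (auto simp: U_def)
  then have U: "open U" "convex U"
    by (simp_all add: open_Int open_halfspace_Im_gt open_halfspace_Im_lt convex_Int
        convex_halfspace_Im_gt convex_halfspace_Im_lt)
  have cont: "continuous_on U g" using holo by (simp add: U_def holomorphic_on_imp_continuous_on)
  have line: "of_real x + w \<in> U" if "w \<in> U" for w and x :: real using that by (simp add: U_def)
  have meas: "(\<lambda>x. g (of_real x + w)) \<in> borel_measurable borel" if "w \<in> U" for w
    using that by (intro borel_measurable_continuous_onI continuous_intros continuous_on_compose2[OF cont])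
       (auto intro: line)
  have shift: "integrable lborel (\<lambda>x. B (x + r))" for r
    using lborel_integrable_real_affine[OF B, of 1 r] by (simp add: add.commute)
  have int: "integrable lborel (\<lambda>x. g (of_real x + w))" if "w \<in> U" for w
    by (rule integrable_dominated[OF shift[of "Re w"]])
       (use that meas bound[of "of_real _ + w"] in \<open>auto simp: U_def\<close>)
  define J where "J w = (CLINT x|lborel. g (of_real x + w))" for w
  have J_real: "J (w + of_real r) = J w" if "w \<in> U" for w r
  proof -
    have "J w = (CLINT x|lborel. g (of_real (r + 1 * x) + w))"
      unfolding J_def using lborel_integral_real_affine[of 1 "\<lambda>x. g (of_real x + w)" r] by simp
    also have "\<dots> = J (w + of_real r)"
      unfolding J_def by (intro Bochner_Integration.integral_cong) (auto simp: algebra_simps)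
    finally show ?thesis ..
  qed
  have der: "\<exists>D. (J has_field_derivative D) (at w)" if w: "w \<in> U" for w
  proof -
    obtain r0 where r0: "0 < r0" "cball w r0 \<subseteq> U" using U(1) w open_contains_cball by blast
    define r where "r = min (1/2) (r0 / 2)"
    have r: "0 < r" "r \<le> 1/2" "2 * r \<le> r0" using r0 by (auto simp: r_def)
    have sub: "ball w (2 * r) \<subseteq> U" using r r0 by force
    have cb: "cball v r \<subseteq> U" if "v \<in> ball w r" for v
    proof
      fix u assume "u \<in> cball v r"
      then have "dist w u < 2 * r" using that dist_triangle[of w u v] by auto
      then show "u \<in> U" using sub by auto
    qed
    have gder: "(g has_field_derivative deriv g v) (at v)" if "v \<in> U" for v
      using holo U that holomorphic_derivI unfolding U_def by blast
    have "(J has_field_derivative (CLINT x|lborel. deriv g (of_real x + w))) (at w)"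
      unfolding J_def
    proof (rule has_field_derivative_integral_dominated[where S = "ball w r" and g = "\<lambda>x. K * B (x + Re w) / r"])
      show "((\<lambda>v. g (of_real x + v)) has_field_derivative deriv g (of_real x + v)) (at v)"
        if "v \<in> ball w r" for v and x :: real
      proof -
        have "v \<in> U" using cb[OF that] r by auto
        then show ?thesis
          using gder[OF line[OF \<open>v \<in> U\<close>, of x]] DERIV_shift[of g "deriv g (of_real x + v)" v "of_real x"]
          by (simp add: add.commute)
      qed
      show "norm (deriv g (of_real x + v)) \<le> K * B (x + Re w) / r"
        if v: "v \<in> ball w r" for v and x :: real
      proof -
        have cbU: "cball (of_real x + v) r \<subseteq> U"
        proof
          fix u assume "u \<in> cball (of_real x + v) r"
          then have "u - of_real x \<in> cball v r" by (simp add: dist_norm algebra_simps)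
          then have "of_real x + (u - of_real x) \<in> U" using cb[OF v] line by blast
          then show "u \<in> U" by simp
        qed
        have "norm ((deriv ^^ 1) g (of_real x + v)) \<le> fact 1 * (K * B (x + Re w)) / r ^ 1"
        proof (rule Cauchy_inequality)
          show "g holomorphic_on ball (of_real x + v) r"
            using holo cbU ball_subset_cball holomorphic_on_subset unfolding U_def[symmetric] by blast
          show "continuous_on (cball (of_real x + v) r) g"
            using cont cbU continuous_on_subset by blast
          show "norm (g u) \<le> K * B (x + Re w)" if u: "norm (of_real x + v - u) = r" for u
          proof -
            have "u \<in> U" using cbU u by (auto simp: dist_norm)
            then have "norm (g u) \<le> B (Re u)" using bound by (auto simp: U_def)
            also have "\<bar>x + Re w - Re u\<bar> \<le> 1"
            proof -
              have "\<bar>Re (of_real x + v - u)\<bar> \<le> r" using abs_Re_le_cmod[of "of_real x + v - u"] u by simp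
              moreover have "\<bar>Re (w - v)\<bar> \<le> r" using abs_Re_le_cmod[of "w - v"] v by (simp add: dist_norm)
              ultimately show ?thesis using r by (simp)
            qed
            then have "B (Re u) \<le> K * B (x + Re w)" by (rule harnack)
            finally show ?thesis .
          qed
        qed (use r in auto)
        then show ?thesis by simp
      qed
      show "integrable lborel (\<lambda>x. K * B (x + Re w) / r)" using shift by simp
      show "integrable lborel (\<lambda>x. g (of_real x + v))" if "v \<in> ball w r" for v
        using that cb[OF that] r by (intro int) auto
    qed (use r in auto)
    then show ?thesis by blast
  qed
  \<comment> \<open>The derivative of J is also its derivative in the real direction, where J is constant.\<close>
  have der0: "(J has_field_derivative 0) (at w)" if w: "w \<in> U" for w
  proof -
    obtain D where D: "(J has_field_derivative D) (at w)" using der[OF w] by blast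
    have "((\<lambda>r::real. J (w + of_real r)) has_vector_derivative D) (at 0)"
    proof -
      have "((\<lambda>r. w + of_real r) has_vector_derivative 1) (at (0::real))"
        by (auto intro!: derivative_eq_intros)
      moreover have "(J has_field_derivative D) (at (w + of_real 0) within (\<lambda>r. w + of_real r) ` UNIV)"
        using D by (simp add: has_field_derivative_at_within)
      ultimately show ?thesis
        using field_vector_diff_chain_within[of "\<lambda>r. w + of_real r" 1 0 UNIV J D] by (simp add: comp_def)
    qed
    then have "((\<lambda>r::real. J w) has_vector_derivative D) (at 0)"
      by (simp add: J_real[OF w])
    then have "D = 0" using vector_derivative_unique_at has_vector_derivative_const by blast
    then show ?thesis using D by simp
  qed
  have "\<exists>c. \<forall>w\<in>U. J w = c"
    by (rule has_field_derivative_zero_constant[OF U(2)]) (auto intro: has_field_derivative_at_within der0)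
  moreover have "\<i> * of_real s \<in> U" "\<i> * of_real t \<in> U" using s t by (auto simp: U_def)
  ultimately have "J (\<i> * of_real s) = J (\<i> * of_real t)" by metis
  then show ?thesis by (simp add: J_def)
qed

section \<open>Resolvent kernels on the imaginary axis\<close>

lemma integrable_inverse_quadratic: "integrable lborel (\<lambda>s::real. 1 / (1 + s\<^sup>2))"
  using integrable_inverse_1_plus_square by (simp add: set_integrable_def inverse_eq_divide einterval_def)

lemma quadratic_le_resolvent:
  assumes "0 < Re w"
  shows "1 + s\<^sup>2 \<le> (2 + (1 + 2 * (norm w)\<^sup>2) / (Re w)\<^sup>2) * (norm (w + \<i> * of_real s))\<^sup>2"
proof -
  have eq: "(norm (w + \<i> * of_real s))\<^sup>2 = (Re w)\<^sup>2 + (Im w + s)\<^sup>2"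
    by (simp add: cmod_power2)
  have "s\<^sup>2 = ((Im w + s) + (- Im w))\<^sup>2" by simp
  also have "\<dots> \<le> 2 * (Im w + s)\<^sup>2 + 2 * (Im w)\<^sup>2"
    using zero_le_power2[of "(Im w + s) + Im w"] by (simp add: power2_eq_square algebra_simps)
  also have "(Im w)\<^sup>2 \<le> (norm w)\<^sup>2" by (simp add: cmod_power2)
  finally have "s\<^sup>2 \<le> 2 * (Im w + s)\<^sup>2 + 2 * (norm w)\<^sup>2" by simp
  then have "1 + s\<^sup>2 \<le> 2 * (norm (w + \<i> * of_real s))\<^sup>2 + (1 + 2 * (norm w)\<^sup>2)"
    unfolding eq using zero_le_power2[of "Re w"] by (simp only: distrib_left)
  also have "1 + 2 * (norm w)\<^sup>2 \<le> (1 + 2 * (norm w)\<^sup>2) / (Re w)\<^sup>2 * (norm (w + \<i> * of_real s))\<^sup>2"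
  proof -
    have "1 \<le> (norm (w + \<i> * of_real s))\<^sup>2 / (Re w)\<^sup>2" using assms by (simp add: eq field_simps)
    then have "(1 + 2 * (norm w)\<^sup>2) * 1 \<le> (1 + 2 * (norm w)\<^sup>2) * ((norm (w + \<i> * of_real s))\<^sup>2 / (Re w)\<^sup>2)"
      by (intro mult_left_mono) auto
    then show ?thesis by simp
  qed
  finally show ?thesis by (simp add: algebra_simps)
qed

text \<open>The uniformity in \<open>w\<close> supplies one integrable majorant for all parameters near \<open>z\<close> when
Cauchy integrals are differentiated.\<close>

lemma resolvent_bound_locally_uniform:
  assumes "0 < Re z"
  obtains S K where "open S" "z \<in> S" "S \<subseteq> {w. 0 < Re w}" "0 < K"
    "\<And>w s. w \<in> S \<Longrightarrow> 1 + s\<^sup>2 \<le> K * (norm (w + \<i> * of_real s))\<^sup>2"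
proof
  define R where "R = Re z / 2"
  define Q where "Q = norm z + 1"
  define S where "S = {w. R < Re w} \<inter> ball 0 Q"
  have R: "0 < R" using assms by (simp add: R_def)
  show "open S" by (auto simp: S_def open_halfspace_Re_gt)
  show "z \<in> S" using assms by (auto simp: S_def R_def Q_def)
  show "S \<subseteq> {w. 0 < Re w}" using R by (auto simp: S_def)
  show "0 < 2 + (1 + 2 * Q\<^sup>2) / R\<^sup>2" by (auto intro!: add_pos_nonneg)
  show "1 + s\<^sup>2 \<le> (2 + (1 + 2 * Q\<^sup>2) / R\<^sup>2) * (norm (w + \<i> * of_real s))\<^sup>2" if "w \<in> S" for w s
  proof -
    have w: "R < Re w" "norm w \<le> Q" using that by (auto simp: S_def)
    have "(norm w)\<^sup>2 \<le> Q\<^sup>2" "R\<^sup>2 \<le> (Re w)\<^sup>2" using w R by (auto intro: power_mono)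
    then have "(1 + 2 * (norm w)\<^sup>2) / (Re w)\<^sup>2 \<le> (1 + 2 * Q\<^sup>2) / R\<^sup>2"
      using R by (intro frac_le) auto
    then have "(2 + (1 + 2 * (norm w)\<^sup>2) / (Re w)\<^sup>2) * (norm (w + \<i> * of_real s))\<^sup>2
       \<le> (2 + (1 + 2 * Q\<^sup>2) / R\<^sup>2) * (norm (w + \<i> * of_real s))\<^sup>2"
      by (intro mult_right_mono) auto
    with quadratic_le_resolvent[of w s] show ?thesis using w R by linarith
  qed
qed

lemma resolvent_nonzero: "0 < Re z \<Longrightarrow> z + \<i> * of_real s \<noteq> 0"
  by (auto simp: complex_eq_iff)

text \<open>The kernel \<open>1 / (z + is)\<close> alone decays too slowly to be integrable; subtracting its value at
\<open>z = 1\<close> gives quadratic decay and changes a Cauchy integral only by a constant.\<close>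

definition resolvent_diff :: "complex \<Rightarrow> real \<Rightarrow> complex" where
  "resolvent_diff z s = 1 / (z + \<i> * of_real s) - 1 / (1 + \<i> * of_real s)"

lemma resolvent_diff_bound:
  assumes "0 < Re z"
  obtains C where "0 < C" "\<And>s. norm (resolvent_diff z s) \<le> C / (1 + s\<^sup>2)"
proof -
  obtain S K where K: "z \<in> S" "0 < K"
    "\<And>w s. w \<in> S \<Longrightarrow> 1 + s\<^sup>2 \<le> K * (norm (w + \<i> * of_real s))\<^sup>2"
    using resolvent_bound_locally_uniform[OF assms] by metis
  have bound: "norm (resolvent_diff z s) \<le> (norm (z - 1) * sqrt K + 1) / (1 + s\<^sup>2)" for s
  proof -
    have p: "0 < 1 + s\<^sup>2" by (auto intro: add_pos_nonneg)
    have nz: "z + \<i> * of_real s \<noteq> 0" "1 + \<i> * of_real s \<noteq> 0"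
      using assms by (auto intro!: resolvent_nonzero)
    have one: "norm (1 + \<i> * of_real s) = sqrt (1 + s\<^sup>2)" by (simp add: cmod_def)
    have "sqrt (1 + s\<^sup>2) \<le> sqrt (K * (norm (z + \<i> * of_real s))\<^sup>2)"
      using K by (intro real_sqrt_le_mono) auto
    also have "\<dots> = sqrt K * norm (z + \<i> * of_real s)" by (simp add: real_sqrt_mult)
    finally have zK: "sqrt (1 + s\<^sup>2) \<le> sqrt K * norm (z + \<i> * of_real s)" .
    have "norm (resolvent_diff z s) = norm (z - 1) / (norm (z + \<i> * of_real s) * sqrt (1 + s\<^sup>2))"
      unfolding resolvent_diff_def using nz
      by (simp add: diff_frac_eq norm_divide norm_mult one norm_minus_commute)
    also have "\<dots> \<le> norm (z - 1) * sqrt K / (1 + s\<^sup>2)"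
    proof -
      have "(1 + s\<^sup>2) = sqrt (1 + s\<^sup>2) * sqrt (1 + s\<^sup>2)" by simp
      also have "\<dots> \<le> (sqrt K * norm (z + \<i> * of_real s)) * sqrt (1 + s\<^sup>2)"
        using zK by (intro mult_right_mono) auto
      finally have "norm (z - 1) * (1 + s\<^sup>2) \<le> norm (z - 1) * (sqrt K * norm (z + \<i> * of_real s) * sqrt (1 + s\<^sup>2))"
        by (intro mult_left_mono) auto
      then show ?thesis using nz p by (simp add: field_simps)
    qed
    also have "\<dots> \<le> (norm (z - 1) * sqrt K + 1) / (1 + s\<^sup>2)"
      using p by (intro divide_right_mono) auto
    finally show ?thesis .
  qed
  show ?thesis
    by (rule that[OF _ bound]) (use K in \<open>auto intro!: add_nonneg_pos\<close>)
qed

lemma resolvent_diff_measurable [measurable]: "resolvent_diff z \<in> borel_measurable borel"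
  unfolding resolvent_diff_def[abs_def] by measurable

lemma integrable_mult_resolvent_diff:
  assumes "0 < Re z" and m[measurable]: "m \<in> borel_measurable lborel"
    and "integrable lborel (\<lambda>s. norm (m s) / (1 + s\<^sup>2))"
  shows "integrable lborel (\<lambda>s. m s * resolvent_diff z s)"
proof -
  obtain C where C: "0 < C" "\<And>s. norm (resolvent_diff z s) \<le> C / (1 + s\<^sup>2)"
    using resolvent_diff_bound[OF assms(1)] by blast
  show ?thesis
  proof (rule integrable_dominated)
    show "integrable lborel (\<lambda>s. C * (norm (m s) / (1 + s\<^sup>2)))"
      using assms(3) by (rule integrable_mult_right)
    fix s
    have "norm (m s * resolvent_diff z s) \<le> norm (m s) * (C / (1 + s\<^sup>2))"
      unfolding norm_mult using C by (intro mult_left_mono) auto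
    then show "norm (m s * resolvent_diff z s) \<le> C * (norm (m s) / (1 + s\<^sup>2))"
      by (simp add: mult.commute)
  qed (use m in measurable)
qed

lemma norm_mult_resolvent_sq_le:
  assumes K: "1 + s\<^sup>2 \<le> K * (norm (z + \<i> * of_real s))\<^sup>2" and z: "0 < Re z"
  shows "norm (a / (z + \<i> * of_real s)\<^sup>2) \<le> K * (norm a / (1 + s\<^sup>2))"
proof -
  have "0 < 1 + s\<^sup>2" by (auto intro: add_pos_nonneg)
  then have "1 / (norm (z + \<i> * of_real s))\<^sup>2 \<le> K / (1 + s\<^sup>2)"
    using K resolvent_nonzero[OF z, of s] by (simp add: field_simps)
  then have "norm a * (1 / (norm (z + \<i> * of_real s))\<^sup>2) \<le> norm a * (K / (1 + s\<^sup>2))"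
    by (intro mult_left_mono) auto
  then show ?thesis by (simp add: norm_divide norm_power mult.commute)
qed

lemma integrable_mult_resolvent_sq:
  assumes z: "0 < Re z" and m [measurable]: "m \<in> borel_measurable lborel"
    and int: "integrable lborel (\<lambda>s. norm (m s) / (1 + s\<^sup>2))"
  shows "integrable lborel (\<lambda>s. m s / (z + \<i> * of_real s)\<^sup>2)"
proof -
  obtain S K where K: "z \<in> S" "\<And>w s. w \<in> S \<Longrightarrow> 1 + s\<^sup>2 \<le> K * (norm (w + \<i> * of_real s))\<^sup>2"
    using resolvent_bound_locally_uniform[OF z] by metis
  show ?thesis
    by (rule integrable_dominated[OF integrable_mult_right[OF int, of K] _ norm_mult_resolvent_sq_le[OF K(2)[OF K(1)] z]])
       measurable
qed

lemma cauchy_transform_deriv: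
  assumes z: "0 < Re z" and m [measurable]: "m \<in> borel_measurable lborel"
    and int: "integrable lborel (\<lambda>s. norm (m s) / (1 + s\<^sup>2))"
  shows "((\<lambda>w. CLINT s|lborel. m s * resolvent_diff w s) has_field_derivative
     - (CLINT s|lborel. m s / (z + \<i> * of_real s)\<^sup>2)) (at z)"
proof -
  obtain S K where S: "open S" "z \<in> S" "S \<subseteq> {w. 0 < Re w}"
    "\<And>w s. w \<in> S \<Longrightarrow> 1 + s\<^sup>2 \<le> K * (norm (w + \<i> * of_real s))\<^sup>2"
    using resolvent_bound_locally_uniform[OF z] by metis
  have "((\<lambda>w. CLINT s|lborel. m s * resolvent_diff w s) has_field_derivative
     (CLINT s|lborel. - (m s / (z + \<i> * of_real s)\<^sup>2))) (at z)"
  proof (rule has_field_derivative_integral_dominated[OF S(1,2)])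
    show "integrable lborel (\<lambda>s. K * (norm (m s) / (1 + s\<^sup>2)))"
      using int by (rule integrable_mult_right)
    fix w :: complex and s :: real assume w: "w \<in> S"
    then have Rew: "0 < Re w" using S(3) by auto
    show "((\<lambda>w. m s * resolvent_diff w s) has_field_derivative - (m s / (w + \<i> * of_real s)\<^sup>2)) (at w)"
      unfolding resolvent_diff_def using resolvent_nonzero[OF Rew]
      by (auto intro!: derivative_eq_intros simp: power2_eq_square)
    show "norm (- (m s / (w + \<i> * of_real s)\<^sup>2)) \<le> K * (norm (m s) / (1 + s\<^sup>2))"
      unfolding norm_minus_cancel by (rule norm_mult_resolvent_sq_le[OF S(4)[OF w] Rew])
  next
    show "integrable lborel (\<lambda>s. m s * resolvent_diff w s)" if "w \<in> S" for w
      using that S(3) by (intro integrable_mult_resolvent_diff int m) auto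
  qed
  then show ?thesis by simp
qed

lemma integral_inverse_quadratic_squared:
  "has_bochner_integral lborel (\<lambda>u::real. u\<^sup>2 / (1 + u\<^sup>2)\<^sup>2) (pi / 2)"
proof -
  have p: "1 + u\<^sup>2 \<noteq> 0" for u :: real by (metis add_pos_nonneg zero_le_power2 less_irrefl zero_less_one)
  have "has_bochner_integral lborel (\<lambda>x. indicator (einterval (-\<infinity>) \<infinity>) x *\<^sub>R (x\<^sup>2 / (1 + x\<^sup>2)\<^sup>2)) (pi/4 - (- pi/4))"
    unfolding has_bochner_integral_iff set_integrable_def[symmetric] set_lebesgue_integral_def[symmetric]
  proof
    let ?F = "\<lambda>u::real. (arctan u - u / (1 + u\<^sup>2)) / 2"
    have der: "DERIV ?F x :> x\<^sup>2 / (1 + x\<^sup>2)\<^sup>2" for x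
    proof -
      have "DERIV ?F x :> (inverse (1 + x\<^sup>2) - ((1 + x\<^sup>2) - x * (2 * x)) / ((1 + x\<^sup>2) * (1 + x\<^sup>2))) / 2"
        using p by (auto intro!: derivative_eq_intros simp: power2_eq_square)
      also have "(inverse (1 + x\<^sup>2) - ((1 + x\<^sup>2) - x * (2 * x)) / ((1 + x\<^sup>2) * (1 + x\<^sup>2))) / 2 = x\<^sup>2 / (1 + x\<^sup>2)\<^sup>2"
        using p[of x] by (simp add: divide_simps) (simp add: algebra_simps power2_eq_square)
      finally show ?thesis .
    qed
    have lim1: "((?F \<circ> real_of_ereal) \<longlongrightarrow> - pi/4) (at_right (-\<infinity>))"
      unfolding ereal_tendsto_simps
    proof -
      have "((\<lambda>u::real. u / (1 + u\<^sup>2)) \<longlongrightarrow> 0) at_bot" by real_asymp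
      then have "(?F \<longlongrightarrow> (- (pi/2) - 0) / 2) at_bot" by (intro tendsto_intros tendsto_arctan_at_bot) auto
      then show "(?F \<longlongrightarrow> - pi/4) at_bot" by simp
    qed
    have lim2: "((?F \<circ> real_of_ereal) \<longlongrightarrow> pi/4) (at_left \<infinity>)"
      unfolding ereal_tendsto_simps
    proof -
      have "((\<lambda>u::real. u / (1 + u\<^sup>2)) \<longlongrightarrow> 0) at_top" by real_asymp
      then have "(?F \<longlongrightarrow> (pi/2 - 0) / 2) at_top" by (intro tendsto_intros tendsto_arctan_at_top) auto
      then show "(?F \<longlongrightarrow> pi/4) at_top" by simp
    qed
    have cont: "isCont (\<lambda>x::real. x\<^sup>2 / (1 + x\<^sup>2)\<^sup>2) x" for x using p by (intro continuous_intros) auto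
    show "set_integrable lborel (einterval (-\<infinity>) \<infinity>) (\<lambda>x::real. x\<^sup>2 / (1 + x\<^sup>2)\<^sup>2)"
      by (rule interval_integral_FTC_nonneg(1)[OF _ der cont _ lim1 lim2]) auto
    have "(LBINT x=-\<infinity>..\<infinity>. x\<^sup>2 / (1 + x\<^sup>2)\<^sup>2) = pi/4 - (- pi/4)"
      by (rule interval_integral_FTC_nonneg(2)[OF _ der cont _ lim1 lim2]) auto
    then show "(LBINT x:einterval (-\<infinity>) \<infinity>. x\<^sup>2 / (1 + x\<^sup>2)\<^sup>2) = pi/4 - (- pi/4)"
      by (simp add: interval_lebesgue_integral_def)
  qed
  then show ?thesis by simp
qed

section \<open>Fourier inversion of the resolvent kernel\<close>

lemma inverse_quadratic_harnack:
  fixes x y :: real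
  assumes "\<bar>x - y\<bar> \<le> 1" "0 \<le> C"
  shows "C / (1 + y\<^sup>2) \<le> 3 * (C / (1 + x\<^sup>2))"
proof -
  have p: "0 < 1 + x\<^sup>2" "0 < 1 + y\<^sup>2" by (auto intro: add_pos_nonneg)
  have "(x - y)\<^sup>2 \<le> 1" using assms by (simp add: abs_square_le_1)
  moreover have "x\<^sup>2 \<le> 2 * y\<^sup>2 + 2 * (x - y)\<^sup>2"
    using zero_le_power2[of "x - 2 * y"] by (simp add: power2_eq_square algebra_simps)
  ultimately have "x\<^sup>2 \<le> 2 * y\<^sup>2 + 2 * 1" by (meson add_left_mono mult_left_mono order_trans zero_le_numeral)
  then have "1 + x\<^sup>2 \<le> 3 + 2 * y\<^sup>2" by simp
  also have "\<dots> \<le> 3 * (1 + y\<^sup>2)" by simp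
  finally have "1 + x\<^sup>2 \<le> 3 * (1 + y\<^sup>2)" .
  then have "C * (1 + x\<^sup>2) \<le> C * (3 * (1 + y\<^sup>2))" using assms by (intro mult_left_mono)
  then show ?thesis using p by (simp add: field_simps)
qed

text \<open>With \<open>w = s - ic\<close> both sides are integrals of \<open>exp (iwx) / (iw)\<^sup>2\<close> over horizontal lines below the
pole at \<open>0\<close>.\<close>

lemma fourier_kernel_shift:
  assumes c: "0 < c" and d: "0 < d"
  shows "exp (of_real (c * x)) * (CLINT s|lborel. exp (\<i> * of_real (s * x)) / (of_real c + \<i> * of_real s)\<^sup>2)
       = exp (of_real (d * x)) * (CLINT s|lborel. exp (\<i> * of_real (s * x)) / (of_real d + \<i> * of_real s)\<^sup>2)"
proof -
  define g where "g w = exp (\<i> * w * of_real x) / (\<i> * w)\<^sup>2" for w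
  define \<epsilon> where "\<epsilon> = min 1 (min c d) / 2"
  define b where "b = max c d + 1"
  have e: "0 < \<epsilon>" "\<epsilon> \<le> 1" "\<epsilon> < c" "\<epsilon> < d" "c < b" "d < b" using c d by (auto simp: \<epsilon>_def b_def)
  define C where "C = exp (b * \<bar>x\<bar>) / \<epsilon>\<^sup>2"
  have C: "0 < C" using e by (simp add: C_def)
  have eq: "(CLINT s|lborel. g (of_real s + \<i> * of_real (- c)))
     = exp (of_real (c * x)) * (CLINT s|lborel. exp (\<i> * of_real (s * x)) / (of_real c + \<i> * of_real s)\<^sup>2)" for c
  proof -
    have "g (of_real s + \<i> * of_real (- c)) = exp (of_real (c * x)) * (exp (\<i> * of_real (s * x)) / (of_real c + \<i> * of_real s)\<^sup>2)" for s
    proof -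
      have "\<i> * (of_real s + \<i> * of_real (- c)) * of_real x = of_real (c * x) + \<i> * of_real (s * x)"
        by (simp add: complex_eq_iff)
      moreover have "\<i> * (of_real s + \<i> * of_real (- c)) = of_real c + \<i> * of_real s"
        by (simp add: complex_eq_iff)
      ultimately show ?thesis unfolding g_def by (simp only: exp_add) simp
    qed
    then show ?thesis by (simp only: integral_mult_right_zero)
  qed
  have "(CLINT s|lborel. g (of_real s + \<i> * of_real (- c))) = (CLINT s|lborel. g (of_real s + \<i> * of_real (- d)))"
  proof (rule integral_horizontal_line_invariant[where a = "- b" and b = "- \<epsilon>" and B = "\<lambda>s. C / (1 + s\<^sup>2)" and K = 3])
    show "g holomorphic_on {w. - b < Im w \<and> Im w < - \<epsilon>}"
      unfolding g_def using e by (intro holomorphic_intros) auto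
    show "integrable lborel (\<lambda>s::real. C / (1 + s\<^sup>2))"
      using integrable_mult_right[OF integrable_inverse_quadratic, of C] by simp
    show "C / (1 + v\<^sup>2) \<le> 3 * (C / (1 + u\<^sup>2))" if "\<bar>u - v\<bar> \<le> 1" for u v :: real
      using inverse_quadratic_harnack[OF that] C by simp
    show "norm (g w) \<le> C / (1 + (Re w)\<^sup>2)" if w: "- b < Im w" "Im w < - \<epsilon>" for w
    proof -
      have p: "0 < 1 + (Re w)\<^sup>2" by (auto intro: add_pos_nonneg)
      have "norm (exp (\<i> * w * of_real x)) = exp (- Im w * x)" by simp
      also have "\<dots> \<le> exp (b * \<bar>x\<bar>)"
      proof -
        have "- Im w * x \<le> \<bar>- Im w * x\<bar>" by (rule abs_ge_self)
        also have "\<dots> = (- Im w) * \<bar>x\<bar>" using w e by (simp add: abs_mult)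
        also have "\<dots> \<le> b * \<bar>x\<bar>" using w by (intro mult_right_mono) auto
        finally show ?thesis by simp
      qed
      finally have num: "norm (exp (\<i> * w * of_real x)) \<le> exp (b * \<bar>x\<bar>)" .
      have e2: "\<epsilon>\<^sup>2 \<le> (Im w)\<^sup>2" using power_mono[of \<epsilon> "- Im w" 2] w e by simp
      have e21: "\<epsilon>\<^sup>2 \<le> 1" using e by (simp add: power_le_one)
      have "\<epsilon>\<^sup>2 * (1 + (Re w)\<^sup>2) \<le> (Im w)\<^sup>2 + (Re w)\<^sup>2"
        using e2 mult_right_mono[OF e21, of "(Re w)\<^sup>2"] by (simp add: distrib_left)
      then have den: "\<epsilon>\<^sup>2 * (1 + (Re w)\<^sup>2) \<le> norm ((\<i> * w)\<^sup>2)"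
        by (simp add: norm_power norm_mult cmod_power2)
      have "norm (g w) \<le> exp (b * \<bar>x\<bar>) / (\<epsilon>\<^sup>2 * (1 + (Re w)\<^sup>2))"
        unfolding g_def norm_divide using num den p e by (intro frac_le) auto
      then show ?thesis by (simp add: C_def)
    qed
  qed (use e in auto)
  then show ?thesis unfolding eq .
qed

text \<open>By \<open>fourier_kernel_shift\<close> the integral times \<open>exp (cx)\<close> does not depend on \<open>c\<close>. For \<open>x \<le> 0\<close> it tends to
zero as \<open>c\<close> tends to infinity.\<close>

lemma fourier_kernel_nonpos:
  assumes c: "0 < c" and x: "x \<le> 0"
  shows "(CLINT s|lborel. exp (\<i> * of_real (s * x)) / (of_real c + \<i> * of_real s)\<^sup>2) = 0"
proof -
  define I where "I c = exp (of_real (c * x)) * (CLINT s|lborel. exp (\<i> * of_real (s * x)) / (of_real c + \<i> * of_real s)\<^sup>2)" for c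
  have const: "I (real n + 1) = I c" for n
    unfolding I_def by (rule fourier_kernel_shift) (use c in auto)
  have lim: "(\<lambda>n. CLINT s|lborel. exp (\<i> * of_real (s * x)) / (of_real (real n + 1) + \<i> * of_real s)\<^sup>2) \<longlonglongrightarrow> (CLINT s::real|lborel. 0)"
  proof (rule integral_dominated_convergence[where w = "\<lambda>s. 1 / (1 + s\<^sup>2)"])
    show "AE s in lborel. norm (exp (\<i> * of_real (s * x)) / (of_real (real n + 1) + \<i> * of_real s)\<^sup>2) \<le> 1 / (1 + s\<^sup>2)" for n
    proof (rule AE_I2)
      fix s :: real
      have p: "0 < 1 + s\<^sup>2" by (auto intro: add_pos_nonneg)
      have "1 \<le> (real n + 1)\<^sup>2" using power_mono[of 1 "real n + 1" 2] by simp
      then show "norm (exp (\<i> * of_real (s * x)) / (of_real (real n + 1) + \<i> * of_real s)\<^sup>2) \<le> 1 / (1 + s\<^sup>2)"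
        using p by (auto simp: norm_divide norm_power cmod_power2 intro!: frac_le)
    qed
    show "AE s in lborel. (\<lambda>n. exp (\<i> * of_real (s * x)) / (of_real (real n + 1) + \<i> * of_real s)\<^sup>2) \<longlonglongrightarrow> 0"
    proof (rule AE_I2)
      fix s :: real
      show "(\<lambda>n. exp (\<i> * of_real (s * x)) / (of_real (real n + 1) + \<i> * of_real s)\<^sup>2) \<longlonglongrightarrow> 0"
      proof (rule tendsto_norm_zero_cancel)
        have "(\<lambda>n. 1 / ((real n + 1)\<^sup>2 + s\<^sup>2)) \<longlonglongrightarrow> 0" by real_asymp
        then show "(\<lambda>n. norm (exp (\<i> * of_real (s * x)) / (of_real (real n + 1) + \<i> * of_real s)\<^sup>2)) \<longlonglongrightarrow> 0"
          by (simp add: norm_divide norm_power cmod_power2)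
      qed
    qed
  qed (use integrable_inverse_quadratic in auto)
  have "(\<lambda>n. I (real n + 1)) \<longlonglongrightarrow> 0"
  proof (rule Lim_null_comparison)
    show "eventually (\<lambda>n. norm (I (real n + 1)) \<le> norm (CLINT s|lborel. exp (\<i> * of_real (s * x)) / (of_real (real n + 1) + \<i> * of_real s)\<^sup>2)) sequentially"
    proof (rule always_eventually, rule allI)
      fix n
      have "(real n + 1) * x \<le> 0" using x by (simp add: mult_nonneg_nonpos)
      then have "exp ((real n + 1) * x) \<le> 1" by simp
      then show "norm (I (real n + 1)) \<le> norm (CLINT s|lborel. exp (\<i> * of_real (s * x)) / (of_real (real n + 1) + \<i> * of_real s)\<^sup>2)"
        unfolding I_def norm_mult by (intro mult_left_le_one_le) (auto simp: norm_exp_eq_Re)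
    qed
    show "(\<lambda>n. norm (CLINT s|lborel. exp (\<i> * of_real (s * x)) / (of_real (real n + 1) + \<i> * of_real s)\<^sup>2)) \<longlonglongrightarrow> 0"
      using tendsto_norm[OF lim] by simp
  qed
  then have "(\<lambda>n::nat. I c) \<longlonglongrightarrow> 0" unfolding const .
  then have "I c = 0" using LIMSEQ_const_iff by metis
  then show ?thesis by (simp add: I_def)
qed

text \<open>The reflected integral, with \<open>c - is\<close> for \<open>c + is\<close>, vanishes by \<open>fourier_kernel_nonpos\<close> and may be subtracted.
The difference of the two kernels concentrates at \<open>s = 0\<close> as \<open>c\<close> tends to \<open>0\<close>: after \<open>s = cu\<close>, and
after an odd term that integrates to zero is dropped, the integrand converges, and the limit is \<open>4 x\<close> times the integral of \<open>u\<^sup>2 / (1 + u\<^sup>2)\<^sup>2\<close>. Since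
the integral times \<open>exp (cx)\<close> does not depend on \<open>c\<close>, the limit determines it.\<close>

lemma fourier_kernel_pos:
  assumes c: "0 < c" and x: "0 < x"
  shows "(CLINT s|lborel. exp (\<i> * of_real (s * x)) / (of_real c + \<i> * of_real s)\<^sup>2) = complex_of_real (2 * pi * x) * exp (- complex_of_real (c * x))"
proof -
  define I where "I c = exp (of_real (c * x)) * (CLINT s|lborel. exp (\<i> * of_real (s * x)) / (of_real c + \<i> * of_real s)\<^sup>2)" for c
  define Q where "Q a u = (exp (\<i> * of_real (a * u * x)) - 1) / of_real a * (- 4 * \<i> * of_real u) / of_real ((1 + u\<^sup>2)\<^sup>2)" for a u :: real
  have p: "0 < 1 + u\<^sup>2" for u :: real by (auto intro: add_pos_nonneg)
  have Q_bound: "norm (Q a u) \<le> 4 * x * (u\<^sup>2 / (1 + u\<^sup>2)\<^sup>2)" if "0 < a" for a u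
  proof -
    have "norm (exp (\<i> * of_real (a * u * x)) - 1) \<le> \<bar>a * u * x\<bar>"
      using iexp_approx1[of "a * u * x" 0] by simp
    then have E: "norm (exp (\<i> * of_real (a * u * x)) - 1) / a * (4 * \<bar>u\<bar>) / (1 + u\<^sup>2)\<^sup>2
        \<le> \<bar>a * u * x\<bar> / a * (4 * \<bar>u\<bar>) / (1 + u\<^sup>2)\<^sup>2"
      using that by (intro divide_right_mono mult_right_mono) auto
    have "norm (Q a u) = norm (exp (\<i> * of_real (a * u * x)) - 1) / a * (4 * \<bar>u\<bar>) / (1 + u\<^sup>2)\<^sup>2"
      unfolding Q_def norm_divide norm_mult norm_of_real using that by simp
    also have "\<dots> \<le> \<bar>a * u * x\<bar> / a * (4 * \<bar>u\<bar>) / (1 + u\<^sup>2)\<^sup>2" by (rule E)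
    also have "\<dots> = 4 * x * (u\<^sup>2 / (1 + u\<^sup>2)\<^sup>2)"
      using that x by (simp add: abs_mult power2_eq_square)
    finally show ?thesis .
  qed
  have Q_lim: "(\<lambda>n. Q (c / (real n + 1)) u) \<longlonglongrightarrow> of_real (4 * x * (u\<^sup>2 / (1 + u\<^sup>2)\<^sup>2))" for u
  proof -
    have "(\<lambda>n. (exp (\<i> * of_real (c / (real n + 1) * u * x)) - 1) / of_real (c / (real n + 1)) - \<i> * of_real (u * x)) \<longlonglongrightarrow> 0"
    proof (rule Lim_null_comparison)
      show "eventually (\<lambda>n. norm ((exp (\<i> * of_real (c / (real n + 1) * u * x)) - 1) / of_real (c / (real n + 1)) - \<i> * of_real (u * x))
          \<le> c / (real n + 1) * (u * x)\<^sup>2 / 2) sequentially"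
      proof (rule always_eventually, rule allI)
        fix n
        define a where "a = c / (real n + 1)"
        have a: "0 < a" using c by (simp add: a_def)
        have eq: "(exp (\<i> * of_real (a * u * x)) - 1) / of_real a - \<i> * of_real (u * x)
          = (exp (\<i> * of_real (a * u * x)) - (1 + \<i> * of_real (a * u * x))) / of_real a"
          using a by (simp add: field_simps)
        have "norm (exp (\<i> * of_real (a * u * x)) - (1 + \<i> * of_real (a * u * x))) \<le> (a * u * x)\<^sup>2 / 2"
          using iexp_approx1[of "a * u * x" 1] by (simp add: numeral_2_eq_2)
        then have "norm (exp (\<i> * of_real (a * u * x)) - (1 + \<i> * of_real (a * u * x))) / a \<le> (a * u * x)\<^sup>2 / 2 / a"
          using a by (intro divide_right_mono) auto
        then have "norm ((exp (\<i> * of_real (a * u * x)) - 1) / of_real a - \<i> * of_real (u * x)) \<le> (a * u * x)\<^sup>2 / 2 / a"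
          unfolding eq norm_divide using a by (simp only: norm_of_real abs_of_pos)
        also have "\<dots> = a * (u * x)\<^sup>2 / 2" using a by (simp add: power2_eq_square)
        finally show "norm ((exp (\<i> * of_real (c / (real n + 1) * u * x)) - 1) / of_real (c / (real n + 1)) - \<i> * of_real (u * x))
          \<le> c / (real n + 1) * (u * x)\<^sup>2 / 2" unfolding a_def .
      qed
      show "(\<lambda>n. c / (real n + 1) * (u * x)\<^sup>2 / 2) \<longlonglongrightarrow> 0" by real_asymp
    qed
    then have "(\<lambda>n. (exp (\<i> * of_real (c / (real n + 1) * u * x)) - 1) / of_real (c / (real n + 1))) \<longlonglongrightarrow> \<i> * of_real (u * x)"
      by (rule LIM_zero_cancel)
    then have "(\<lambda>n. Q (c / (real n + 1)) u) \<longlonglongrightarrow> \<i> * of_real (u * x) * (- 4 * \<i> * of_real u) / of_real ((1 + u\<^sup>2)\<^sup>2)"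
      unfolding Q_def by (intro tendsto_divide tendsto_mult tendsto_const) (use p[of u] in \<open>simp_all only: of_real_eq_0_iff, auto\<close>)
    also have "\<i> * of_real (u * x) * (- 4 * \<i> * of_real u) / of_real ((1 + u\<^sup>2)\<^sup>2) = complex_of_real (4 * x * (u\<^sup>2 / (1 + u\<^sup>2)\<^sup>2))"
      by (simp add: complex_eq_iff Re_divide_of_real Im_divide_of_real power2_eq_square[of u] del: of_real_power of_real_add)
    finally show ?thesis .
  qed
  have conj0: "(CLINT s|lborel. exp (\<i> * of_real (s * x)) / (of_real a - \<i> * of_real s)\<^sup>2) = 0" if a: "0 < a" for a
  proof -
    have "(CLINT s|lborel. cnj (exp (\<i> * of_real (s * (- x))) / (of_real a + \<i> * of_real s)\<^sup>2)) = cnj 0"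
      unfolding Bochner_Integration.integral_cnj using fourier_kernel_nonpos[OF a, of "- x"] x by simp
    then show ?thesis by (simp add: exp_cnj)
  qed
  have I_eq: "I a = exp (of_real (a * x)) * (CLINT u|lborel. Q a u)" if a: "0 < a" for a
  proof -
    let ?e = "\<lambda>s. exp (\<i> * of_real (s * x))"
    have i1: "integrable lborel (\<lambda>s. ?e s / (of_real a + \<i> * of_real s)\<^sup>2)"
      using a integrable_inverse_quadratic by (intro integrable_mult_resolvent_sq) auto
    have "integrable lborel (\<lambda>s. cnj (exp (\<i> * of_real (s * (- x))) / (of_real a + \<i> * of_real s)\<^sup>2))"
      using a integrable_inverse_quadratic by (intro Bochner_Integration.integrable_cnj integrable_mult_resolvent_sq) auto
    then have i2: "integrable lborel (\<lambda>s. ?e s / (of_real a - \<i> * of_real s)\<^sup>2)" by (simp add: exp_cnj)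
    have frac: "1 / p\<^sup>2 - 1 / q\<^sup>2 = (q\<^sup>2 - p\<^sup>2) / (p * q)\<^sup>2" if "p \<noteq> 0" "q \<noteq> 0" for p q :: complex
      using that by (simp add: diff_frac_eq power_mult_distrib)
    have ker: "1 / (of_real a + \<i> * of_real s)\<^sup>2 - 1 / (of_real a - \<i> * of_real s)\<^sup>2
        = - 4 * \<i> * of_real (a * s) / of_real ((a\<^sup>2 + s\<^sup>2)\<^sup>2)" for s
    proof -
      have n1: "of_real a + \<i> * of_real s \<noteq> 0" "of_real a - \<i> * of_real s \<noteq> 0"
        using a by (auto simp: complex_eq_iff)
      have n2: "of_real (a\<^sup>2 + s\<^sup>2) = (of_real a + \<i> * of_real s) * (of_real a - \<i> * of_real s)"
        by (simp add: algebra_simps power2_eq_square)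
      have "1 / (of_real a + \<i> * of_real s)\<^sup>2 - 1 / (of_real a - \<i> * of_real s)\<^sup>2
         = ((of_real a - \<i> * of_real s)\<^sup>2 - (of_real a + \<i> * of_real s)\<^sup>2) / of_real ((a\<^sup>2 + s\<^sup>2)\<^sup>2)"
        unfolding of_real_power n2 by (rule frac[OF n1])
      also have "(of_real a - \<i> * of_real s)\<^sup>2 - (of_real a + \<i> * of_real s)\<^sup>2 = - 4 * \<i> * of_real (a * s)"
        by (simp add: power2_eq_square algebra_simps)
      finally show ?thesis .
    qed
    have "(CLINT s|lborel. ?e s / (of_real a + \<i> * of_real s)\<^sup>2)
       = (CLINT s|lborel. ?e s / (of_real a + \<i> * of_real s)\<^sup>2) - (CLINT s|lborel. ?e s / (of_real a - \<i> * of_real s)\<^sup>2)"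
      using conj0[OF a] by simp
    also have "\<dots> = (CLINT s|lborel. ?e s / (of_real a + \<i> * of_real s)\<^sup>2 - ?e s / (of_real a - \<i> * of_real s)\<^sup>2)"
      by (rule Bochner_Integration.integral_diff[symmetric]) (rule i1, rule i2)
    also have "\<dots> = (CLINT s|lborel. ?e s * (- 4 * \<i> * of_real (a * s) / of_real ((a\<^sup>2 + s\<^sup>2)\<^sup>2)))"
      unfolding ker[symmetric] by (intro Bochner_Integration.integral_cong) (simp_all add: right_diff_distrib)
    also have "\<dots> = \<bar>a\<bar> *\<^sub>R (CLINT u|lborel. ?e (0 + a * u) * (- 4 * \<i> * of_real (a * (0 + a * u)) / of_real ((a\<^sup>2 + (0 + a * u)\<^sup>2)\<^sup>2)))"
      using a by (intro lborel_integral_real_affine) auto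
    also have "\<dots> = (CLINT u|lborel. Q a u + (- 4 * \<i> * of_real u) / (of_real a * of_real ((1 + u\<^sup>2)\<^sup>2)))"
    proof -
      have "\<bar>a\<bar> *\<^sub>R (?e (0 + a * u) * (- 4 * \<i> * of_real (a * (0 + a * u)) / of_real ((a\<^sup>2 + (0 + a * u)\<^sup>2)\<^sup>2)))
         = Q a u + (- 4 * \<i> * of_real u) / (of_real a * of_real ((1 + u\<^sup>2)\<^sup>2))" for u
      proof -
        have scale: "a\<^sup>2 + (0 + a * u)\<^sup>2 = a\<^sup>2 * (1 + u\<^sup>2)" by (simp add: algebra_simps power2_eq_square)
        have D: "of_real (1 + u\<^sup>2) \<noteq> (0::complex)" using p[of u] by (simp only: of_real_eq_0_iff)
        have alg: "A * (E * (- 4 * \<i> * (A * (A * U)) / (A\<^sup>2 * D)\<^sup>2)) = (E - 1) / A * (- 4 * \<i> * U) / D\<^sup>2 + (- 4 * \<i> * U) / (A * D\<^sup>2)"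
          if "A \<noteq> 0" "D \<noteq> 0" for A D E U :: complex
          using that by (simp add: field_simps power2_eq_square)
        show ?thesis
          unfolding Q_def scaleR_conv_of_real scale of_real_power of_real_mult[of "a\<^sup>2"] add_0_left
          using alg[of "of_real a" "of_real (1 + u\<^sup>2)" "?e (a * u)" "of_real u"] a D by (simp only: of_real_mult of_real_power abs_of_pos) (simp add: power_mult_distrib distrib_left)
      qed
      then show ?thesis unfolding integral_scaleR_right[symmetric] by (simp only:)
    qed
    also have "\<dots> = (CLINT u|lborel. Q a u)"
    proof -
      have odd_int: "integrable lborel (\<lambda>u::real. of_real (u / (1 + u\<^sup>2)\<^sup>2) :: complex)"
      proof (rule integrable_of_real, rule integrable_dominated[OF integrable_inverse_quadratic])
        fix u :: real
        have "\<bar>u\<bar> \<le> 1 + u\<^sup>2" using zero_le_power2[of "\<bar>u\<bar> - 1"] by (simp add: power2_diff)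
        then have "\<bar>u\<bar> / (1 + u\<^sup>2)\<^sup>2 \<le> (1 + u\<^sup>2) / (1 + u\<^sup>2)\<^sup>2" by (intro divide_right_mono) auto
        also have "\<dots> = 1 / (1 + u\<^sup>2)" by (simp add: power2_eq_square)
        finally show "norm (u / (1 + u\<^sup>2)\<^sup>2) \<le> 1 / (1 + u\<^sup>2)" by simp
      qed auto
      \<comment> \<open>The remaining term is an odd function of u.\<close>
      define J :: complex where "J = (CLINT u|lborel. of_real (u / (1 + u\<^sup>2)\<^sup>2))"
      have "J = \<bar>-1\<bar> *\<^sub>R (CLINT u|lborel. of_real ((0 + (-1) * u) / (1 + (0 + (-1) * u)\<^sup>2)\<^sup>2))"
        unfolding J_def by (rule lborel_integral_real_affine) auto
      also have "\<dots> = - J" by (simp add: J_def)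
      finally have "J = 0" by simp
      have split: "(- 4 * \<i> * of_real u) / (of_real a * of_real ((1 + u\<^sup>2)\<^sup>2)) = (- 4 * \<i> / of_real a) * of_real (u / (1 + u\<^sup>2)\<^sup>2)" for u
        by simp
      have i3: "integrable lborel (\<lambda>u. (- 4 * \<i> * of_real u) / (of_real a * of_real ((1 + u\<^sup>2)\<^sup>2)))"
        unfolding split using odd_int by (rule integrable_mult_right)
      have Q_int: "integrable lborel (Q a)"
      proof (rule integrable_dominated[OF _ _ Q_bound[OF a]])
        show "integrable lborel (\<lambda>u. 4 * x * (u\<^sup>2 / (1 + u\<^sup>2)\<^sup>2))"
          by (rule integrable_mult_right) (rule integrable.intros[OF integral_inverse_quadratic_squared])
      qed (simp add: Q_def[abs_def])
      have "(CLINT u|lborel. Q a u + (- 4 * \<i> * of_real u) / (of_real a * of_real ((1 + u\<^sup>2)\<^sup>2)))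
         = (CLINT u|lborel. Q a u) + (- 4 * \<i> / of_real a) * J"
        unfolding Bochner_Integration.integral_add[OF Q_int i3] unfolding split J_def by (simp only: integral_mult_right_zero)
      then show ?thesis using \<open>J = 0\<close> by simp
    qed
    finally show ?thesis by (simp add: I_def)
  qed
  have Q_meas: "Q a \<in> borel_measurable lborel" for a unfolding Q_def[abs_def] by measurable
  have "(\<lambda>n. CLINT u|lborel. Q (c / (real n + 1)) u) \<longlonglongrightarrow> (CLINT u|lborel. of_real (4 * x * (u\<^sup>2 / (1 + u\<^sup>2)\<^sup>2)))"
  proof (rule integral_dominated_convergence[where w = "\<lambda>u. 4 * x * (u\<^sup>2 / (1 + u\<^sup>2)\<^sup>2)"])
    show "integrable lborel (\<lambda>u. 4 * x * (u\<^sup>2 / (1 + u\<^sup>2)\<^sup>2))"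
      by (rule integrable_mult_right) (rule integrable.intros[OF integral_inverse_quadratic_squared])
    show "AE u in lborel. norm (Q (c / (real n + 1)) u) \<le> 4 * x * (u\<^sup>2 / (1 + u\<^sup>2)\<^sup>2)" for n
      using c by (intro AE_I2 Q_bound) auto
  qed (use Q_lim Q_meas in auto)
  also have "(CLINT u|lborel. of_real (4 * x * (u\<^sup>2 / (1 + u\<^sup>2)\<^sup>2))) = complex_of_real (2 * pi * x)"
    unfolding integral_complex_of_real integral_mult_right_zero
    unfolding has_bochner_integral_integral_eq[OF integral_inverse_quadratic_squared] by simp
  finally have "(\<lambda>n. exp (of_real (c / (real n + 1) * x)) * (CLINT u|lborel. Q (c / (real n + 1)) u)) \<longlonglongrightarrow> exp (of_real 0) * complex_of_real (2 * pi * x)"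
  proof (intro tendsto_mult tendsto_exp tendsto_of_real)
    show "(\<lambda>n. c / (real n + 1) * x) \<longlonglongrightarrow> 0" by real_asymp
  qed
  moreover have "exp (of_real (c / (real n + 1) * x)) * (CLINT u|lborel. Q (c / (real n + 1)) u) = I c" for n
  proof -
    have "I (c / (real n + 1)) = I c" unfolding I_def by (rule fourier_kernel_shift) (use c in auto)
    then show ?thesis using I_eq[of "c / (real n + 1)"] c by simp
  qed
  ultimately have "(\<lambda>n::nat. I c) \<longlonglongrightarrow> 2 * pi * x" by simp
  then have "I c = 2 * pi * x" using LIMSEQ_const_iff by metis
  then have "exp (of_real (c * x)) * (CLINT s|lborel. exp (\<i> * of_real (s * x)) / (of_real c + \<i> * of_real s)\<^sup>2) = 2 * pi * x"
    by (simp only: I_def)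
  then show ?thesis by (simp add: exp_minus field_simps)
qed

lemma fourier_kernel:
  fixes z :: complex
  assumes "0 < Re z"
  shows "(CLINT s|lborel. exp (\<i> * of_real (s * x)) / (z + \<i> * of_real s)\<^sup>2)
     = (if 0 < x then complex_of_real (2 * pi * x) * exp (- z * of_real x) else 0)"
proof -
  have "(CLINT s|lborel. exp (\<i> * of_real (s * x)) / (z + \<i> * of_real s)\<^sup>2)
    = \<bar>1\<bar> *\<^sub>R (CLINT s|lborel. exp (\<i> * of_real ((- Im z + 1 * s) * x)) / (z + \<i> * of_real (- Im z + 1 * s))\<^sup>2)"
    by (rule lborel_integral_real_affine) simp
  also have "\<dots> = (CLINT s|lborel. exp (- \<i> * Im z * x) * (exp (\<i> * of_real (s * x)) / (of_real (Re z) + \<i> * of_real s)\<^sup>2))"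
  proof -
    have "exp (\<i> * of_real ((- Im z + 1 * s) * x)) / (z + \<i> * of_real (- Im z + 1 * s))\<^sup>2
       = exp (- \<i> * Im z * x) * (exp (\<i> * of_real (s * x)) / (of_real (Re z) + \<i> * of_real s)\<^sup>2)" for s
    proof -
      have "z + \<i> * of_real (- Im z + 1 * s) = of_real (Re z) + \<i> * of_real s" by (simp add: complex_eq_iff)
      moreover have "\<i> * of_real ((- Im z + 1 * s) * x) = - \<i> * Im z * x + \<i> * of_real (s * x)"
        by (simp add: algebra_simps)
      ultimately show ?thesis by (simp only: exp_add times_divide_eq_right)
    qed
    then show ?thesis by simp
  qed
  also have "\<dots> = exp (- \<i> * Im z * x) * (CLINT s|lborel. exp (\<i> * of_real (s * x)) / (of_real (Re z) + \<i> * of_real s)\<^sup>2)"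
    by (rule integral_mult_right_zero)
  also have "\<dots> = (if 0 < x then complex_of_real (2 * pi * x) * exp (- z * of_real x) else 0)"
  proof (cases "0 < x")
    case True
    have *: "exp (- \<i> * Im z * x) * exp (- of_real (Re z * x)) = exp (- z * of_real x)"
      unfolding exp_add[symmetric] by (rule arg_cong[of _ _ exp]) (simp add: complex_eq_iff)
    show ?thesis
      unfolding fourier_kernel_pos[OF assms True] *[symmetric] using True by (simp only: if_True mult_ac)
  next
    case False
    then show ?thesis using fourier_kernel_nonpos[OF assms, of x] by simp
  qed
  finally show ?thesis .
qed

text \<open>Both sides vanish at \<open>z = 1\<close> and have the same derivative in \<open>z\<close>, by \<open>fourier_kernel\<close>.\<close>

lemma integral_exp_resolvent_diff:
  fixes z :: complex
  assumes "0 < Re z"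
  shows "(CLINT s|lborel. exp (\<i> * of_real (s * x)) * resolvent_diff z s)
     = complex_of_real (2 * pi) * (if 0 < x then exp (- z * of_real x) - exp (- complex_of_real x) else 0)"
proof -
  define L where "L z = (CLINT s|lborel. exp (\<i> * of_real (s * x)) * resolvent_diff z s)" for z
  define R where "R z = complex_of_real (2 * pi) * (if 0 < x then exp (- z * of_real x) - exp (- complex_of_real x) else 0)" for z
  have "\<exists>c. \<forall>w\<in>{w. 0 < Re w}. L w - R w = c"
  proof (rule has_field_derivative_zero_constant)
    show "convex {w. 0 < Re w}" by (rule convex_halfspace_Re_gt)
    fix w :: complex assume "w \<in> {w. 0 < Re w}"
    then have w: "0 < Re w" by simp
    have "(L has_field_derivative - (CLINT s|lborel. exp (\<i> * of_real (s * x)) / (w + \<i> * of_real s)\<^sup>2)) (at w)"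
      unfolding L_def using w integrable_inverse_quadratic by (intro cauchy_transform_deriv) auto
    moreover have "(R has_field_derivative (- (if 0 < x then complex_of_real (2 * pi * x) * exp (- w * of_real x) else 0))) (at w)"
      unfolding R_def by (cases "0 < x") (auto intro!: derivative_eq_intros)
    ultimately have "((\<lambda>w. L w - R w) has_field_derivative 0) (at w)"
      unfolding fourier_kernel[OF w] by (auto dest: DERIV_diff)
    then show "((\<lambda>w. L w - R w) has_field_derivative 0) (at w within {w. 0 < Re w})"
      by (rule has_field_derivative_at_within)
  qed
  then obtain c where c: "\<And>w. 0 < Re w \<Longrightarrow> L w - R w = c" by auto
  have "L 1 = 0" "R 1 = 0" by (simp_all add: L_def R_def resolvent_diff_def)
  then have "c = 0" using c[of 1] by simp
  then have "L z = R z" using c[OF assms] by simp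
  then show ?thesis by (simp add: L_def R_def)
qed

section \<open>Bounded analytic functions on the right half-plane\<close>

text \<open>Functions on the left half-plane are represented by \<open>z \<mapsto> f (- z)\<close>, so this one class serves both
factors of a Wiener--Hopf factorisation.\<close>

definition bounded_right_analytic :: "(complex \<Rightarrow> complex) \<Rightarrow> bool" where
  "bounded_right_analytic f \<longleftrightarrow>
     continuous_on {z. 0 \<le> Re z} f \<and> f holomorphic_on {z. 0 < Re z} \<and> (\<exists>B. \<forall>z. 0 \<le> Re z \<longrightarrow> norm (f z) \<le> B)"

lemma bounded_right_analytic_boundE:
  assumes "bounded_right_analytic f"
  obtains B where "\<And>z. 0 \<le> Re z \<Longrightarrow> norm (f z) \<le> B"
  using assms unfolding bounded_right_analytic_def by blast

lemma bounded_right_analytic_const [intro]: "bounded_right_analytic (\<lambda>_. c)"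
  by (auto simp: bounded_right_analytic_def)

lemma bounded_right_analytic_add:
  assumes "bounded_right_analytic f" "bounded_right_analytic g"
  shows "bounded_right_analytic (\<lambda>z. f z + g z)"
proof -
  obtain B where B: "\<And>z. 0 \<le> Re z \<Longrightarrow> norm (f z) \<le> B" using bounded_right_analytic_boundE[OF assms(1)] by blast
  obtain C where C: "\<And>z. 0 \<le> Re z \<Longrightarrow> norm (g z) \<le> C" using bounded_right_analytic_boundE[OF assms(2)] by blast
  have "\<forall>z. 0 \<le> Re z \<longrightarrow> norm (f z + g z) \<le> B + C"
    using B C by (blast intro: norm_triangle_mono)
  then show ?thesis using assms unfolding bounded_right_analytic_def
    by (auto intro!: continuous_on_add holomorphic_on_add)
qed

lemma bounded_right_analytic_mult:
  assumes "bounded_right_analytic f" "bounded_right_analytic g"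
  shows "bounded_right_analytic (\<lambda>z. f z * g z)"
proof -
  obtain B where B: "\<And>z. 0 \<le> Re z \<Longrightarrow> norm (f z) \<le> B" using bounded_right_analytic_boundE[OF assms(1)] by blast
  obtain C where C: "\<And>z. 0 \<le> Re z \<Longrightarrow> norm (g z) \<le> C" using bounded_right_analytic_boundE[OF assms(2)] by blast
  have "\<forall>z. 0 \<le> Re z \<longrightarrow> norm (f z * g z) \<le> B * C"
    unfolding norm_mult using B C by (blast intro: mult_mono order_trans[OF norm_ge_zero])
  then show ?thesis using assms unfolding bounded_right_analytic_def
    by (auto intro!: continuous_on_mult holomorphic_on_mult)
qed

lemma bounded_right_analytic_diff:
  assumes "bounded_right_analytic f" "bounded_right_analytic g"
  shows "bounded_right_analytic (\<lambda>z. f z - g z)"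
  using bounded_right_analytic_add[OF assms(1) bounded_right_analytic_mult[OF bounded_right_analytic_const[of "-1"] assms(2)]]
  by simp

lemma bounded_right_analytic_exp:
  assumes "bounded_right_analytic f"
  shows "bounded_right_analytic (\<lambda>z. exp (f z))"
proof -
  obtain B where B: "\<And>z. 0 \<le> Re z \<Longrightarrow> norm (f z) \<le> B" using bounded_right_analytic_boundE[OF assms] by blast
  then have "\<forall>z. 0 \<le> Re z \<longrightarrow> norm (exp (f z)) \<le> exp B"
    by (auto intro: order_trans[OF complex_Re_le_cmod])
  then show ?thesis using assms unfolding bounded_right_analytic_def
    by (auto intro!: continuous_on_exp holomorphic_on_compose_gen[of f _ exp UNIV, unfolded comp_def] holomorphic_on_exp)
qed

lemma bounded_right_analytic_suminf:
  assumes f: "\<And>n. bounded_right_analytic (f n)"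
    and bound: "\<And>n z. 0 \<le> Re z \<Longrightarrow> norm (f n z) \<le> b n" and b: "summable b"
  shows "bounded_right_analytic (\<lambda>z. \<Sum>n. f n z)"
proof -
  have unif: "uniform_limit {z. 0 \<le> Re z} (\<lambda>n z. \<Sum>i<n. f i z) (\<lambda>z. \<Sum>i. f i z) sequentially"
    by (rule Weierstrass_m_test[OF _ b]) (use bound in auto)
  have "continuous_on {z. 0 \<le> Re z} (\<lambda>z. \<Sum>n. f n z)"
    using f by (intro uniform_limit_theorem[OF _ unif])
      (auto intro!: always_eventually continuous_on_sum simp: bounded_right_analytic_def)
  moreover have "(\<lambda>z. \<Sum>n. f n z) holomorphic_on {z. 0 < Re z}"
  proof (rule holomorphic_uniform_sequence[OF open_halfspace_Re_gt, where f = "\<lambda>n z. \<Sum>i<n. f i z"])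
    show "(\<lambda>z. \<Sum>i<n. f i z) holomorphic_on {z. 0 < Re z}" for n
      using f by (intro holomorphic_on_sum) (auto simp: bounded_right_analytic_def)
    fix z :: complex assume "z \<in> {z. 0 < Re z}"
    then obtain d where d: "0 < d" "cball z d \<subseteq> {z. 0 < Re z}"
      using open_halfspace_Re_gt open_contains_cball by blast
    moreover have "uniform_limit (cball z d) (\<lambda>n z. \<Sum>i<n. f i z) (\<lambda>z. \<Sum>n. f n z) sequentially"
      by (rule uniform_limit_on_subset[OF unif]) (use d in auto)
    ultimately show "\<exists>d>0. cball z d \<subseteq> {z. 0 < Re z} \<and>
        uniform_limit (cball z d) (\<lambda>n z. \<Sum>i<n. f i z) (\<lambda>z. \<Sum>n. f n z) sequentially" by blast
  qed
  moreover have "norm (\<Sum>n. f n z) \<le> suminf b" if "0 \<le> Re z" for z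
    by (rule norm_suminf_le[OF bound[OF that] b])
  ultimately show ?thesis unfolding bounded_right_analytic_def by blast
qed

text \<open>Gluing \<open>f z\<close> on the right to \<open>g (- z)\<close> on the left gives a continuous function that is holomorphic off the
imaginary axis, hence entire, and bounded, hence constant.\<close>

lemma liouville_across_imaginary_axis:
  assumes f: "bounded_right_analytic f" and g: "bounded_right_analytic g"
    and eq: "\<And>y. f (\<i> * of_real y) = g (- (\<i> * of_real y))"
  obtains c where "\<And>z. 0 \<le> Re z \<Longrightarrow> f z = c"
proof -
  define F where "F z = (if 0 \<le> Re z then f z else g (- z))" for z
  have ax: "f z = g (- z)" if "Re z = 0" for z
  proof -
    have "\<i> * of_real (Im z) = z" using that by (simp add: complex_eq_iff)
    then show ?thesis using eq[of "Im z"] by (simp only:)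
  qed
  have cont: "continuous_on UNIV F"
  proof -
    have "continuous_on ({z. 0 \<le> Re z} \<union> {z. Re z \<le> 0}) F"
      unfolding F_def
    proof (rule continuous_on_If)
      show "continuous_on {z. 0 \<le> Re z} f" using f by (simp add: bounded_right_analytic_def)
      show "continuous_on {z. Re z \<le> 0} (\<lambda>z. g (- z))"
        using g by (intro continuous_on_compose2[of "{z. 0 \<le> Re z}" g "{z. Re z \<le> 0}" uminus])
           (auto simp: bounded_right_analytic_def intro: continuous_on_minus continuous_on_id)
    qed (auto simp: closed_halfspace_Re_ge closed_halfspace_Re_le ax)
    moreover have "{z. 0 \<le> Re z} \<union> {z. Re z \<le> 0} = UNIV" by auto
    ultimately show ?thesis by simp
  qed
  have "F holomorphic_on UNIV"
  proof (rule holomorphic_on_paste_across_line[where d = 1 and k = 0])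
    have eq1: "UNIV \<inter> {z. 1 \<bullet> z < (0::real)} = {z. Re z < 0}" by (auto simp: inner_complex_def)
    have eq2: "UNIV \<inter> {z. 0 < (1 \<bullet> z :: real)} = {z. 0 < Re z}" by (auto simp: inner_complex_def)
    have "(uminus :: complex \<Rightarrow> complex) holomorphic_on {z. Re z < 0}"
      by (rule holomorphic_on_minus) (rule holomorphic_on_ident)
    then have "(g \<circ> uminus) holomorphic_on {z. Re z < 0}"
      using g by (rule_tac holomorphic_on_compose_gen[where t = "{z. 0 < Re z}"]) (auto simp: bounded_right_analytic_def)
    then have "(\<lambda>z. g (- z)) holomorphic_on {z. Re z < 0}" by (simp add: comp_def)
    then show "F holomorphic_on UNIV \<inter> {z. 1 \<bullet> z < 0}" unfolding eq1
      by (rule holomorphic_transform) (auto simp: F_def)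
    have "f holomorphic_on {z. 0 < Re z}" using f by (simp add: bounded_right_analytic_def)
    then show "F holomorphic_on UNIV \<inter> {z. 0 < 1 \<bullet> z}" unfolding eq2
      by (rule holomorphic_transform) (auto simp: F_def)
  qed (use cont in auto)
  moreover have "bounded (range F)"
  proof -
    obtain B where B: "\<And>z. 0 \<le> Re z \<Longrightarrow> norm (f z) \<le> B" using bounded_right_analytic_boundE[OF f] by blast
    obtain C where C: "\<And>z. 0 \<le> Re z \<Longrightarrow> norm (g z) \<le> C" using bounded_right_analytic_boundE[OF g] by blast
    have "norm (F z) \<le> max B C" for z unfolding F_def using B[of z] C[of "- z"] by (auto simp: le_max_iff_disj)
    then show ?thesis by (auto simp: bounded_iff)
  qed
  ultimately have "F constant_on UNIV" by (rule Liouville_theorem)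
  then obtain c where c: "\<And>z. F z = c" by (auto simp: constant_on_def)
  have "f z = c" if "0 \<le> Re z" for z using c[of z] that by (simp add: F_def)
  then show ?thesis by (rule that)
qed

section \<open>Random walks, their maxima and their reflections\<close>

text \<open>The weight \<open>W\<close> will be the indicator of an event, such as a restriction on the sign of the walk.\<close>

lemma laplace_transform_bounded_right_analytic:
  fixes W :: "'a \<Rightarrow> complex" and Y :: "'a \<Rightarrow> real"
  assumes "prob_space M" and W[measurable]: "W \<in> borel_measurable M" and Y[measurable]: "Y \<in> borel_measurable M"
    and W1: "\<And>x. norm (W x) \<le> 1" and Y0: "\<And>x. 0 \<le> Y x"
  shows "bounded_right_analytic (\<lambda>z. \<integral>x. W x * exp (- z * of_real (Y x)) \<partial>M)"
    and "0 \<le> Re z \<Longrightarrow> norm (\<integral>x. W x * exp (- z * of_real (Y x)) \<partial>M) \<le> 1"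
    and "0 \<le> Re z \<Longrightarrow> integrable M (\<lambda>x. W x * exp (- z * of_real (Y x)))"
proof -
  interpret prob_space M by fact
  have b: "norm (W x * exp (- z * of_real (Y x))) \<le> 1" if "0 \<le> Re z" for z x
  proof -
    have "norm (exp (- z * of_real (Y x))) \<le> 1" using that Y0[of x] by simp
    then show ?thesis using W1[of x] by (simp add: norm_mult mult_le_one)
  qed
  have int: "integrable M (\<lambda>x. W x * exp (- z * of_real (Y x)))" if "0 \<le> Re z" for z
    by (rule integrable_const_bound[of _ 1]) (use b[OF that] in auto)
  have bound: "norm (\<integral>x. W x * exp (- z * of_real (Y x)) \<partial>M) \<le> 1" if "0 \<le> Re z" for z
  proof -
    have "norm (\<integral>x. W x * exp (- z * of_real (Y x)) \<partial>M) \<le> (\<integral>x. norm (W x * exp (- z * of_real (Y x))) \<partial>M)"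
      by (rule integral_norm_bound)
    also have "\<dots> \<le> (\<integral>x. 1 \<partial>M)"
      by (rule integral_mono) (use int[OF that] b[OF that] in auto)
    finally show ?thesis by (simp add: prob_space)
  qed
  have cont: "continuous_on {z. 0 \<le> Re z} (\<lambda>z. \<integral>x. W x * exp (- z * of_real (Y x)) \<partial>M)"
    unfolding continuous_on_sequentially comp_def
  proof (intro allI ballI impI)
    fix X :: "nat \<Rightarrow> complex" and a :: complex
    assume X: "a \<in> {z. 0 \<le> Re z}" "(\<forall>n. X n \<in> {z. 0 \<le> Re z}) \<and> X \<longlonglongrightarrow> a"
    show "(\<lambda>n. \<integral>x. W x * exp (- X n * of_real (Y x)) \<partial>M) \<longlonglongrightarrow> (\<integral>x. W x * exp (- a * of_real (Y x)) \<partial>M)"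
      by (rule integral_dominated_convergence[where w = "\<lambda>_. 1"])
         (use X b in \<open>auto intro!: tendsto_intros\<close>)
  qed
  have holo: "(\<lambda>z. \<integral>x. W x * exp (- z * of_real (Y x)) \<partial>M) holomorphic_on {z. 0 < Re z}"
    unfolding holomorphic_on_open[OF open_halfspace_Re_gt]
  proof
    fix z :: complex assume "z \<in> {z. 0 < Re z}"
    then have z: "0 < Re z" by simp
    define r where "r = Re z / 2"
    have r: "0 < r" "r < Re z" using z by (auto simp: r_def)
    have "((\<lambda>z. \<integral>x. W x * exp (- z * of_real (Y x)) \<partial>M) has_field_derivative
        (\<integral>x. W x * (- of_real (Y x) * exp (- z * of_real (Y x))) \<partial>M)) (at z)"
    proof (rule has_field_derivative_integral_dominated[where S = "{w. r < Re w}" and g = "\<lambda>_. 1 / r"])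
      show "open {w. r < Re w}" by (rule open_halfspace_Re_gt)
      fix w x assume "w \<in> {w. r < Re w}"
      then have w: "r < Re w" by simp
      show "((\<lambda>w. W x * exp (- w * of_real (Y x))) has_field_derivative
          W x * (- of_real (Y x) * exp (- w * of_real (Y x)))) (at w)"
        by (auto intro!: derivative_eq_intros)
      have "r * Y x \<le> exp (r * Y x)" using exp_ge_add_one_self[of "r * Y x"] by linarith
      also have "\<dots> \<le> exp (Re w * Y x)" using w Y0[of x] by (simp add: mult_right_mono)
      finally have "Y x * exp (- Re w * Y x) \<le> 1 / r" using r by (simp add: exp_minus field_simps)
      then have "norm (of_real (Y x) * exp (- w * of_real (Y x))) \<le> 1 / r"
        using Y0[of x] by (simp add: norm_mult)
      then have "norm (W x) * norm (of_real (Y x) * exp (- w * of_real (Y x))) \<le> 1 * (1 / r)"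
        using W1[of x] by (intro mult_mono) auto
      then show "norm (W x * (- of_real (Y x) * exp (- w * of_real (Y x)))) \<le> 1 / r"
        by (simp add: norm_mult)
    next
      show "integrable M (\<lambda>x. W x * exp (- w * of_real (Y x)))" if "w \<in> {w. r < Re w}" for w
        using that r by (intro int) auto
    qed (use r in auto)
    then show "\<exists>f'. ((\<lambda>z. \<integral>x. W x * exp (- z * of_real (Y x)) \<partial>M) has_field_derivative f') (at z)" by blast
  qed
  show "bounded_right_analytic (\<lambda>z. \<integral>x. W x * exp (- z * of_real (Y x)) \<partial>M)"
    unfolding bounded_right_analytic_def using cont holo bound by blast
  show "0 \<le> Re z \<Longrightarrow> norm (\<integral>x. W x * exp (- z * of_real (Y x)) \<partial>M) \<le> 1" by (rule bound)
  show "0 \<le> Re z \<Longrightarrow> integrable M (\<lambda>x. W x * exp (- z * of_real (Y x)))" by (rule int)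
qed

primrec walk :: "(nat \<Rightarrow> real) \<Rightarrow> nat \<Rightarrow> real" where
  "walk x 0 = 0"
| "walk x (Suc n) = walk x n + x n"

primrec walk_max :: "(nat \<Rightarrow> real) \<Rightarrow> nat \<Rightarrow> real" where
  "walk_max x 0 = 0"
| "walk_max x (Suc n) = max (walk_max x n) (walk x (Suc n))"

primrec reflected_walk :: "(nat \<Rightarrow> real) \<Rightarrow> nat \<Rightarrow> real" where
  "reflected_walk x 0 = 0"
| "reflected_walk x (Suc n) = max 0 (reflected_walk x n + x n)"

lemma walk_shift: "walk x (Suc n) = x 0 + walk (\<lambda>i. x (Suc i)) n"
  by (induction n) auto

lemma walk_max_shift: "walk_max x (Suc n) = max 0 (x 0 + walk_max (\<lambda>i. x (Suc i)) n)"
proof (induction n)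
  case (Suc n)
  have "walk_max x (Suc (Suc n)) = max (walk_max x (Suc n)) (walk x (Suc (Suc n)))" by simp
  also have "\<dots> = max (max 0 (x 0 + walk_max (\<lambda>i. x (Suc i)) n)) (x 0 + walk (\<lambda>i. x (Suc i)) (Suc n))"
    by (simp only: Suc walk_shift)
  also have "\<dots> = max 0 (x 0 + walk_max (\<lambda>i. x (Suc i)) (Suc n))"
    by (simp add: max_def)
  finally show ?case .
qed simp

text \<open>Duality: the reflected walk at time \<open>n\<close> is the largest sum over a final segment of the steps, which is an
initial segment when the steps are read backwards.\<close>

lemma reflected_walk_eq_reversed_max: "reflected_walk x n = walk_max (\<lambda>i. x (n - Suc i)) n"
proof (induction n)
  case (Suc n)
  show ?case unfolding walk_max_shift by (simp add: Suc add.commute)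
qed simp

lemma walk_restrict: "k \<le> n \<Longrightarrow> walk (restrict x {..<n}) k = walk x k"
  by (induction k) auto

lemma walk_max_restrict: "k \<le> n \<Longrightarrow> walk_max (restrict x {..<n}) k = walk_max x k"
  by (induction k) (auto simp: walk_restrict)

lemma reflected_walk_restrict: "k \<le> n \<Longrightarrow> reflected_walk (restrict x {..<n}) k = reflected_walk x k"
  by (induction k) auto

lemma walk_le_walk_max: "walk x n \<le> walk_max x n"
  by (cases n) auto

lemma walk_max_nonneg: "0 \<le> walk_max x n"
  by (induction n) (auto simp: le_max_iff_disj)

lemma measurable_walk:
  "k \<le> n \<Longrightarrow> (\<lambda>x. walk x k) \<in> borel_measurable (PiM {..<n} (\<lambda>_. borel))"
  by (induction k) (auto intro!: borel_measurable_add measurable_component_singleton)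

lemma measurable_walk_max:
  "k \<le> n \<Longrightarrow> (\<lambda>x. walk_max x k) \<in> borel_measurable (PiM {..<n} (\<lambda>_. borel))"
proof (induction k)
  case (Suc k)
  have "(\<lambda>x. max (walk_max x k) (walk x (Suc k))) \<in> borel_measurable (PiM {..<n} (\<lambda>_. borel))"
    using Suc by (intro borel_measurable_max measurable_walk) auto
  then show ?case by simp
qed simp

lemma measurable_reflected_walk:
  "k \<le> n \<Longrightarrow> (\<lambda>x. reflected_walk x k) \<in> borel_measurable (PiM {..<n} (\<lambda>_. borel))"
  by (induction k) (auto intro!: borel_measurable_max borel_measurable_add measurable_component_singleton)

text \<open>Independence is asked for each finite initial segment because that is the form in which
the increments of a Levy process are independent.\<close>

locale random_walk = prob_space M for M :: "'a measure" +
  fixes \<xi> :: "nat \<Rightarrow> 'a \<Rightarrow> real"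
  assumes indep: "\<And>n. indep_vars (\<lambda>_. borel) \<xi> {..<n}"
    and law: "\<And>n. distr M borel (\<xi> n) = distr M borel (\<xi> 0)"
begin

definition increment_char :: "real \<Rightarrow> complex" where
  "increment_char s = (\<integral>\<omega>. exp (\<i> * of_real (s * \<xi> 0 \<omega>)) \<partial>M)"

lemma rv [measurable]: "\<xi> n \<in> borel_measurable M"
  using indep[of "Suc n"] unfolding indep_vars_def by auto

lemma vec_measurable [measurable]: "(\<lambda>\<omega>. \<lambda>i\<in>{..<n}. \<xi> i \<omega>) \<in> M \<rightarrow>\<^sub>M PiM {..<n} (\<lambda>_. borel)"
  by (rule measurable_restrict) (rule rv)

lemma functional_measurable:
  assumes F: "F \<in> borel_measurable (PiM {..<n} (\<lambda>_. borel))" and loc: "\<And>x. F (restrict x {..<n}) = F x"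
  shows "(\<lambda>\<omega>. F (\<lambda>i. \<xi> i \<omega>)) \<in> borel_measurable M"
  using measurable_compose[OF vec_measurable F] by (simp add: loc)

lemma walk_measurable [measurable]: "(\<lambda>\<omega>. walk (\<lambda>i. \<xi> i \<omega>) n) \<in> borel_measurable M"
  by (rule functional_measurable[OF measurable_walk[of n n]]) (simp_all add: walk_restrict)

lemma walk_max_measurable [measurable]: "(\<lambda>\<omega>. walk_max (\<lambda>i. \<xi> i \<omega>) n) \<in> borel_measurable M"
  by (rule functional_measurable[OF measurable_walk_max[of n n]]) (simp_all add: walk_max_restrict)

lemma reflected_walk_measurable [measurable]: "(\<lambda>\<omega>. reflected_walk (\<lambda>i. \<xi> i \<omega>) n) \<in> borel_measurable M"
  by (rule functional_measurable[OF measurable_reflected_walk[of n n]]) (simp_all add: reflected_walk_restrict)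

text \<open>The condition on \<open>restrict\<close> says that \<open>F\<close> depends only on the first \<open>n\<close> steps.\<close>

lemma expectation_next_step:
  fixes F :: "(nat \<Rightarrow> real) \<Rightarrow> complex"
  assumes F: "F \<in> borel_measurable (PiM {..<n} (\<lambda>_. borel))" and loc: "\<And>x. F (restrict x {..<n}) = F x"
    and bound: "\<And>x. norm (F x) \<le> 1"
  shows "(\<integral>\<omega>. F (\<lambda>i. \<xi> i \<omega>) * exp (\<i> * of_real (s * \<xi> n \<omega>)) \<partial>M)
     = (\<integral>\<omega>. F (\<lambda>i. \<xi> i \<omega>) \<partial>M) * increment_char s"
proof -
  let ?g = "\<lambda>y::real. exp (\<i> * of_real (s * y))"
  have "indep_var (PiM {..<n} (\<lambda>_. borel)) (\<lambda>\<omega>. restrict (\<lambda>i. \<xi> i \<omega>) {..<n})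
      (PiM {n} (\<lambda>_. borel)) (\<lambda>\<omega>. restrict (\<lambda>i. \<xi> i \<omega>) {n})"
    using indep[of "Suc n"] by (rule indep_var_restrict) auto
  then have "indep_var borel (F \<circ> (\<lambda>\<omega>. restrict (\<lambda>i. \<xi> i \<omega>) {..<n}))
      borel ((\<lambda>x. ?g (x n)) \<circ> (\<lambda>\<omega>. restrict (\<lambda>i. \<xi> i \<omega>) {n}))"
  proof (rule indep_var_compose)
    have "(\<lambda>x. x n) \<in> borel_measurable (PiM {n} (\<lambda>_. borel :: real measure))"
      by (rule measurable_component_singleton) simp
    then show "(\<lambda>x. ?g (x n)) \<in> borel_measurable (PiM {n} (\<lambda>_. borel :: real measure))"
      by measurable
  qed (rule F)
  then have ind: "indep_var borel (\<lambda>\<omega>. F (\<lambda>i. \<xi> i \<omega>)) borel (\<lambda>\<omega>. ?g (\<xi> n \<omega>))"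
    by (simp add: comp_def loc)
  have "(\<integral>\<omega>. F (\<lambda>i. \<xi> i \<omega>) * ?g (\<xi> n \<omega>) \<partial>M) = (\<integral>\<omega>. F (\<lambda>i. \<xi> i \<omega>) \<partial>M) * (\<integral>\<omega>. ?g (\<xi> n \<omega>) \<partial>M)"
  proof (rule indep_var_lebesgue_integral[OF ind])
    show "integrable M (\<lambda>\<omega>. F (\<lambda>i. \<xi> i \<omega>))"
      by (rule integrable_const_bound[of _ 1]) (use bound functional_measurable[OF F loc] in auto)
    show "integrable M (\<lambda>\<omega>. ?g (\<xi> n \<omega>))"
      by (rule integrable_const_bound[of _ 1]) (auto simp del: of_real_mult)
  qed
  also have "(\<integral>\<omega>. ?g (\<xi> n \<omega>) \<partial>M) = (\<integral>y. ?g y \<partial>distr M borel (\<xi> n))"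
    by (rule integral_distr[symmetric]) auto
  also have "\<dots> = increment_char s"
    unfolding law[of n] increment_char_def by (rule integral_distr) auto
  finally show ?thesis .
qed

lemma increment_char_bound: "norm (increment_char s) \<le> 1"
proof -
  have "norm (increment_char s) \<le> (\<integral>\<omega>. norm (exp (\<i> * of_real (s * \<xi> 0 \<omega>))) \<partial>M)"
    unfolding increment_char_def by (rule integral_norm_bound)
  also have "\<dots> = 1" by (simp add: prob_space del: of_real_mult)
  finally show ?thesis .
qed

lemma walk_char: "(\<integral>\<omega>. exp (\<i> * of_real (s * walk (\<lambda>i. \<xi> i \<omega>) n)) \<partial>M) = increment_char s ^ n"
proof (induction n)
  case 0
  then show ?case by (simp add: prob_space)
next
  case (Suc n)
  have "(\<integral>\<omega>. exp (\<i> * of_real (s * walk (\<lambda>i. \<xi> i \<omega>) (Suc n))) \<partial>M)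
     = (\<integral>\<omega>. exp (\<i> * of_real (s * walk (\<lambda>i. \<xi> i \<omega>) n)) * exp (\<i> * of_real (s * \<xi> n \<omega>)) \<partial>M)"
    by (simp add: exp_add[symmetric] algebra_simps)
  also have "\<dots> = (\<integral>\<omega>. exp (\<i> * of_real (s * walk (\<lambda>i. \<xi> i \<omega>) n)) \<partial>M) * increment_char s"
  proof (rule expectation_next_step)
    have [measurable]: "(\<lambda>x. walk x n) \<in> borel_measurable (PiM {..<n} (\<lambda>_. borel))" by (rule measurable_walk) simp
    show "(\<lambda>x. exp (\<i> * of_real (s * walk x n))) \<in> borel_measurable (PiM {..<n} (\<lambda>_. borel))" by measurable
  qed (simp_all add: walk_restrict del: of_real_mult restrict_apply)
  finally show ?case using Suc by (simp add: mult.commute)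
qed

text \<open>The first \<open>n\<close> steps have the same law in either order, so the maximum has the law of the reflected walk.
The reflected walk is a function of its previous value and one further independent step, which is the form
that \<open>expectation_next_step\<close> requires.\<close>

lemma reflected_walk_law:
  assumes f: "f \<in> borel_measurable borel"
  shows "(\<integral>\<omega>. f (reflected_walk (\<lambda>i. \<xi> i \<omega>) n) \<partial>M) = (\<integral>\<omega>. (f (walk_max (\<lambda>i. \<xi> i \<omega>) n) :: complex) \<partial>M)"
proof (cases "n = 0")
  case False
  let ?P = "PiM {..<n} (\<lambda>_. borel :: real measure)"
  let ?Q = "PiM {..<n} (\<lambda>_. distr M borel (\<xi> 0))"
  have ne: "{..<n} \<noteq> {}" using False by auto
  have "distr M ?P (\<lambda>\<omega>. \<lambda>i\<in>{..<n}. \<xi> i \<omega>) = PiM {..<n} (\<lambda>i. distr M borel (\<xi> i))"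
    using indep_vars_iff_distr_eq_PiM'[where I = "{..<n}" and X = \<xi> and M' = "\<lambda>_. borel", OF ne] indep rv by auto
  also have "\<dots> = ?Q" by (intro PiM_cong refl law)
  finally have vec: "distr M ?P (\<lambda>\<omega>. \<lambda>i\<in>{..<n}. \<xi> i \<omega>) = ?Q" .
  have sets_Q [measurable_cong]: "sets ?Q = sets ?P" by (intro sets_PiM_cong) auto
  \<comment> \<open>The product measure is invariant under reversal of the coordinates.\<close>
  have rev: "distr ?Q ?Q (\<lambda>x. \<lambda>i\<in>{..<n}. x (n - Suc i)) = ?Q"
    by (rule distr_PiM_reindex) (auto simp: inj_on_def intro: prob_space_distr)
  have [measurable]: "(\<lambda>x. f (walk_max x n)) \<in> borel_measurable ?P"
    using measurable_compose[OF measurable_walk_max[of n n] f] by simp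
  have rev_P: "(\<lambda>x. \<lambda>i\<in>{..<n}. x (n - Suc i)) \<in> ?P \<rightarrow>\<^sub>M ?P"
    by (intro measurable_restrict measurable_component_singleton) auto
  then have rev_meas: "(\<lambda>x. f (walk_max (\<lambda>i\<in>{..<n}. x (n - Suc i)) n)) \<in> borel_measurable ?P"
    by measurable
  have "(\<integral>\<omega>. f (reflected_walk (\<lambda>i. \<xi> i \<omega>) n) \<partial>M)
      = (\<integral>\<omega>. f (walk_max (\<lambda>i\<in>{..<n}. (\<lambda>i\<in>{..<n}. \<xi> i \<omega>) (n - Suc i)) n) \<partial>M)"
  proof -
    have "walk_max (\<lambda>i\<in>{..<n}. (\<lambda>i\<in>{..<n}. \<xi> i \<omega>) (n - Suc i)) n = reflected_walk (\<lambda>i. \<xi> i \<omega>) n" for \<omega>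
    proof -
      have "(\<lambda>i\<in>{..<n}. (\<lambda>i\<in>{..<n}. \<xi> i \<omega>) (n - Suc i)) = (\<lambda>i\<in>{..<n}. \<xi> (n - Suc i) \<omega>)"
        using False by (auto simp: restrict_def fun_eq_iff)
      then show ?thesis by (simp add: walk_max_restrict reflected_walk_eq_reversed_max del: restrict_apply)
    qed
    then show ?thesis by simp
  qed
  also have "\<dots> = (\<integral>x. f (walk_max (\<lambda>i\<in>{..<n}. x (n - Suc i)) n) \<partial>?Q)"
    unfolding vec[symmetric] by (rule integral_distr[symmetric, OF vec_measurable]) (rule rev_meas)
  also have "\<dots> = (\<integral>x. f (walk_max x n) \<partial>distr ?Q ?Q (\<lambda>x. \<lambda>i\<in>{..<n}. x (n - Suc i)))"
  proof (rule integral_distr[symmetric])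
    show "(\<lambda>x. \<lambda>i\<in>{..<n}. x (n - Suc i)) \<in> ?Q \<rightarrow>\<^sub>M ?Q"
      unfolding measurable_cong_sets[OF sets_Q sets_Q] by (rule rev_P)
    show "(\<lambda>x. f (walk_max x n)) \<in> borel_measurable ?Q"
      unfolding measurable_cong_sets[OF sets_Q refl] by measurable
  qed
  also have "\<dots> = (\<integral>x. f (walk_max x n) \<partial>distr M ?P (\<lambda>\<omega>. \<lambda>i\<in>{..<n}. \<xi> i \<omega>))"
    unfolding rev vec ..
  also have "\<dots> = (\<integral>\<omega>. f (walk_max (\<lambda>i\<in>{..<n}. \<xi> i \<omega>) n) \<partial>M)"
    by (rule integral_distr[OF vec_measurable]) measurable
  also have "\<dots> = (\<integral>\<omega>. f (walk_max (\<lambda>i. \<xi> i \<omega>) n) \<partial>M)"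
    by (simp add: walk_max_restrict del: restrict_apply)
  finally show ?thesis .
qed simp

end

section \<open>Wiener--Hopf factorisation of a killed random walk\<close>

lemma bounded_right_analytic_weighted_series:
  assumes f: "\<And>n. bounded_right_analytic (f n)"
    and bound: "\<And>n z. 0 \<le> Re z \<Longrightarrow> norm (f n z) \<le> 1" and c: "summable c" "\<And>n. 0 \<le> c n"
  shows "bounded_right_analytic (\<lambda>z. \<Sum>n. of_real (c n) * f n z)"
    and "0 \<le> Re z \<Longrightarrow> summable (\<lambda>n. of_real (c n) * f n z)"
proof -
  have b: "norm (of_real (c n) * f n z) \<le> c n" if "0 \<le> Re z" for n z
    using mult_left_mono[OF bound[OF that, of n] c(2)[of n]] c(2)[of n] by (simp add: norm_mult)
  show "bounded_right_analytic (\<lambda>z. \<Sum>n. of_real (c n) * f n z)"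
    by (rule bounded_right_analytic_suminf[OF _ b c(1)])
       (auto intro: bounded_right_analytic_mult bounded_right_analytic_const f)
  show "summable (\<lambda>n. of_real (c n) * f n z)" if "0 \<le> Re z"
    by (rule summable_comparison_test'[OF c(1)]) (use b[OF that] in auto)
qed

locale killed_random_walk = random_walk +
  fixes q :: real
  assumes q: "0 < q" "q < 1"
begin

abbreviation "S n \<omega> \<equiv> walk (\<lambda>i. \<xi> i \<omega>) n"
abbreviation "S_max n \<omega> \<equiv> walk_max (\<lambda>i. \<xi> i \<omega>) n"
abbreviation "S_refl n \<omega> \<equiv> reflected_walk (\<lambda>i. \<xi> i \<omega>) n"

definition max_transform :: "nat \<Rightarrow> complex \<Rightarrow> complex" where
  "max_transform n z = (\<integral>\<omega>. exp (- z * of_real (S_max n \<omega>)) \<partial>M)"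

definition killed_max_transform :: "complex \<Rightarrow> complex" where
  "killed_max_transform z = (\<Sum>n. of_real (q ^ n) * max_transform n z)"

lemma q_summable: "summable (\<lambda>n. q ^ n)"
  using q by (intro summable_geometric) simp

lemma q_summable_div: "summable (\<lambda>n. q ^ Suc n / real (Suc n))"
proof (rule summable_comparison_test'[OF q_summable])
  show "norm (q ^ Suc n / real (Suc n)) \<le> q ^ n" for n
    using q by (simp add: divide_le_eq)
qed

lemma max_transform:
  shows "bounded_right_analytic (max_transform n)"
    and "0 \<le> Re z \<Longrightarrow> norm (max_transform n z) \<le> 1"
  using laplace_transform_bounded_right_analytic(1,2)[OF prob_space_axioms _ walk_max_measurable[of n], of "\<lambda>_. 1"]
    walk_max_nonneg
  by (simp_all add: max_transform_def[abs_def])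

lemma max_transform_0 [simp]: "max_transform 0 z = 1"
  by (simp add: max_transform_def prob_space)

lemma max_transform_refl: "max_transform n z = (\<integral>\<omega>. exp (- z * of_real (S_refl n \<omega>)) \<partial>M)"
  unfolding max_transform_def by (rule reflected_walk_law[symmetric, where f = "\<lambda>x. exp (- z * of_real x)"]) measurable

lemma killed_max_transform:
  shows "bounded_right_analytic killed_max_transform"
    and "0 \<le> Re z \<Longrightarrow> summable (\<lambda>n. of_real (q ^ n) * max_transform n z)"
  using bounded_right_analytic_weighted_series[of max_transform, OF max_transform q_summable] q
  by (simp_all add: killed_max_transform_def[abs_def])

text \<open>The transform of the amount that reflection at \<open>0\<close> adds to the unreflected step.\<close>

definition overshoot_transform :: "nat \<Rightarrow> complex \<Rightarrow> complex" where
  "overshoot_transform n z = (\<integral>\<omega>. exp (- z * of_real (max 0 (- (S_refl n \<omega> + \<xi> n \<omega>)))) \<partial>M)"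

lemma overshoot_transform:
  shows "bounded_right_analytic (overshoot_transform n)"
    and "0 \<le> Re z \<Longrightarrow> norm (overshoot_transform n z) \<le> 1"
  using laplace_transform_bounded_right_analytic(1,2)[OF prob_space_axioms, of "\<lambda>_. 1" "\<lambda>\<omega>. max 0 (- (S_refl n \<omega> + \<xi> n \<omega>))"]
  by (simp_all add: overshoot_transform_def[abs_def])

text \<open>For real \<open>u\<close> and \<open>y\<close>, one of \<open>max 0 u\<close> and \<open>max 0 (- u)\<close> is zero, so the corresponding two exponentials
add up to \<open>1 + exp (- iyu)\<close>; here \<open>u\<close> is the reflected walk plus its next step.\<close>

lemma lindley_step:
  "max_transform (Suc n) (\<i> * of_real y) + overshoot_transform n (- (\<i> * of_real y))
     = 1 + max_transform n (\<i> * of_real y) * increment_char (- y)"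
proof -
  have int: "integrable M (\<lambda>\<omega>. exp (\<i> * of_real (f \<omega>)))" if [measurable]: "f \<in> borel_measurable M" for f :: "'a \<Rightarrow> real"
    by (rule integrable_const_bound[of _ 1]) auto
  have pt: "exp (\<i> * of_real (- y * max 0 u)) + exp (\<i> * of_real (y * max 0 (- u))) = 1 + exp (\<i> * of_real (- y * u))" for u
    by (cases "0 \<le> u") (auto simp: max_def)
  have "max_transform (Suc n) (\<i> * of_real y) + overshoot_transform n (- (\<i> * of_real y))
     = (\<integral>\<omega>. exp (\<i> * of_real (- y * max 0 (S_refl n \<omega> + \<xi> n \<omega>))) \<partial>M)
       + (\<integral>\<omega>. exp (\<i> * of_real (y * max 0 (- (S_refl n \<omega> + \<xi> n \<omega>)))) \<partial>M)"
    unfolding max_transform_refl overshoot_transform_def by (simp add: mult_ac)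
  also have "\<dots> = (\<integral>\<omega>. exp (\<i> * of_real (- y * max 0 (S_refl n \<omega> + \<xi> n \<omega>)))
       + exp (\<i> * of_real (y * max 0 (- (S_refl n \<omega> + \<xi> n \<omega>)))) \<partial>M)"
    by (rule Bochner_Integration.integral_add[symmetric]) (intro int, measurable)+
  also have "\<dots> = (\<integral>\<omega>. 1 + exp (\<i> * of_real (- y * (S_refl n \<omega> + \<xi> n \<omega>))) \<partial>M)"
    unfolding pt ..
  also have "\<dots> = (\<integral>\<omega>. 1 \<partial>M) + (\<integral>\<omega>. exp (\<i> * of_real (- y * (S_refl n \<omega> + \<xi> n \<omega>))) \<partial>M)"
    by (rule Bochner_Integration.integral_add) (simp, intro int, measurable)
  also have "(\<integral>\<omega>. exp (\<i> * of_real (- y * (S_refl n \<omega> + \<xi> n \<omega>))) \<partial>M)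
     = (\<integral>\<omega>. exp (- (\<i> * of_real y) * of_real (S_refl n \<omega>)) * exp (\<i> * of_real (- y * \<xi> n \<omega>)) \<partial>M)"
    by (simp add: exp_add[symmetric] algebra_simps)
  also have "\<dots> = (\<integral>\<omega>. exp (- (\<i> * of_real y) * of_real (S_refl n \<omega>)) \<partial>M) * increment_char (- y)"
  proof (rule expectation_next_step)
    have [measurable]: "(\<lambda>x. reflected_walk x n) \<in> borel_measurable (PiM {..<n} (\<lambda>_. borel))"
      by (rule measurable_reflected_walk) simp
    show "(\<lambda>x. exp (- (\<i> * of_real y) * of_real (reflected_walk x n))) \<in> borel_measurable (PiM {..<n} (\<lambda>_. borel))"
      by measurable
  qed (simp_all add: reflected_walk_restrict del: restrict_apply)
  finally show ?thesis by (simp add: prob_space max_transform_refl)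
qed

definition killed_overshoot_transform :: "complex \<Rightarrow> complex" where
  "killed_overshoot_transform z = (\<Sum>n. of_real (q ^ n) * overshoot_transform n z)"

lemma killed_overshoot_transform:
  shows "bounded_right_analytic killed_overshoot_transform"
    and "0 \<le> Re z \<Longrightarrow> summable (\<lambda>n. of_real (q ^ n) * overshoot_transform n z)"
  using bounded_right_analytic_weighted_series[of overshoot_transform, OF overshoot_transform q_summable] q
  by (simp_all add: killed_overshoot_transform_def[abs_def])

text \<open>Lindley's recursion, multiplied by \<open>q\<^sup>n\<^sup>+\<^sup>1\<close> and summed.\<close>

lemma killed_max_boundary:
  "killed_max_transform (\<i> * of_real y) * (1 - of_real q * increment_char (- y))
     = 1 / (1 - of_real q) - of_real q * killed_overshoot_transform (- (\<i> * of_real y))"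
proof -
  let ?g = "\<lambda>n. of_real (q ^ n) * max_transform n (\<i> * of_real y)"
  let ?h = "\<lambda>n. of_real (q ^ n) * overshoot_transform n (- (\<i> * of_real y))"
  have sg: "summable ?g" by (rule killed_max_transform) simp
  have sh: "summable ?h" by (rule killed_overshoot_transform) simp
  have geo: "(\<lambda>n. complex_of_real (q ^ n)) sums (1 / (1 - of_real q))"
    using geometric_sums[of "of_real q :: complex"] q by simp
  have step: "?g (Suc n) = of_real q * of_real (q ^ n) + of_real q * increment_char (- y) * ?g n - of_real q * ?h n" for n
    using arg_cong[OF lindley_step[of n y], of "\<lambda>u. of_real (q ^ Suc n) * u"]
    by (simp add: algebra_simps)
  have "(\<lambda>n. of_real q * of_real (q ^ n) + of_real q * increment_char (- y) * ?g n - of_real q * ?h n) sums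
      (of_real q * (1 / (1 - of_real q)) + of_real q * increment_char (- y) * suminf ?g - of_real q * suminf ?h)"
    by (intro sums_add sums_diff sums_mult geo summable_sums sg sh)
  then have "(\<Sum>n. ?g (Suc n)) = of_real q * (1 / (1 - of_real q)) + of_real q * increment_char (- y) * suminf ?g - of_real q * suminf ?h"
    unfolding step[symmetric] by (rule sums_unique[symmetric])
  then have eq: "suminf ?g - ?g 0 = of_real q * (1 / (1 - of_real q)) + of_real q * increment_char (- y) * suminf ?g - of_real q * suminf ?h"
    unfolding suminf_split_head[OF sg] .
  have "A - G0 = Q * K + Q * X * A - Q * B \<Longrightarrow> A * (1 - Q * X) = G0 + Q * K - Q * B" for A B G0 K Q X :: complex
    by (simp add: algebra_simps)
  from this[OF eq] have "suminf ?g * (1 - of_real q * increment_char (- y)) = 1 + of_real q * (1 / (1 - of_real q)) - of_real q * suminf ?h"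
    by simp
  also have "1 + of_real q * (1 / (1 - of_real q)) = 1 / (1 - complex_of_real q)"
  proof -
    have "1 - complex_of_real q \<noteq> 0" using q by (metis of_real_1 of_real_diff of_real_eq_0_iff diff_gt_0_iff_gt less_irrefl)
    then show ?thesis by (simp add: field_simps)
  qed
  finally show ?thesis by (simp add: killed_max_transform_def killed_overshoot_transform_def)
qed

text \<open>\<open>survival_transform\<close> is the part of the transform of \<open>S\<^sub>n\<close> where the walk has not yet been positive;
\<open>passage_transform\<close> is the part of that of \<open>S\<^sub>n\<^sub>+\<^sub>1\<close> where \<open>n + 1\<close> is the first time that the walk is
positive. Taking positive parts in the exponent is harmless on these events and puts
the first into the left half-plane and the second into the right one.\<close>

definition survival_transform :: "nat \<Rightarrow> complex \<Rightarrow> complex" where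
  "survival_transform n z = (\<integral>\<omega>. of_bool (S_max n \<omega> \<le> 0) * exp (- z * of_real (max 0 (- S n \<omega>))) \<partial>M)"

definition passage_transform :: "nat \<Rightarrow> complex \<Rightarrow> complex" where
  "passage_transform n z = (\<integral>\<omega>. of_bool (S_max n \<omega> \<le> 0 \<and> 0 < S (Suc n) \<omega>) * exp (- z * of_real (max 0 (S (Suc n) \<omega>))) \<partial>M)"

lemma survival_transform:
  shows "bounded_right_analytic (survival_transform n)"
    and "0 \<le> Re z \<Longrightarrow> norm (survival_transform n z) \<le> 1"
  using laplace_transform_bounded_right_analytic(1,2)[OF prob_space_axioms, of "\<lambda>\<omega>. of_bool (S_max n \<omega> \<le> 0)" "\<lambda>\<omega>. max 0 (- S n \<omega>)"]
  by (simp_all add: survival_transform_def[abs_def])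

lemma passage_transform:
  shows "bounded_right_analytic (passage_transform n)"
    and "0 \<le> Re z \<Longrightarrow> norm (passage_transform n z) \<le> 1"
  using laplace_transform_bounded_right_analytic(1,2)[OF prob_space_axioms, of "\<lambda>\<omega>. of_bool (S_max n \<omega> \<le> 0 \<and> 0 < S (Suc n) \<omega>)" "\<lambda>\<omega>. max 0 (S (Suc n) \<omega>)"]
  by (simp_all add: passage_transform_def[abs_def] del: walk.simps)

text \<open>A walk that has not been positive up to time \<open>n\<close> either stays so for one more step or is positive for the first
time.\<close>

lemma survival_step:
  "survival_transform (Suc n) (- (\<i> * of_real y)) + passage_transform n (\<i> * of_real y)
     = survival_transform n (- (\<i> * of_real y)) * increment_char (- y)"
proof -
  have le: "S k \<omega> \<le> S_max k \<omega>" for k \<omega> by (rule walk_le_walk_max)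
  have int: "integrable M (\<lambda>\<omega>. of_bool (P \<omega>) * exp (\<i> * of_real (f \<omega>)))"
    if [measurable]: "f \<in> borel_measurable M" "Measurable.pred M P" for f :: "'a \<Rightarrow> real" and P
    by (rule integrable_const_bound[of _ 1]) (auto simp: norm_mult)
  have "survival_transform (Suc n) (- (\<i> * of_real y)) + passage_transform n (\<i> * of_real y)
    = (\<integral>\<omega>. of_bool (S_max (Suc n) \<omega> \<le> 0) * exp (\<i> * of_real (- y * S (Suc n) \<omega>)) \<partial>M)
    + (\<integral>\<omega>. of_bool (S_max n \<omega> \<le> 0 \<and> 0 < S (Suc n) \<omega>) * exp (\<i> * of_real (- y * S (Suc n) \<omega>)) \<partial>M)"
    unfolding survival_transform_def passage_transform_def
    by (intro arg_cong2[of _ _ _ _ "(+)"] Bochner_Integration.integral_cong refl)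
       (use le in \<open>auto simp: of_bool_def max_def mult_ac intro: order_trans simp del: walk.simps\<close>)
  also have "\<dots> = (\<integral>\<omega>. of_bool (S_max (Suc n) \<omega> \<le> 0) * exp (\<i> * of_real (- y * S (Suc n) \<omega>))
     + of_bool (S_max n \<omega> \<le> 0 \<and> 0 < S (Suc n) \<omega>) * exp (\<i> * of_real (- y * S (Suc n) \<omega>)) \<partial>M)"
    by (rule Bochner_Integration.integral_add[symmetric]) (intro int, measurable)+
  also have "\<dots> = (\<integral>\<omega>. (of_bool (S_max n \<omega> \<le> 0) * exp (\<i> * of_real (- y * S n \<omega>))) * exp (\<i> * of_real (- y * \<xi> n \<omega>)) \<partial>M)"
  proof (intro Bochner_Integration.integral_cong refl)
    fix \<omega>
    have "exp (\<i> * of_real (- y * S n \<omega>)) * exp (\<i> * of_real (- y * \<xi> n \<omega>)) = exp (\<i> * of_real (- y * S (Suc n) \<omega>))"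
      unfolding exp_add[symmetric] by (rule arg_cong[of _ _ exp]) (simp add: algebra_simps)
    moreover have "of_bool (S_max (Suc n) \<omega> \<le> 0) + of_bool (S_max n \<omega> \<le> 0 \<and> 0 < S (Suc n) \<omega>) = (of_bool (S_max n \<omega> \<le> 0) :: complex)"
      by (auto simp del: walk.simps)
    ultimately show "of_bool (S_max (Suc n) \<omega> \<le> 0) * exp (\<i> * of_real (- y * S (Suc n) \<omega>))
     + of_bool (S_max n \<omega> \<le> 0 \<and> 0 < S (Suc n) \<omega>) * exp (\<i> * of_real (- y * S (Suc n) \<omega>))
      = (of_bool (S_max n \<omega> \<le> 0) * exp (\<i> * of_real (- y * S n \<omega>))) * exp (\<i> * of_real (- y * \<xi> n \<omega>))"
      by (simp only: mult.assoc distrib_right[symmetric])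
  qed
  also have "\<dots> = (\<integral>\<omega>. of_bool (S_max n \<omega> \<le> 0) * exp (\<i> * of_real (- y * S n \<omega>)) \<partial>M) * increment_char (- y)"
  proof (rule expectation_next_step)
    have [measurable]: "(\<lambda>x. walk x n) \<in> borel_measurable (PiM {..<n} (\<lambda>_. borel))"
      "(\<lambda>x. walk_max x n) \<in> borel_measurable (PiM {..<n} (\<lambda>_. borel))"
      by (rule measurable_walk measurable_walk_max, simp)+
    show "(\<lambda>x. of_bool (walk_max x n \<le> 0) * exp (\<i> * of_real (- y * walk x n))) \<in> borel_measurable (PiM {..<n} (\<lambda>_. borel))"
      by measurable
  qed (simp_all add: walk_restrict walk_max_restrict norm_mult del: restrict_apply of_real_mult)
  also have "(\<integral>\<omega>. of_bool (S_max n \<omega> \<le> 0) * exp (\<i> * of_real (- y * S n \<omega>)) \<partial>M) = survival_transform n (- (\<i> * of_real y))"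
    unfolding survival_transform_def
    by (intro Bochner_Integration.integral_cong refl)
       (use le in \<open>auto simp: of_bool_def max_def mult_ac intro: order_trans\<close>)
  finally show ?thesis .
qed

definition killed_survival_transform :: "complex \<Rightarrow> complex" where
  "killed_survival_transform z = (\<Sum>n. of_real (q ^ n) * survival_transform n z)"

definition killed_passage_transform :: "complex \<Rightarrow> complex" where
  "killed_passage_transform z = (\<Sum>n. of_real (q ^ Suc n) * passage_transform n z)"

lemma q_summable_Suc: "summable (\<lambda>n. q ^ Suc n)"
  using q_summable by (subst summable_Suc_iff)

lemma killed_survival_transform:
  shows "bounded_right_analytic killed_survival_transform"
    and "0 \<le> Re z \<Longrightarrow> summable (\<lambda>n. of_real (q ^ n) * survival_transform n z)"
  using bounded_right_analytic_weighted_series[of survival_transform, OF survival_transform q_summable] q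
  by (simp_all add: killed_survival_transform_def[abs_def])

lemma killed_passage_transform:
  shows "bounded_right_analytic killed_passage_transform"
    and "0 \<le> Re z \<Longrightarrow> summable (\<lambda>n. of_real (q ^ Suc n) * passage_transform n z)"
  using bounded_right_analytic_weighted_series[of passage_transform, OF passage_transform q_summable_Suc] q
  by (simp_all add: killed_passage_transform_def[abs_def])

lemma survival_transform_start [simp]: "survival_transform 0 z = 1"
  by (simp add: survival_transform_def prob_space)

lemma killed_survival_boundary:
  "killed_survival_transform (- (\<i> * of_real y)) * (1 - of_real q * increment_char (- y))
     = 1 - killed_passage_transform (\<i> * of_real y)"
proof -
  let ?v = "\<lambda>n. of_real (q ^ n) * survival_transform n (- (\<i> * of_real y))"
  let ?a = "\<lambda>n. of_real (q ^ Suc n) * passage_transform n (\<i> * of_real y)"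
  have sv: "summable ?v" by (rule killed_survival_transform) simp
  have sa: "summable ?a" by (rule killed_passage_transform) simp
  have step: "?v (Suc n) = of_real q * increment_char (- y) * ?v n - ?a n" for n
    using arg_cong[OF survival_step[of n y], of "\<lambda>u. of_real (q ^ Suc n) * u"]
    by (simp add: algebra_simps)
  have "(\<lambda>n. of_real q * increment_char (- y) * ?v n - ?a n) sums
      (of_real q * increment_char (- y) * suminf ?v - suminf ?a)"
    by (intro sums_diff sums_mult summable_sums sv sa)
  then have "(\<Sum>n. ?v (Suc n)) = of_real q * increment_char (- y) * suminf ?v - suminf ?a"
    unfolding step[symmetric] by (rule sums_unique[symmetric])
  then have eq: "suminf ?v - ?v 0 = of_real q * increment_char (- y) * suminf ?v - suminf ?a"
    unfolding suminf_split_head[OF sv] .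
  have "V - V0 = X * V - A \<Longrightarrow> V * (1 - X) = V0 - A" for V V0 X A :: complex
    by (simp add: algebra_simps)
  from this[OF eq] have "suminf ?v * (1 - of_real q * increment_char (- y)) = 1 - suminf ?a"
    by simp
  then show ?thesis by (simp add: killed_survival_transform_def killed_passage_transform_def)
qed

lemma increment_char_0 [simp]: "increment_char 0 = 1"
  by (simp add: increment_char_def prob_space)

text \<open>At \<open>z = 0\<close> the boundary identity reads \<open>A(0) = 1 - (1 - q) V(0)\<close>, and \<open>V(0) \<ge> 1\<close> because its first term is
\<open>1\<close>. The modulus at any
other point of the half-plane is at most the value at \<open>0\<close>.\<close>

lemma killed_passage_bound:
  assumes "0 \<le> Re z"
  shows "norm (killed_passage_transform z) \<le> q"
proof -
  define v where "v n = prob {\<omega> \<in> space M. S_max n \<omega> \<le> 0}" for n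
  define a where "a n = prob {\<omega> \<in> space M. S_max n \<omega> \<le> 0 \<and> 0 < S (Suc n) \<omega>}" for n
  have exp_of_bool: "(\<integral>\<omega>. of_bool (P \<omega>) \<partial>M) = (of_real (prob {\<omega> \<in> space M. P \<omega>}) :: complex)" if "Measurable.pred M P" for P
  proof -
    have "(\<integral>\<omega>. of_bool (P \<omega>) \<partial>M) = (\<integral>\<omega>. (of_real (indicator {\<omega> \<in> space M. P \<omega>} \<omega>) :: complex) \<partial>M)"
      by (intro Bochner_Integration.integral_cong) (auto simp: indicator_def)
    also have "\<dots> = of_real (prob {\<omega> \<in> space M. P \<omega>})"
      using that by (subst integral_complex_of_real) simp
    finally show ?thesis .
  qed
  have v: "survival_transform n 0 = of_real (v n)" for n
    by (simp add: survival_transform_def v_def exp_of_bool)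
  have a: "passage_transform n 0 = of_real (a n)" for n
    by (simp add: passage_transform_def a_def exp_of_bool del: walk.simps)
  have sv: "summable (\<lambda>n. q ^ n * v n)"
    by (rule summable_comparison_test'[OF q_summable]) (use q in \<open>auto simp: v_def abs_mult intro!: mult_left_le\<close>)
  have sa: "summable (\<lambda>n. q ^ Suc n * a n)"
    by (rule summable_comparison_test'[OF q_summable_Suc])
       (use q in \<open>auto simp: a_def abs_mult intro!: mult_left_le simp del: walk.simps\<close>)
  have "killed_survival_transform 0 * (1 - of_real q) = 1 - killed_passage_transform 0"
    using killed_survival_boundary[of 0] by simp
  then have "complex_of_real (suminf (\<lambda>n. q ^ n * v n) * (1 - q)) = of_real (1 - suminf (\<lambda>n. q ^ Suc n * a n))"
    unfolding killed_survival_transform_def killed_passage_transform_def v a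
    using suminf_of_real[OF sv, where 'a = complex] suminf_of_real[OF sa, where 'a = complex] by simp
  then have eq: "suminf (\<lambda>n. q ^ Suc n * a n) = 1 - suminf (\<lambda>n. q ^ n * v n) * (1 - q)"
    unfolding of_real_eq_iff by simp
  have "q ^ 0 * v 0 \<le> suminf (\<lambda>n. q ^ n * v n)"
    using sum_le_suminf[OF sv, of "{0}"] q by (simp add: v_def)
  moreover have "v 0 = 1" by (simp add: v_def prob_space)
  ultimately have "1 * (1 - q) \<le> suminf (\<lambda>n. q ^ n * v n) * (1 - q)" using q by (intro mult_right_mono) auto
  then have le: "suminf (\<lambda>n. q ^ Suc n * a n) \<le> q" unfolding eq by simp
  have "norm (of_real (q ^ Suc n) * passage_transform n z) \<le> q ^ Suc n * a n" for n
  proof -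
    have "norm (passage_transform n z) \<le> (\<integral>\<omega>. norm (of_bool (S_max n \<omega> \<le> 0 \<and> 0 < S (Suc n) \<omega>) * exp (- z * of_real (max 0 (S (Suc n) \<omega>)))) \<partial>M)"
      unfolding passage_transform_def by (rule integral_norm_bound)
    also have "\<dots> \<le> (\<integral>\<omega>. indicator {\<omega> \<in> space M. S_max n \<omega> \<le> 0 \<and> 0 < S (Suc n) \<omega>} \<omega> \<partial>M)"
    proof (rule integral_mono)
      show "integrable M (\<lambda>\<omega>. norm (of_bool (S_max n \<omega> \<le> 0 \<and> 0 < S (Suc n) \<omega>) * exp (- z * of_real (max 0 (S (Suc n) \<omega>)))))"
        using assms by (intro integrable_norm laplace_transform_bounded_right_analytic(3) prob_space_axioms) auto
      show "norm (of_bool (S_max n \<omega> \<le> 0 \<and> 0 < S (Suc n) \<omega>) * exp (- z * of_real (max 0 (S (Suc n) \<omega>))))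
         \<le> indicator {\<omega> \<in> space M. S_max n \<omega> \<le> 0 \<and> 0 < S (Suc n) \<omega>} \<omega>" if "\<omega> \<in> space M" for \<omega>
        using assms that by (auto simp: norm_mult indicator_def simp del: walk.simps)
      show "integrable M (indicat_real {\<omega> \<in> space M. S_max n \<omega> \<le> 0 \<and> 0 < S (Suc n) \<omega>})"
        by (intro integrable_real_indicator) (auto simp: less_top[symmetric] simp del: walk.simps)
    qed
    also have "\<dots> = a n" by (simp add: a_def del: walk.simps)
    finally show ?thesis using q by (simp add: norm_mult norm_power)
  qed
  then have "norm (killed_passage_transform z) \<le> suminf (\<lambda>n. q ^ Suc n * a n)"
    unfolding killed_passage_transform_def by (rule norm_suminf_le) (rule sa)
  with le show ?thesis by simp
qed

lemma killed_max_transform_at_0: "killed_max_transform 0 = of_real (1 / (1 - q))"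
proof -
  have "(\<lambda>n. complex_of_real (q ^ n)) sums (1 / (1 - of_real q))"
    using geometric_sums[of "of_real q :: complex"] q by simp
  then show ?thesis
    by (simp add: killed_max_transform_def max_transform_def prob_space sums_iff)
qed

text \<open>By \<open>killed_max_boundary\<close> and \<open>killed_survival_boundary\<close>, the product of this transform with \<open>1 - A\<close>, where
\<open>A\<close> is \<open>killed_passage_transform\<close>, extends to the left half-plane, so it is a constant. The constant is
real and positive, as is seen at \<open>z = 0\<close>, and \<open>1 - A\<close> has positive real part because \<open>\<bar>A\<bar> < 1\<close>.\<close>

lemma killed_max_transform_Re_pos:
  assumes z: "0 \<le> Re z"
  shows "0 < Re (killed_max_transform z)"
proof -
  let ?f = "\<lambda>z. killed_max_transform z * (1 - killed_passage_transform z)"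
  let ?g = "\<lambda>z. killed_survival_transform z * (1 / (1 - of_real q) - of_real q * killed_overshoot_transform z)"
  have "bounded_right_analytic ?f"
    by (intro bounded_right_analytic_mult bounded_right_analytic_diff bounded_right_analytic_const killed_max_transform killed_passage_transform)
  moreover have "bounded_right_analytic ?g"
    by (intro bounded_right_analytic_mult bounded_right_analytic_diff bounded_right_analytic_const killed_survival_transform killed_overshoot_transform)
  moreover have "?f (\<i> * of_real y) = ?g (- (\<i> * of_real y))" for y
    unfolding killed_survival_boundary[symmetric] killed_max_boundary[symmetric] by (simp add: mult_ac)
  ultimately obtain c where c: "\<And>z. 0 \<le> Re z \<Longrightarrow> ?f z = c"
    using liouville_across_imaginary_axis[of ?f ?g] by blast
  have P1: "norm (killed_passage_transform w) < 1" if "0 \<le> Re w" for w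
    using killed_passage_bound[OF that] q by simp
  have c0: "c = of_real (1 / (1 - q)) * (1 - killed_passage_transform 0)"
    using c[of 0] by (simp add: killed_max_transform_at_0)
  have K0: "killed_passage_transform 0 = 1 - killed_survival_transform 0 * of_real (1 - q)"
    using killed_survival_boundary[of 0] by (simp add: algebra_simps)
  have Im0: "Im (killed_survival_transform 0) = 0"
  proof -
    have "survival_transform n 0 \<in> \<real>" for n
    proof -
      have "survival_transform n 0 = (\<integral>\<omega>. complex_of_real (of_bool (S_max n \<omega> \<le> 0)) \<partial>M)"
        unfolding survival_transform_def by (intro Bochner_Integration.integral_cong refl) auto
      then show ?thesis by (simp only: integral_complex_of_real Reals_of_real)
    qed
    then have "of_real (q ^ n) * survival_transform n 0 \<in> \<real>" for n by simp
    then have "(\<lambda>n. Im (of_real (q ^ n) * survival_transform n 0)) = (\<lambda>n. 0)"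
      by (simp only: complex_is_Real_iff)
    then show ?thesis using sums_Im[OF summable_sums[OF killed_survival_transform(2)[of 0]]]
      by (simp add: killed_survival_transform_def sums_iff)
  qed
  have Imc: "Im c = 0" unfolding c0 K0 using Im0 by simp
  have Rec: "0 < Re c"
  proof -
    have "Re (killed_passage_transform 0) < 1" using P1[of 0] complex_Re_le_cmod[of "killed_passage_transform 0"] by simp
    then show ?thesis unfolding c0 using q by (simp del: of_real_divide of_real_diff)
  qed
  have ceq: "c = of_real (Re c)" using Imc by (simp add: complex_eq_iff)
  define w where "w = 1 - killed_passage_transform z"
  have Rew: "0 < Re w" using P1[OF z] complex_Re_le_cmod[of "killed_passage_transform z"] by (simp add: w_def)
  then have "w \<noteq> 0" by auto
  then have "killed_max_transform z = of_real (Re c) / w" using c[OF z] ceq by (simp add: w_def field_simps)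
  also have "Re \<dots> = Re c * Re w / (norm w)\<^sup>2" by (simp add: cmod_power2 Re_divide)
  finally show ?thesis using Rec Rew \<open>w \<noteq> 0\<close> by simp
qed

definition positive_transform :: "nat \<Rightarrow> complex \<Rightarrow> complex" where
  "positive_transform n z = (\<integral>\<omega>. of_bool (0 < S (Suc n) \<omega>) * exp (- z * of_real (max 0 (S (Suc n) \<omega>))) \<partial>M)"

definition nonpositive_transform :: "nat \<Rightarrow> complex \<Rightarrow> complex" where
  "nonpositive_transform n z = (\<integral>\<omega>. of_bool (S (Suc n) \<omega> \<le> 0) * exp (- z * of_real (max 0 (- S (Suc n) \<omega>))) \<partial>M)"

lemma positive_transform:
  shows "bounded_right_analytic (positive_transform n)"
    and "0 \<le> Re z \<Longrightarrow> norm (positive_transform n z) \<le> 1"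
  using laplace_transform_bounded_right_analytic(1,2)[OF prob_space_axioms, of "\<lambda>\<omega>. of_bool (0 < S (Suc n) \<omega>)" "\<lambda>\<omega>. max 0 (S (Suc n) \<omega>)"]
  by (simp_all add: positive_transform_def[abs_def] del: walk.simps)

lemma nonpositive_transform:
  shows "bounded_right_analytic (nonpositive_transform n)"
    and "0 \<le> Re z \<Longrightarrow> norm (nonpositive_transform n z) \<le> 1"
  using laplace_transform_bounded_right_analytic(1,2)[OF prob_space_axioms, of "\<lambda>\<omega>. of_bool (S (Suc n) \<omega> \<le> 0)" "\<lambda>\<omega>. max 0 (- S (Suc n) \<omega>)"]
  by (simp_all add: nonpositive_transform_def[abs_def] del: walk.simps)

lemma positive_nonpositive_sum:
  "positive_transform n (\<i> * of_real y) + nonpositive_transform n (- (\<i> * of_real y)) = increment_char (- y) ^ Suc n"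
proof -
  have i1: "integrable M (\<lambda>\<omega>. of_bool (0 < S (Suc n) \<omega>) * exp (- (\<i> * of_real y) * of_real (max 0 (S (Suc n) \<omega>))))"
    by (rule laplace_transform_bounded_right_analytic(3)[OF prob_space_axioms]) (auto simp del: walk.simps)
  have i2: "integrable M (\<lambda>\<omega>. of_bool (S (Suc n) \<omega> \<le> 0) * exp (- (- (\<i> * of_real y)) * of_real (max 0 (- S (Suc n) \<omega>))))"
    by (rule laplace_transform_bounded_right_analytic(3)[OF prob_space_axioms]) (auto simp del: walk.simps)
  have "positive_transform n (\<i> * of_real y) + nonpositive_transform n (- (\<i> * of_real y))
     = (\<integral>\<omega>. exp (\<i> * of_real (- y * S (Suc n) \<omega>)) \<partial>M)"
    unfolding positive_transform_def nonpositive_transform_def Bochner_Integration.integral_add[OF i1 i2, symmetric]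
    by (intro Bochner_Integration.integral_cong refl) (auto simp: of_bool_def max_def mult_ac simp del: walk.simps)
  then show ?thesis by (simp only: walk_char)
qed

definition spitzer_exponent :: "complex \<Rightarrow> complex" where
  "spitzer_exponent z = (\<Sum>n. of_real (q ^ Suc n / real (Suc n)) * positive_transform n z)"

definition dual_spitzer_exponent :: "complex \<Rightarrow> complex" where
  "dual_spitzer_exponent z = (\<Sum>n. of_real (q ^ Suc n / real (Suc n)) * nonpositive_transform n z)"

lemma spitzer_exponent:
  shows "bounded_right_analytic spitzer_exponent"
    and "0 \<le> Re z \<Longrightarrow> summable (\<lambda>n. of_real (q ^ Suc n / real (Suc n)) * positive_transform n z)"
  using bounded_right_analytic_weighted_series[of positive_transform, OF positive_transform q_summable_div] q
  by (simp_all add: spitzer_exponent_def[abs_def])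

lemma dual_spitzer_exponent:
  shows "bounded_right_analytic dual_spitzer_exponent"
    and "0 \<le> Re z \<Longrightarrow> summable (\<lambda>n. of_real (q ^ Suc n / real (Suc n)) * nonpositive_transform n z)"
  using bounded_right_analytic_weighted_series[of nonpositive_transform, OF nonpositive_transform q_summable_div] q
  by (simp_all add: dual_spitzer_exponent_def[abs_def])

lemma q_char_norm: "norm (of_real q * increment_char s) < 1"
proof -
  have "norm (of_real q * increment_char s) \<le> q * 1"
    unfolding norm_mult using q increment_char_bound[of s] by (intro mult_mono) auto
  then show ?thesis using q by simp
qed

lemma log_series: "(\<lambda>n. of_real (q ^ Suc n / real (Suc n)) * increment_char s ^ Suc n) sums (- Ln (1 - of_real q * increment_char s))"
proof -
  let ?w = "of_real q * increment_char s"
  have "(\<lambda>n. - ((- (- ?w)) ^ n) / of_nat n) sums ln (1 + (- ?w))"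
    by (rule Ln_series') (use q_char_norm in simp)
  then have "(\<lambda>n. - (- (?w ^ n) / of_nat n)) sums - Ln (1 - ?w)"
    by (intro sums_minus) simp
  then have "(\<lambda>n. ?w ^ n / of_nat n) sums - Ln (1 - ?w)" by simp
  then have "(\<lambda>n. ?w ^ Suc n / of_nat (Suc n)) sums - Ln (1 - ?w)"
    by (subst sums_Suc_iff) simp
  then show ?thesis by (simp add: power_mult_distrib mult_ac)
qed

text \<open>The two exponents add up to the power series of \<open>- ln (1 - q \<chi>)\<close>, since \<open>\<chi>\<^sup>n\<close> is the characteristic
function of \<open>S\<^sub>n\<close>.\<close>

lemma spitzer_boundary:
  "exp (spitzer_exponent (\<i> * of_real y) + dual_spitzer_exponent (- (\<i> * of_real y))) * (1 - of_real q * increment_char (- y)) = 1"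
proof -
  let ?w = "of_real q * increment_char (- y)"
  have "spitzer_exponent (\<i> * of_real y) + dual_spitzer_exponent (- (\<i> * of_real y))
    = (\<Sum>n. of_real (q ^ Suc n / real (Suc n)) * positive_transform n (\<i> * of_real y)
        + of_real (q ^ Suc n / real (Suc n)) * nonpositive_transform n (- (\<i> * of_real y)))"
    unfolding spitzer_exponent_def dual_spitzer_exponent_def
    by (rule suminf_add) (rule spitzer_exponent dual_spitzer_exponent, simp)+
  also have "\<dots> = - Ln (1 - ?w)"
    unfolding distrib_left[symmetric] positive_nonpositive_sum using log_series by (rule sums_unique[symmetric])
  finally have "exp (spitzer_exponent (\<i> * of_real y) + dual_spitzer_exponent (- (\<i> * of_real y))) = exp (- Ln (1 - ?w))" by simp
  moreover have "1 - ?w \<noteq> 0" using q_char_norm[of "- y"] by auto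
  ultimately show ?thesis by (simp add: exp_minus)
qed

text \<open>Spitzer's identity, normalised at \<open>w\<close> rather than at \<open>0\<close> because the Cauchy integrals below compare values inside
the half-plane. On the axis, the transform times \<open>exp (- P)\<close> equals \<open>H exp N\<close>, where \<open>H\<close> is the right-hand
side of \<open>killed_max_boundary\<close> and \<open>P\<close>, \<open>N\<close> are the two exponents; hence it is constant.\<close>

lemma killed_max_transform_spitzer:
  assumes "0 \<le> Re z" "0 \<le> Re w"
  shows "killed_max_transform z = killed_max_transform w * exp (spitzer_exponent z - spitzer_exponent w)"
proof -
  let ?f = "\<lambda>z. killed_max_transform z * exp (-1 * spitzer_exponent z)"
  let ?g = "\<lambda>z. (1 / (1 - of_real q) - of_real q * killed_overshoot_transform z) * exp (dual_spitzer_exponent z)"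
  have "bounded_right_analytic ?f"
    by (intro bounded_right_analytic_mult bounded_right_analytic_exp bounded_right_analytic_const killed_max_transform spitzer_exponent)
  moreover have "bounded_right_analytic ?g"
    by (intro bounded_right_analytic_mult bounded_right_analytic_exp bounded_right_analytic_diff bounded_right_analytic_const
        killed_overshoot_transform dual_spitzer_exponent)
  moreover have "?f (\<i> * of_real y) = ?g (- (\<i> * of_real y))" for y
  proof -
    let ?A = "spitzer_exponent (\<i> * of_real y)" and ?B = "dual_spitzer_exponent (- (\<i> * of_real y))"
      and ?w = "1 - of_real q * increment_char (- y)"
    have "exp (- 1 * ?A) = exp (- ?A) * (exp (?A + ?B) * ?w)" unfolding spitzer_boundary by simp
    also have "\<dots> = exp ?B * ?w" by (simp flip: mult.assoc exp_add)
    finally show ?thesis unfolding killed_max_boundary[symmetric] by (simp only: mult_ac)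
  qed
  ultimately obtain c where c: "\<And>z. 0 \<le> Re z \<Longrightarrow> ?f z = c"
    using liouville_across_imaginary_axis[of ?f ?g] by blast
  have "?f z = ?f w" using c assms by metis
  then show ?thesis by (simp add: exp_diff exp_minus field_simps)
qed

end

section \<open>The factor as a Cauchy integral\<close>

lemma integrable_resolvent_diff: "0 < Re z \<Longrightarrow> integrable lborel (resolvent_diff z)"
  using integrable_mult_resolvent_diff[of z "\<lambda>_. 1"] integrable_inverse_quadratic by simp

context killed_random_walk
begin

lemma increment_char_measurable [measurable]: "increment_char \<in> borel_measurable borel"
  unfolding increment_char_def[abs_def] by measurable

text \<open>Fourier inversion of \<open>x \<mapsto> exp (- z x) - exp (- x)\<close> on \<open>x > 0\<close>, integrated against the law of \<open>S\<^sub>n\<^sub>+\<^sub>1\<close>.\<close>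

lemma positive_transform_diff:
  assumes z: "0 < Re z"
  shows "positive_transform n z - positive_transform n 1
     = 1 / of_real (2 * pi) * (CLINT s|lborel. increment_char s ^ Suc n * resolvent_diff z s)"
proof -
  interpret pair_sigma_finite M lborel ..
  let ?P = "\<lambda>w \<omega>. of_bool (0 < S (Suc n) \<omega>) * exp (- w * of_real (max 0 (S (Suc n) \<omega>)))"
  let ?f = "\<lambda>\<omega> s. exp (\<i> * of_real (s * S (Suc n) \<omega>)) * resolvent_diff z s"
  have int: "integrable M (?P w)" if "0 \<le> Re w" for w
    by (rule laplace_transform_bounded_right_analytic(3)[OF prob_space_axioms]) (use that in \<open>auto simp del: walk.simps\<close>)
  have f_int: "integrable lborel (?f \<omega>)" for \<omega>
    using integrable_inverse_quadratic by (intro integrable_mult_resolvent_diff z) auto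
  have "positive_transform n z - positive_transform n 1 = (\<integral>\<omega>. ?P z \<omega> - ?P 1 \<omega> \<partial>M)"
    unfolding positive_transform_def
    by (rule Bochner_Integration.integral_diff[symmetric]; rule int) (use z in auto)
  also have "\<dots> = (\<integral>\<omega>. 1 / of_real (2 * pi) * (CLINT s|lborel. ?f \<omega> s) \<partial>M)"
    unfolding integral_exp_resolvent_diff[OF z]
    by (intro Bochner_Integration.integral_cong refl) (auto simp: of_bool_def max_def simp del: walk.simps)
  also have "\<dots> = 1 / of_real (2 * pi) * (\<integral>\<omega>. (CLINT s|lborel. ?f \<omega> s) \<partial>M)"
    by (rule integral_mult_right_zero)
  also have "(\<integral>\<omega>. (CLINT s|lborel. ?f \<omega> s) \<partial>M) = (CLINT s|lborel. (\<integral>\<omega>. ?f \<omega> s \<partial>M))"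
  proof (rule Fubini_integral[symmetric], rule Fubini_integrable)
    show "(\<lambda>(\<omega>, s). ?f \<omega> s) \<in> borel_measurable (M \<Otimes>\<^sub>M lborel)"
      by (simp del: walk.simps)
    show "integrable M (\<lambda>\<omega>. LBINT s. norm (case (\<omega>, s) of (\<omega>, s) \<Rightarrow> ?f \<omega> s))"
      by (simp add: norm_mult del: of_real_mult walk.simps)
    show "AE \<omega> in M. integrable lborel (\<lambda>s. case (\<omega>, s) of (\<omega>, s) \<Rightarrow> ?f \<omega> s)"
      using f_int by simp
  qed
  also have "\<dots> = (CLINT s|lborel. increment_char s ^ Suc n * resolvent_diff z s)"
    unfolding walk_char[symmetric] by simp
  finally show ?thesis .
qed

text \<open>The logarithmic series is summed under the integral; the weights \<open>q\<^sup>n / n\<close> are summable and the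
kernel is integrable.\<close>

lemma spitzer_exponent_diff:
  assumes z: "0 < Re z"
  shows "spitzer_exponent z - spitzer_exponent 1
     = - (1 / of_real (2 * pi)) * (CLINT s|lborel. Ln (1 - of_real q * increment_char s) * resolvent_diff z s)"
proof -
  let ?c = "\<lambda>n. q ^ Suc n / real (Suc n)"
  let ?f = "\<lambda>n s. of_real (?c n) * increment_char s ^ Suc n * resolvent_diff z s"
  have c0: "0 \<le> ?c n" for n using q by simp
  have b: "norm (?f n s) \<le> ?c n * norm (resolvent_diff z s)" for n s
  proof -
    have "norm (increment_char s ^ Suc n) \<le> 1"
      using increment_char_bound[of s] by (simp only: norm_power) (rule power_le_one, auto)
    then have "?c n * norm (increment_char s ^ Suc n) \<le> ?c n * 1" using c0 by (intro mult_left_mono)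
    then show ?thesis unfolding norm_mult norm_of_real abs_of_nonneg[OF c0] mult_1_right
      by (rule mult_right_mono) simp
  qed
  have int: "integrable lborel (?f n)" for n
  proof (rule integrable_dominated[OF _ _ b])
    show "integrable lborel (\<lambda>s. ?c n * norm (resolvent_diff z s))"
      by (intro integrable_mult_right integrable_norm integrable_resolvent_diff z)
  qed measurable
  have "(\<lambda>n. CLINT s|lborel. ?f n s) sums (CLINT s|lborel. (\<Sum>n. ?f n s))"
  proof (rule sums_integral[OF int])
    show "AE s in lborel. summable (\<lambda>n. norm (?f n s))"
    proof (rule AE_I2)
      fix s
      have "summable (\<lambda>n. ?c n * norm (resolvent_diff z s))" using q_summable_div by (rule summable_mult2)
      then show "summable (\<lambda>n. norm (?f n s))"
        by (rule summable_comparison_test') (use b in auto)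
    qed
    show "summable (\<lambda>n. LBINT s. norm (?f n s))"
    proof (rule summable_comparison_test')
      show "summable (\<lambda>n. ?c n * (LBINT s. norm (resolvent_diff z s)))" using q_summable_div by (rule summable_mult2)
      show "norm (LBINT s. norm (?f n s)) \<le> ?c n * (LBINT s. norm (resolvent_diff z s))" for n
      proof -
        have "(LBINT s. norm (?f n s)) \<le> (LBINT s. ?c n * norm (resolvent_diff z s))"
          using int[of n] integrable_resolvent_diff[OF z] b[of n] by (intro integral_mono integrable_mult_right integrable_norm) auto
        moreover have "0 \<le> (LBINT s. norm (?f n s))" by (intro Bochner_Integration.integral_nonneg) simp
        ultimately show ?thesis by simp
      qed
    qed
  qed
  also have "(CLINT s|lborel. (\<Sum>n. ?f n s)) = (CLINT s|lborel. - (Ln (1 - of_real q * increment_char s) * resolvent_diff z s))"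
  proof (intro Bochner_Integration.integral_cong refl)
    fix s
    have "(\<lambda>n. ?f n s) sums (- Ln (1 - of_real q * increment_char s) * resolvent_diff z s)"
      using log_series by (rule sums_mult2)
    then show "(\<Sum>n. ?f n s) = - (Ln (1 - of_real q * increment_char s) * resolvent_diff z s)"
      by (simp add: sums_iff)
  qed
  finally have sums1: "(\<lambda>n. CLINT s|lborel. ?f n s) sums - (CLINT s|lborel. Ln (1 - of_real q * increment_char s) * resolvent_diff z s)"
    by simp
  have term_eq: "1 / of_real (2 * pi) * (CLINT s|lborel. ?f n s)
     = of_real (?c n) * positive_transform n z - of_real (?c n) * positive_transform n 1" for n
  proof -
    have "(CLINT s|lborel. ?f n s) = of_real (?c n) * (CLINT s|lborel. increment_char s ^ Suc n * resolvent_diff z s)"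
      unfolding mult.assoc by (rule integral_mult_right_zero)
    then show ?thesis
      unfolding right_diff_distrib[symmetric] positive_transform_diff[OF z] by (simp only: mult.left_commute)
  qed
  have "(\<lambda>n. of_real (?c n) * positive_transform n z - of_real (?c n) * positive_transform n 1) sums
     (spitzer_exponent z - spitzer_exponent 1)"
    unfolding spitzer_exponent_def
    by (intro sums_diff summable_sums spitzer_exponent(2)) (use z in auto)
  moreover have "(\<lambda>n. of_real (?c n) * positive_transform n z - of_real (?c n) * positive_transform n 1) sums
     (1 / of_real (2 * pi) * - (CLINT s|lborel. Ln (1 - of_real q * increment_char s) * resolvent_diff z s))"
    unfolding term_eq[symmetric] by (rule sums_mult[OF sums1])
  ultimately have "spitzer_exponent z - spitzer_exponent 1
     = 1 / of_real (2 * pi) * - (CLINT s|lborel. Ln (1 - of_real q * increment_char s) * resolvent_diff z s)"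
    by (rule sums_unique2)
  then show ?thesis by simp
qed

theorem killed_max_transform_formula:
  assumes z: "0 < Re z"
  shows "killed_max_transform z = killed_max_transform 1 *
     exp (- (1 / of_real (2 * pi)) * (CLINT s|lborel. Ln (1 - of_real q * increment_char s) * resolvent_diff z s))"
  using killed_max_transform_spitzer[of z 1] z unfolding spitzer_exponent_diff[OF z] by simp

end

section \<open>Grid maxima of cadlag paths\<close>

lemma walk_max_le_iff: "walk_max x n \<le> c \<longleftrightarrow> (\<forall>k\<le>n. walk x k \<le> c)"
proof (induction n)
  case (Suc n)
  then show ?case by (auto simp: le_Suc_eq simp del: walk.simps(2))
qed simp

lemma walk_le_walk_max': "k \<le> n \<Longrightarrow> walk x k \<le> walk_max x n"
  using walk_max_le_iff[of x n "walk_max x n"] by simp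

lemma walk_telescope: "walk (\<lambda>i. f (real (Suc i) * h) - f (real i * h)) n = f (real n * h) - f 0"
  by (induction n) auto

lemma walk_max_measurable_gen:
  assumes "\<And>i. (\<lambda>\<omega>. x i \<omega>) \<in> borel_measurable N"
  shows "(\<lambda>\<omega>. walk_max (\<lambda>i. x i \<omega>) n) \<in> borel_measurable N"
proof -
  have walk: "(\<lambda>\<omega>. walk (\<lambda>i. x i \<omega>) k) \<in> borel_measurable N" for k
    by (induction k) (auto intro!: borel_measurable_add assms)
  show ?thesis by (induction n) (auto intro!: borel_measurable_max borel_measurable_add walk assms)
qed

text \<open>A cadlag function is bounded near each point, from the right by continuity and from the left by the existence
of a limit; bisection makes the bound uniform on a compact interval.\<close>

lemma cadlag_bdd_above:
  assumes f: "cadlag f" and T: "0 \<le> T"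
  shows "bdd_above (f ` {0..T})"
proof -
  define P where "P a b \<longleftrightarrow> bdd_above (f ` ({a..b} \<inter> {0..T}))" for a b
  have "P 0 T"
  proof (rule Bolzano[OF T])
    fix a b c assume "P a b" "P b c" "a \<le> b" "b \<le> c"
    moreover have "f ` ({a..c} \<inter> {0..T}) \<subseteq> f ` ({a..b} \<inter> {0..T}) \<union> f ` ({b..c} \<inter> {0..T})"
      unfolding image_Un[symmetric] by (rule image_mono) auto
    ultimately show "P a c" unfolding P_def by (meson bdd_above_Un bdd_above_mono)
  next
    fix x assume x: "0 \<le> x" "x \<le> T"
    have "continuous (at_right x) f" using f x by (auto simp: cadlag_def)
    then have "(f \<longlongrightarrow> f x) (at_right x)" by (simp add: continuous_within)
    then have "eventually (\<lambda>y. f y < f x + 1) (at_right x)" by (rule order_tendstoD) simp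
    then obtain r where r: "x < r" "\<And>y. x < y \<Longrightarrow> y < r \<Longrightarrow> f y < f x + 1"
      unfolding eventually_at_right_field by auto
    have "\<exists>l C. l < x \<and> (\<forall>y. 0 \<le> y \<longrightarrow> l < y \<longrightarrow> y < x \<longrightarrow> f y \<le> C)"
    proof (cases "x = 0")
      case False
      then have "0 < x" using x by simp
      then obtain L where "(f \<longlongrightarrow> L) (at_left x)" using f unfolding cadlag_def by blast
      then have "eventually (\<lambda>y. f y < L + 1) (at_left x)" by (rule order_tendstoD) simp
      then obtain l where "l < x" "\<And>y. l < y \<Longrightarrow> y < x \<Longrightarrow> f y < L + 1"
        unfolding eventually_at_left_field by auto
      then show ?thesis by (intro exI[of _ l] exI[of _ "L + 1"]) (auto intro: less_imp_le)
    qed (auto intro!: exI[of _ "- 1"])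
    then obtain l C where l: "l < x" "\<And>y. 0 \<le> y \<Longrightarrow> l < y \<Longrightarrow> y < x \<Longrightarrow> f y \<le> C" by blast
    define d where "d = min (r - x) (x - l)"
    have "P a b" if ab: "a \<le> x" "x \<le> b" "b - a < d" for a b
      unfolding P_def
    proof (rule bdd_aboveI2)
      fix y assume y: "y \<in> {a..b} \<inter> {0..T}"
      then have "l < y" "y < r" using ab by (auto simp: d_def)
      then show "f y \<le> max C (f x + 1)"
        using l(2)[of y] r(2)[of y] y by (cases "y < x"; cases "y = x") (auto simp: le_max_iff_disj less_imp_le)
    qed
    moreover have "0 < d" using r l by (simp add: d_def)
    ultimately show "\<exists>d>0. \<forall>a b. a \<le> x \<and> x \<le> b \<and> b - a < d \<longrightarrow> P a b" by blast
  qed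
  then show ?thesis by (simp add: P_def)
qed

lemma cadlag_right:
  assumes f: "cadlag f" and u: "0 \<le> u"
  shows "f u < c \<Longrightarrow> \<exists>d>0. \<forall>v. u \<le> v \<longrightarrow> v < u + d \<longrightarrow> f v < c"
    and "c < f u \<Longrightarrow> \<exists>d>0. \<forall>v. u \<le> v \<longrightarrow> v < u + d \<longrightarrow> c < f v"
proof -
  have "continuous (at_right u) f" using f u by (auto simp: cadlag_def)
  then have lim: "(f \<longlongrightarrow> f u) (at_right u)" by (simp add: continuous_within)
  show "\<exists>d>0. \<forall>v. u \<le> v \<longrightarrow> v < u + d \<longrightarrow> f v < c" if c: "f u < c"
  proof -
    obtain r where r: "u < r" "\<And>y. u < y \<Longrightarrow> y < r \<Longrightarrow> f y < c"
      using order_tendstoD(2)[OF lim c] unfolding eventually_at_right_field by auto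
    show ?thesis
    proof (intro exI[of _ "r - u"] conjI allI impI)
      fix v assume "u \<le> v" "v < u + (r - u)"
      then show "f v < c" using r(2)[of v] c by (cases "u = v") auto
    qed (use r in simp)
  qed
  show "\<exists>d>0. \<forall>v. u \<le> v \<longrightarrow> v < u + d \<longrightarrow> c < f v" if c: "c < f u"
  proof -
    obtain r where r: "u < r" "\<And>y. u < y \<Longrightarrow> y < r \<Longrightarrow> c < f y"
      using order_tendstoD(1)[OF lim c] unfolding eventually_at_right_field by auto
    show ?thesis
    proof (intro exI[of _ "r - u"] conjI allI impI)
      fix v assume "u \<le> v" "v < u + (r - u)"
      then show "c < f v" using r(2)[of v] c by (cases "u = v") auto
    qed (use r in simp)
  qed
qed

lemma nat_ceiling_grid:
  fixes u h :: real
  assumes "0 \<le> u" "0 < h"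
  shows "u \<le> real (nat \<lceil>u / h\<rceil>) * h" "real (nat \<lceil>u / h\<rceil>) * h < u + h"
proof -
  have "0 \<le> u / h" using assms by simp
  then have c: "real (nat \<lceil>u / h\<rceil>) = of_int \<lceil>u / h\<rceil>" by simp
  have "u / h \<le> of_int \<lceil>u / h\<rceil>" "of_int \<lceil>u / h\<rceil> < u / h + 1" by linarith+
  then have "u \<le> of_int \<lceil>u / h\<rceil> * h" "of_int \<lceil>u / h\<rceil> * h < (u / h + 1) * h"
    using assms(2) by (simp_all only: pos_divide_le_eq mult_less_cancel_right_pos)
  then show "u \<le> real (nat \<lceil>u / h\<rceil>) * h" "real (nat \<lceil>u / h\<rceil>) * h < u + h"
    unfolding c using assms(2) by (simp_all add: distrib_right)
qed

text \<open>The time \<open>T\<close> is rounded up: a value near the supremum is approximated from the right by the next grid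
point, and at most one grid point lies beyond \<open>T\<close>, where right continuity at \<open>T\<close> controls the path.
Rounding up rather than down is what catches a jump at \<open>T\<close>.\<close>

lemma grid_max_tendsto_sup:
  assumes f: "cadlag f" "f 0 = 0" and T: "0 \<le> T" and h: "\<And>m. 0 < h m" "h \<longlonglongrightarrow> 0"
  shows "(\<lambda>m. walk_max (\<lambda>i. f (real (Suc i) * h m) - f (real i * h m)) (nat \<lceil>T / h m\<rceil>)) \<longlonglongrightarrow> (SUP u\<in>{0..T}. f u)"
proof (rule order_tendstoI)
  let ?x = "\<lambda>m i. f (real (Suc i) * h m) - f (real i * h m)"
  have walk: "walk (?x m) k = f (real k * h m)" for m k
    using walk_telescope[of f "h m" k] f(2) by simp
  have bdd: "bdd_above (f ` {0..T})" by (rule cadlag_bdd_above[OF f(1) T])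
  {
    fix a assume "a < (SUP u\<in>{0..T}. f u)"
    then obtain u where u: "0 \<le> u" "u \<le> T" "a < f u"
      using less_cSUP_iff[OF _ bdd] T by auto
    obtain d where d: "0 < d" "\<And>v. u \<le> v \<Longrightarrow> v < u + d \<Longrightarrow> a < f v"
      using cadlag_right(2)[OF f(1) u(1) u(3)] by blast
    show "eventually (\<lambda>m. a < walk_max (?x m) (nat \<lceil>T / h m\<rceil>)) sequentially"
      using order_tendstoD(2)[OF h(2) d(1)]
    proof eventually_elim
      case (elim m)
      have "a < f (real (nat \<lceil>u / h m\<rceil>) * h m)"
        using nat_ceiling_grid[OF u(1) h(1)[of m]] elim by (intro d(2)) auto
      also have "\<dots> = walk (?x m) (nat \<lceil>u / h m\<rceil>)" by (rule walk[symmetric])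
      also have "\<dots> \<le> walk_max (?x m) (nat \<lceil>T / h m\<rceil>)"
        using u h(1)[of m] by (intro walk_le_walk_max' nat_mono ceiling_mono divide_right_mono) auto
      finally show ?case .
    qed
  }
  {
    fix a assume a: "(SUP u\<in>{0..T}. f u) < a"
    obtain b where b: "(SUP u\<in>{0..T}. f u) < b" "b < a" using dense[OF a] by blast
    have le: "f u \<le> (SUP u\<in>{0..T}. f u)" if "0 \<le> u" "u \<le> T" for u
      using that by (intro cSUP_upper bdd) auto
    then have "f T < b" using b T by force
    then obtain d where d: "0 < d" "\<And>v. T \<le> v \<Longrightarrow> v < T + d \<Longrightarrow> f v < b"
      using cadlag_right(1)[OF f(1) T] by blast
    show "eventually (\<lambda>m. walk_max (?x m) (nat \<lceil>T / h m\<rceil>) < a) sequentially"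
      using order_tendstoD(2)[OF h(2) d(1)]
    proof eventually_elim
      case (elim m)
      have "walk_max (?x m) (nat \<lceil>T / h m\<rceil>) \<le> b"
        unfolding walk_max_le_iff walk
      proof (intro allI impI)
        fix k assume k: "k \<le> nat \<lceil>T / h m\<rceil>"
        have "real k * h m \<le> real (nat \<lceil>T / h m\<rceil>) * h m" using k h(1)[of m] by (intro mult_right_mono) auto
        also have "\<dots> < T + h m" by (rule nat_ceiling_grid[OF T h(1)])
        finally have "real k * h m < T + d" using elim by simp
        then show "f (real k * h m) \<le> b"
          using d(2)[of "real k * h m"] le[of "real k * h m"] b h(1)[of m] by (cases "real k * h m \<le> T") auto
      qed
      then show ?case using b by simp
    qed
  }
qed

lemma borel_measurable_completion_AE:
  fixes f g :: "'a \<Rightarrow> real"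
  assumes f[measurable]: "f \<in> borel_measurable M" and eq: "AE x in M. f x = g x"
  shows "g \<in> borel_measurable (completion M)"
proof (rule measurableI)
  show "g x \<in> space borel" for x by simp
  fix A :: "real set" assume [measurable]: "A \<in> sets borel"
  show "g -` A \<inter> space (completion M) \<in> sets (completion M)"
  proof (rule completion.in_sets_AE)
    show "AE x in completion M. x \<in> f -` A \<inter> space M \<longleftrightarrow> x \<in> g -` A \<inter> space (completion M)"
      by (rule AE_completion) (use eq in auto)
    have "f -` A \<inter> space M \<in> sets M" by measurable
    then show "f -` A \<inter> space M \<in> sets (completion M)" by simp
  qed auto
qed

lemma (in prob_space) indep_var_of_indep_set:
  assumes ind: "indep_set (sets F) (sets G)" and sp: "space F = space M" "space G = space M"
    and f: "f \<in> F \<rightarrow>\<^sub>M S" and g: "g \<in> G \<rightarrow>\<^sub>M T"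
  shows "indep_var S f T g"
proof -
  have sub: "sets F \<subseteq> events" "sets G \<subseteq> events" using ind indep_setD_ev1 indep_setD_ev2 by auto
  have rv: "f \<in> M \<rightarrow>\<^sub>M S" "g \<in> M \<rightarrow>\<^sub>M T"
    using f g sub sp by (auto simp: measurable_def)
  have 1: "sigma_sets (space M) {f -` A \<inter> space M |A. A \<in> sets S} \<subseteq> sets F"
    unfolding sp(1)[symmetric] by (rule sets.sigma_sets_subset) (use f in \<open>auto intro: measurable_sets\<close>)
  have 2: "sigma_sets (space M) {g -` A \<inter> space M |A. A \<in> sets T} \<subseteq> sets G"
    unfolding sp(2)[symmetric] by (rule sets.sigma_sets_subset) (use g in \<open>auto intro: measurable_sets\<close>)
  show ?thesis unfolding indep_var_eq
    using rv indep_sets_mono_sets[OF ind[unfolded indep_set_def]] 1 2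
    by (auto simp: indep_set_def split: bool.split)
qed

section \<open>The supremum of a stable process at an exponential time\<close>

locale killed_stable_process =
  fixes \<alpha> \<rho> :: real and M :: "'a measure" and X :: "real \<Rightarrow> 'a \<Rightarrow> real" and e :: "'a \<Rightarrow> real"
  assumes adm: "(\<alpha>, \<rho>) \<in> admissible"
    and stable: "stable_process \<alpha> \<rho> M X"
    and e_law: "distributed M lborel e (exponential_density 1)"
    and e_indep: "indep_of_process M e X"
begin

sublocale prob_space M
  using stable by (simp add: stable_process_def levy_process_def)

abbreviation "\<Psi> \<equiv> stable_exponent \<alpha> \<rho>"

definition grid_step :: "real \<Rightarrow> nat \<Rightarrow> 'a \<Rightarrow> real" where
  "grid_step h k \<omega> = X (real (Suc k) * h) \<omega> - X (real k * h) \<omega>"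

lemma X_measurable [measurable]: "0 \<le> t \<Longrightarrow> X t \<in> borel_measurable M"
  using stable by (simp add: stable_process_def levy_process_def)

lemma e_measurable [measurable]: "e \<in> borel_measurable M"
  using distributed_measurable[OF e_law] by simp

lemma grid_step_law: 
  assumes "0 \<le> h"
  shows "distr M borel (grid_step h k) = distr M borel (X h)"
proof -
  have st: "\<forall>s\<ge>0. \<forall>t\<ge>0. distr M borel (\<lambda>\<omega>. X (s + t) \<omega> - X s \<omega>) = distr M borel (X t)"
    using stable unfolding stable_process_def levy_process_def by blast
  have "grid_step h k = (\<lambda>\<omega>. X (real k * h + h) \<omega> - X (real k * h) \<omega>)"
    by (simp add: grid_step_def fun_eq_iff algebra_simps)
  then show ?thesis using st assms by simp
qed

lemma killed_grid_walk:
  assumes h: "0 < h"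
  shows "killed_random_walk M (grid_step h) (exp (- h))"
proof unfold_locales
  have ind: "\<forall>n (t :: nat \<Rightarrow> real). 0 \<le> t 0 \<and> (\<forall>i<n. t i \<le> t (Suc i)) \<longrightarrow>
        indep_vars (\<lambda>_. borel) (\<lambda>i \<omega>. X (t (Suc i)) \<omega> - X (t i) \<omega>) {..<n}"
    using stable unfolding stable_process_def levy_process_def by blast
  show "indep_vars (\<lambda>_. borel) (grid_step h) {..<n}" for n
  proof -
    have "0 \<le> real 0 * h \<and> (\<forall>i<n. real i * h \<le> real (Suc i) * h)" using h by (auto simp: mult_right_mono)
    then have "indep_vars (\<lambda>_. borel) (\<lambda>i \<omega>. X (real (Suc i) * h) \<omega> - X (real i * h) \<omega>) {..<n}"
      using ind[rule_format, of "\<lambda>i. real i * h" n] by blast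
    then show ?thesis by (simp add: grid_step_def[abs_def])
  qed
  show "distr M borel (grid_step h n) = distr M borel (grid_step h 0)" for n
    using grid_step_law[of h] h by simp
qed (use h in auto)

lemma grid_step_measurable [measurable]: "0 \<le> h \<Longrightarrow> grid_step h k \<in> borel_measurable M"
  unfolding grid_step_def[abs_def] by measurable

lemma grid_increment_char:
  assumes h: "0 < h"
  shows "random_walk.increment_char M (grid_step h) s = exp (- of_real h * \<Psi> s)"
proof -
  interpret killed_random_walk M "grid_step h" "exp (- h)" by (rule killed_grid_walk[OF h])
  have [measurable]: "grid_step h 0 \<in> borel_measurable M" using h by simp
  have "increment_char s = (CLINT y|distr M borel (grid_step h 0). exp (\<i> * of_real (s * y)))"
    unfolding increment_char_def by (rule integral_distr[symmetric]) auto
  also have "\<dots> = char (distr M borel (X h)) s"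
    unfolding char_def using grid_step_law[of h 0] h by simp
  also have "\<dots> = exp (- of_real h * \<Psi> s)"
    using stable h unfolding stable_process_def by auto
  finally show ?thesis .
qed

lemma prob_e_interval:
  assumes h: "0 < h"
  shows "prob {\<omega> \<in> space M. real n * h < e \<omega> \<and> e \<omega> \<le> real (Suc n) * h} = exp (- h) ^ n * (1 - exp (- h))"
proof -
  have gt: "prob {\<omega> \<in> space M. real n * h < e \<omega>} = exp (- h) ^ n" for n
    using exponential_distributedD_gt[OF e_law, of "real n * h"] h
    by (simp flip: exp_of_nat_mult)
  have "{\<omega> \<in> space M. real n * h < e \<omega> \<and> e \<omega> \<le> real (Suc n) * h}
      = {\<omega> \<in> space M. real n * h < e \<omega>} - {\<omega> \<in> space M. real (Suc n) * h < e \<omega>}" by auto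
  also have "prob \<dots> = prob {\<omega> \<in> space M. real n * h < e \<omega>} - prob {\<omega> \<in> space M. real (Suc n) * h < e \<omega>}"
  proof (rule finite_measure_Diff)
    have "real n * h \<le> real (Suc n) * h" using h by (intro mult_right_mono) auto
    then show "{\<omega> \<in> space M. real (Suc n) * h < e \<omega>} \<subseteq> {\<omega> \<in> space M. real n * h < e \<omega>}" by auto
  qed measurable
  also have "\<dots> = exp (- h) ^ n * (1 - exp (- h))" unfolding gt by (simp add: algebra_simps)
  finally show ?thesis .
qed

lemma e_pos: "AE \<omega> in M. 0 < e \<omega>"
proof -
  have "prob {\<omega> \<in> space M. 0 < e \<omega>} = 1"
    using exponential_distributedD_gt[OF e_law, of 0] by simp
  then show ?thesis by (subst prob_Collect_eq_1[symmetric]) auto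
qed

text \<open>The hypothesis on \<open>F\<close> expresses that \<open>F\<close> is a functional of the values \<open>X t\<close>: it is measurable for
every \<open>\<sigma>\<close>-algebra that makes all of them measurable.\<close>

lemma e_indep_functional:
  assumes F: "\<And>N. (\<And>t. 0 \<le> t \<Longrightarrow> X t \<in> borel_measurable N) \<Longrightarrow> F \<in> N \<rightarrow>\<^sub>M (borel :: complex measure)"
    and f: "f \<in> borel \<rightarrow>\<^sub>M (borel :: complex measure)"
  shows "indep_var borel (\<lambda>\<omega>. f (e \<omega>)) borel F"
proof (rule indep_var_of_indep_set)
  let ?E = "vimage_algebra (space M) e borel"
  let ?X = "vimage_algebra (space M) (\<lambda>\<omega>. \<lambda>t\<in>{0..}. X t \<omega>) (Pi\<^sub>M {0..} (\<lambda>_. borel))"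
  show "indep_set (sets ?E) (sets ?X)" using e_indep unfolding indep_of_process_def .
  show "space ?E = space M" "space ?X = space M" by simp_all
  have "e \<in> ?E \<rightarrow>\<^sub>M borel" by (rule measurable_vimage_algebra1) auto
  then show "(\<lambda>\<omega>. f (e \<omega>)) \<in> borel_measurable ?E" using f by (rule measurable_compose)
  show "F \<in> borel_measurable ?X"
  proof (rule F)
    fix t :: real assume t: "0 \<le> t"
    have "(\<lambda>\<omega>. \<lambda>t\<in>{0..}. X t \<omega>) \<in> ?X \<rightarrow>\<^sub>M Pi\<^sub>M {0..} (\<lambda>_. borel)"
      by (rule measurable_vimage_algebra1) (auto simp: space_PiM)
    then have "(\<lambda>\<omega>. (\<lambda>t\<in>{0..}. X t \<omega>) t) \<in> borel_measurable ?X"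
      by (rule measurable_compose) (use t in \<open>auto intro: measurable_component_singleton\<close>)
    then show "X t \<in> borel_measurable ?X" using t by simp
  qed
qed

definition grid_max :: "real \<Rightarrow> 'a \<Rightarrow> real" where
  "grid_max h \<omega> = walk_max (\<lambda>i. grid_step h i \<omega>) (nat \<lceil>e \<omega> / h\<rceil>)"

lemma grid_max_measurable [measurable]: "0 < h \<Longrightarrow> grid_max h \<in> borel_measurable M"
proof -
  assume h: "0 < h"
  have [measurable]: "(\<lambda>\<omega>. walk_max (\<lambda>i. grid_step h i \<omega>) n) \<in> borel_measurable M" for n
    by (rule walk_max_measurable_gen) (use h in simp)
  show ?thesis unfolding grid_max_def[abs_def]
    by (rule measurable_compose_countable[where g = "\<lambda>\<omega>. nat \<lceil>e \<omega> / h\<rceil>"]) measurable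
qed

lemma grid_max_nonneg: "0 \<le> grid_max h \<omega>"
  unfolding grid_max_def by (rule walk_max_nonneg)

text \<open>The rounded time \<open>\<lceil>e / h\<rceil>\<close> is at least \<open>1\<close> almost surely and equals \<open>n + 1\<close> with probability
\<open>q\<^sup>n (1 - q)\<close>, independently of the walk. The series therefore lacks the term \<open>n = 0\<close>, which is \<open>1\<close>.\<close>

lemma grid_max_transform:
  assumes h: "0 < h" and z: "0 \<le> Re z"
  shows "(\<integral>\<omega>. exp (- z * of_real (grid_max h \<omega>)) \<partial>M)
     = of_real (1 - exp (- h)) / of_real (exp (- h)) * (killed_random_walk.killed_max_transform M (grid_step h) (exp (- h)) z - 1)"
proof -
  define q where "q = exp (- h)"
  interpret killed_random_walk M "grid_step h" q unfolding q_def by (rule killed_grid_walk[OF h])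
  let ?Y = "\<lambda>n \<omega>. exp (- z * of_real (walk_max (\<lambda>i. grid_step h i \<omega>) n))"
  let ?I = "\<lambda>n x. of_bool (real n * h < x \<and> x \<le> real (Suc n) * h) :: complex"
  have Ynorm: "norm (?Y n \<omega>) \<le> 1" for n \<omega>
    using z walk_max_nonneg[of "\<lambda>i. grid_step h i \<omega>" n] by simp
  have Yint: "integrable M (?Y n)" for n
    by (rule integrable_const_bound[of _ 1]) (use Ynorm in auto)
  have Iint: "integrable M (\<lambda>\<omega>. ?I n (e \<omega>))" for n
    by (rule integrable_const_bound[of _ 1]) auto
  have I_eq: "(\<integral>\<omega>. ?I n (e \<omega>) \<partial>M) = of_real (q ^ n * (1 - q))" for n
  proof -
    have "(\<integral>\<omega>. ?I n (e \<omega>) \<partial>M) = (\<integral>\<omega>. complex_of_real (indicator {\<omega> \<in> space M. real n * h < e \<omega> \<and> e \<omega> \<le> real (Suc n) * h} \<omega>) \<partial>M)"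
      by (intro Bochner_Integration.integral_cong) (auto simp: indicator_def)
    also have "\<dots> = of_real (prob {\<omega> \<in> space M. real n * h < e \<omega> \<and> e \<omega> \<le> real (Suc n) * h})"
      by (subst integral_complex_of_real) simp
    finally show ?thesis unfolding prob_e_interval[OF h] q_def .
  qed
  have term_eq: "(\<integral>\<omega>. ?I n (e \<omega>) * ?Y (Suc n) \<omega> \<partial>M) = of_real (q ^ n * (1 - q)) * max_transform (Suc n) z"
    and term_int: "integrable M (\<lambda>\<omega>. ?I n (e \<omega>) * ?Y (Suc n) \<omega>)" for n
  proof -
    have ind: "indep_var borel (\<lambda>\<omega>. ?I n (e \<omega>)) borel (?Y (Suc n))"
    proof (rule e_indep_functional)
      fix N assume N: "\<And>t. 0 \<le> t \<Longrightarrow> X t \<in> borel_measurable N"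
      have "grid_step h i \<in> borel_measurable N" for i
        unfolding grid_step_def[abs_def] by (intro borel_measurable_diff N) (use h in auto)
      then have [measurable]: "(\<lambda>\<omega>. walk_max (\<lambda>i. grid_step h i \<omega>) (Suc n)) \<in> borel_measurable N"
        by (rule walk_max_measurable_gen)
      show "?Y (Suc n) \<in> borel_measurable N" by measurable
    qed measurable
    show "(\<integral>\<omega>. ?I n (e \<omega>) * ?Y (Suc n) \<omega> \<partial>M) = of_real (q ^ n * (1 - q)) * max_transform (Suc n) z"
      unfolding max_transform_def I_eq[symmetric]
      by (rule indep_var_lebesgue_integral[OF ind Iint Yint])
    show "integrable M (\<lambda>\<omega>. ?I n (e \<omega>) * ?Y (Suc n) \<omega>)"
      by (rule indep_var_integrable[OF ind Iint Yint])
  qed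
  have I_unique: "real n * h < x \<and> x \<le> real (Suc n) * h \<longleftrightarrow> nat \<lceil>x / h\<rceil> = Suc n" for n x
  proof -
    have "real n * h < x \<and> x \<le> real (Suc n) * h \<longleftrightarrow> real n < x / h \<and> x / h \<le> real (Suc n)"
      using h by (simp add: pos_less_divide_eq pos_divide_le_eq)
    also have "\<dots> \<longleftrightarrow> \<lceil>x / h\<rceil> = int (Suc n)" by (auto simp: ceiling_eq_iff)
    also have "\<dots> \<longleftrightarrow> nat \<lceil>x / h\<rceil> = Suc n" by auto
    finally show ?thesis .
  qed
  have pt: "(\<lambda>n. ?I n (e \<omega>) * ?Y (Suc n) \<omega>) sums exp (- z * of_real (grid_max h \<omega>))" if "0 < e \<omega>" for \<omega>
  proof -
    have "0 < nat \<lceil>e \<omega> / h\<rceil>" using that h by simp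
    then obtain k where k: "nat \<lceil>e \<omega> / h\<rceil> = Suc k" using gr0_conv_Suc by blast
    have "(\<lambda>n. ?I n (e \<omega>) * ?Y (Suc n) \<omega>) = (\<lambda>n. if n = k then ?Y (Suc n) \<omega> else 0)"
      unfolding I_unique k by (auto simp: fun_eq_iff simp del: walk_max.simps)
    moreover have "(\<lambda>n. if n = k then ?Y (Suc n) \<omega> else 0) sums ?Y (Suc k) \<omega>"
      by (rule sums_single)
    ultimately show ?thesis by (simp only: grid_max_def k)
  qed
  have n_eq: "(\<integral>\<omega>. norm (?I n (e \<omega>) * ?Y (Suc n) \<omega>) \<partial>M) \<le> q ^ n" for n
  proof -
    have "(\<integral>\<omega>. norm (?I n (e \<omega>) * ?Y (Suc n) \<omega>) \<partial>M) \<le> (\<integral>\<omega>. indicator {\<omega> \<in> space M. real n * h < e \<omega> \<and> e \<omega> \<le> real (Suc n) * h} \<omega> \<partial>M)"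
    proof (rule integral_mono)
      show "integrable M (\<lambda>\<omega>. norm (?I n (e \<omega>) * ?Y (Suc n) \<omega>))" by (rule integrable_norm[OF term_int])
      show "integrable M (indicat_real {\<omega> \<in> space M. real n * h < e \<omega> \<and> e \<omega> \<le> real (Suc n) * h})"
        by (intro integrable_real_indicator) (auto simp: less_top[symmetric])
      show "norm (?I n (e \<omega>) * ?Y (Suc n) \<omega>) \<le> indicator {\<omega> \<in> space M. real n * h < e \<omega> \<and> e \<omega> \<le> real (Suc n) * h} \<omega>"
        if "\<omega> \<in> space M" for \<omega>
      proof -
        have "norm (?Y (Suc n) \<omega>) \<le> 1" by (rule Ynorm)
        then show ?thesis using that by (simp only: norm_mult) (auto simp: indicator_def simp del: walk_max.simps)
      qed
    qed
    also have "\<dots> = q ^ n * (1 - q)" using prob_e_interval[OF h, of n] by (simp add: q_def)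
    also have "\<dots> \<le> q ^ n" using q by (simp add: mult_left_le)
    finally show ?thesis .
  qed
  have "(\<lambda>n. (\<integral>\<omega>. ?I n (e \<omega>) * ?Y (Suc n) \<omega> \<partial>M)) sums (\<integral>\<omega>. (\<Sum>n. ?I n (e \<omega>) * ?Y (Suc n) \<omega>) \<partial>M)"
  proof (rule sums_integral[OF term_int])
    show "AE \<omega> in M. summable (\<lambda>n. norm (?I n (e \<omega>) * ?Y (Suc n) \<omega>))"
    proof (rule AE_I2)
      fix \<omega>
      show "summable (\<lambda>n. norm (?I n (e \<omega>) * ?Y (Suc n) \<omega>))"
      proof (rule summable_finite[of "{nat \<lceil>e \<omega> / h\<rceil> - 1}"])
        show "norm (?I n (e \<omega>) * ?Y (Suc n) \<omega>) = 0" if "n \<notin> {nat \<lceil>e \<omega> / h\<rceil> - 1}" for n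
          unfolding I_unique using that by (auto simp del: walk_max.simps)
      qed simp
    qed
    show "summable (\<lambda>n. \<integral>\<omega>. norm (?I n (e \<omega>) * ?Y (Suc n) \<omega>) \<partial>M)"
      by (rule summable_comparison_test'[OF q_summable])
         (use n_eq in \<open>simp only: real_norm_def abs_of_nonneg[OF Bochner_Integration.integral_nonneg[OF norm_ge_zero]]\<close>)
  qed
  also have "(\<integral>\<omega>. (\<Sum>n. ?I n (e \<omega>) * ?Y (Suc n) \<omega>) \<partial>M) = (\<integral>\<omega>. exp (- z * of_real (grid_max h \<omega>)) \<partial>M)"
  proof (rule integral_cong_AE)
    show "AE \<omega> in M. (\<Sum>n. ?I n (e \<omega>) * ?Y (Suc n) \<omega>) = exp (- z * of_real (grid_max h \<omega>))"
      using e_pos by eventually_elim (rule sums_unique[symmetric, OF pt])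
    show "(\<lambda>\<omega>. \<Sum>n. ?I n (e \<omega>) * ?Y (Suc n) \<omega>) \<in> borel_measurable M"
      by (rule borel_measurable_suminf) (rule borel_measurable_integrable[OF term_int])
    have [measurable]: "grid_max h \<in> borel_measurable M" using h by simp
    show "(\<lambda>\<omega>. exp (- z * of_real (grid_max h \<omega>))) \<in> borel_measurable M" by measurable
  qed
  finally have s1: "(\<lambda>n. of_real (q ^ n * (1 - q)) * max_transform (Suc n) z) sums (\<integral>\<omega>. exp (- z * of_real (grid_max h \<omega>)) \<partial>M)"
    unfolding term_eq .
  have "(\<lambda>n. of_real (q ^ n) * max_transform n z) sums killed_max_transform z"
    unfolding killed_max_transform_def by (rule summable_sums[OF killed_max_transform(2)[OF z]])
  then have "(\<lambda>n. of_real (q ^ Suc n) * max_transform (Suc n) z) sums (killed_max_transform z - 1)"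
    by (subst sums_Suc_iff) simp
  then have "(\<lambda>n. of_real (1 - q) / of_real q * (of_real (q ^ Suc n) * max_transform (Suc n) z)) sums (of_real (1 - q) / of_real q * (killed_max_transform z - 1))"
    by (rule sums_mult)
  moreover have "of_real (1 - q) / of_real q * (of_real (q ^ Suc n) * max_transform (Suc n) z) = of_real (q ^ n * (1 - q)) * max_transform (Suc n) z" for n
    using q by (simp add: field_simps)
  ultimately have "(\<lambda>n. of_real (q ^ n * (1 - q)) * max_transform (Suc n) z) sums (of_real (1 - q) / of_real q * (killed_max_transform z - 1))"
    by simp
  from sums_unique2[OF s1 this] show ?thesis unfolding q_def .
qed

text \<open>\<open>R\<close> is a measurable version of the supremum at time \<open>e\<close>; it moves the integral from the completion of \<open>M\<close> to
\<open>M\<close> itself.\<close>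

lemma phi_as_limit:
  assumes h: "\<And>m. 0 < h m" "h \<longlonglongrightarrow> 0"
  obtains R where "R \<in> borel_measurable M" "AE \<omega> in M. 0 \<le> R \<omega>"
    "\<And>z. phi M X e z = (\<integral>\<omega>. exp (- z * of_real (R \<omega>)) \<partial>M)"
    "\<And>z. 0 \<le> Re z \<Longrightarrow> (\<lambda>m. \<integral>\<omega>. exp (- z * of_real (grid_max (h m) \<omega>)) \<partial>M) \<longlonglongrightarrow> phi M X e z"
proof -
  define R where "R \<omega> = lim (\<lambda>m. grid_max (h m) \<omega>)" for \<omega>
  have gm [measurable]: "grid_max (h m) \<in> borel_measurable M" for m using h by simp
  have R_meas [measurable]: "R \<in> borel_measurable M"
    unfolding R_def[abs_def] by (rule borel_measurable_lim_metric) (rule gm)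
  have "AE \<omega> in M. X 0 \<omega> = 0" "AE \<omega> in M. cadlag (\<lambda>t. X t \<omega>)"
    using stable unfolding stable_process_def levy_process_def by blast+
  then have lim: "AE \<omega> in M. (\<lambda>m. grid_max (h m) \<omega>) \<longlonglongrightarrow> running_sup X (e \<omega>) \<omega>"
    using e_pos
  proof eventually_elim
    case (elim \<omega>)
    show ?case
      unfolding grid_max_def grid_step_def running_sup_def
      by (rule grid_max_tendsto_sup) (use elim h in auto)
  qed
  have R_eq: "AE \<omega> in M. R \<omega> = running_sup X (e \<omega>) \<omega>"
    using lim by eventually_elim (simp add: R_def limI)
  have R_lim: "AE \<omega> in M. (\<lambda>m. grid_max (h m) \<omega>) \<longlonglongrightarrow> R \<omega>"
    using lim R_eq by eventually_elim simp
  have R_nonneg: "AE \<omega> in M. 0 \<le> R \<omega>"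
    using R_lim by eventually_elim (rule LIMSEQ_le_const, auto simp: grid_max_nonneg)
  have phi: "phi M X e z = (\<integral>\<omega>. exp (- z * of_real (R \<omega>)) \<partial>M)" for z
  proof -
    have sup_meas [measurable]: "(\<lambda>\<omega>. running_sup X (e \<omega>) \<omega>) \<in> borel_measurable (completion M)"
      by (rule borel_measurable_completion_AE[OF R_meas R_eq])
    have R_meas' [measurable]: "R \<in> borel_measurable (completion M)" by (rule measurable_completion[OF R_meas])
    have "phi M X e z = (\<integral>\<omega>. exp (- z * of_real (R \<omega>)) \<partial>completion M)"
      unfolding phi_def
    proof (rule integral_cong_AE)
      show "AE \<omega> in completion M. exp (- z * of_real (running_sup X (e \<omega>) \<omega>)) = exp (- z * of_real (R \<omega>))"
        using AE_completion[OF R_eq] by eventually_elim simp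
    qed measurable
    also have "\<dots> = (\<integral>\<omega>. exp (- z * of_real (R \<omega>)) \<partial>M)"
      by (rule integral_completion) measurable
    finally show ?thesis .
  qed
  have "(\<lambda>m. \<integral>\<omega>. exp (- z * of_real (grid_max (h m) \<omega>)) \<partial>M) \<longlonglongrightarrow> phi M X e z" if z: "0 \<le> Re z" for z
    unfolding phi
  proof (rule integral_dominated_convergence[where w = "\<lambda>_. 1"])
    show "AE \<omega> in M. (\<lambda>m. exp (- z * of_real (grid_max (h m) \<omega>))) \<longlonglongrightarrow> exp (- z * of_real (R \<omega>))"
      using R_lim by eventually_elim (intro tendsto_intros)
    show "AE \<omega> in M. norm (exp (- z * of_real (grid_max (h m) \<omega>))) \<le> 1" for m
      using z by (intro AE_I2) (simp add: grid_max_nonneg)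
  qed auto
  with R_meas R_nonneg phi show ?thesis by (rule that)
qed

end

section \<open>From the walk on a grid to the process\<close>

text \<open>Logarithms of \<open>1 + \<Psi>\<close> grow more slowly than the square root, which makes this a convenient weight
against a kernel of quadratic decay.\<close>

lemma integrable_sqrt_weight: "integrable lborel (\<lambda>s::real. sqrt (1 + \<bar>s\<bar>) / (1 + s\<^sup>2))"
proof -
  let ?f = "\<lambda>s::real. (2 + s) powr (- (3/2))"
  have "set_integrable lborel (einterval (ereal (-1)) \<infinity>) ?f"
  proof (rule interval_integral_FTC_nonneg(1))
    let ?F = "\<lambda>s::real. - 2 * (2 + s) powr (- (1/2))"
    show "DERIV ?F x :> ?f x" if "ereal (-1) < ereal x" for x
      using that by (auto intro!: derivative_eq_intros simp: powr_diff[symmetric])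
    show "isCont ?f x" if "ereal (-1) < ereal x" for x
      using that by (intro continuous_intros) auto
    show "((?F \<circ> real_of_ereal) \<longlongrightarrow> - 2) (at_right (ereal (-1)))"
      unfolding ereal_tendsto_simps
    proof -
      have "isCont ?F (-1)" by (intro continuous_intros) auto
      then have "(?F \<longlongrightarrow> ?F (-1)) (at (-1))" by (simp add: isCont_def)
      then show "(?F \<longlongrightarrow> - 2) (at_right (-1))" by (simp add: filterlim_at_split)
    qed
    show "((?F \<circ> real_of_ereal) \<longlongrightarrow> 0) (at_left \<infinity>)"
      unfolding ereal_tendsto_simps by real_asymp
  qed auto
  then have half: "set_integrable lborel {0..} ?f"
    by (rule set_integrable_subset) (auto simp: einterval_def)
  have half2: "integrable lborel (\<lambda>s. indicator {0..} (- s) *\<^sub>R ?f (- s))"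
    using lborel_integrable_real_affine[OF half[unfolded set_integrable_def], of "-1" 0] by simp
  have "integrable lborel (\<lambda>s. 8 * (indicator {0..} s *\<^sub>R ?f s + indicator {0..} (- s) *\<^sub>R ?f (- s)))"
    using half half2 unfolding set_integrable_def by (intro integrable_mult_right Bochner_Integration.integrable_add)
  then show ?thesis
  proof (rule integrable_dominated)
      fix s :: real
      define t where "t = \<bar>s\<bar>"
      have t: "0 \<le> t" by (simp add: t_def)
      have "(2 + t) ^ 2 \<le> 8 * (1 + t\<^sup>2)"
      proof -
        have "2 * t \<le> 1 + t * t" "0 \<le> t * t"
          using zero_le_power2[of "t - 1"] by (simp_all add: power2_eq_square algebra_simps)
        then show ?thesis unfolding power2_eq_square distrib_left distrib_right by linarith
      qed
      moreover have "sqrt (1 + t) \<le> (2 + t) powr (1/2)" using t by (simp add: powr_half_sqrt)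
      ultimately have "sqrt (1 + t) * (2 + t)\<^sup>2 \<le> (2 + t) powr (1/2) * (8 * (1 + t\<^sup>2))"
        by (intro mult_mono) auto
      moreover have "(2 + t) powr (1/2) = ?f t * (2 + t)\<^sup>2"
        using t by (simp add: powr_add[symmetric] flip: powr_numeral)
      ultimately have "sqrt (1 + t) * (2 + t)\<^sup>2 \<le> (?f t * (8 * (1 + t\<^sup>2))) * (2 + t)\<^sup>2" by (simp add: mult_ac)
      then have "sqrt (1 + t) \<le> ?f t * (8 * (1 + t\<^sup>2))" using t by (subst (asm) mult_le_cancel_right_pos) auto
      then have "sqrt (1 + t) / (1 + t\<^sup>2) \<le> 8 * ?f t"
        using pos_divide_le_eq[of "1 + t\<^sup>2" "sqrt (1 + t)" "8 * ?f t"] by (simp add: add_pos_nonneg mult_ac distrib_left distrib_right)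
      also have "\<dots> \<le> 8 * (indicator {0..} s *\<^sub>R ?f s + indicator {0..} (- s) *\<^sub>R ?f (- s))"
        by (cases "0 \<le> s") (auto simp: t_def indicator_def)
      finally show "norm (sqrt (1 + \<bar>s\<bar>) / (1 + s\<^sup>2)) \<le>
        8 * (indicator {0..} s *\<^sub>R ?f s + indicator {0..} (- s) *\<^sub>R ?f (- s))"
        by (simp add: t_def)
  qed measurable
qed

lemma integrable_sqrt_bound:
  assumes [measurable]: "m \<in> borel_measurable lborel" and b: "\<And>s. norm (m s) \<le> C * sqrt (1 + \<bar>s\<bar>)"
  shows "integrable lborel (\<lambda>s. norm (m s) / (1 + s\<^sup>2))"
proof (rule integrable_dominated)
  show "integrable lborel (\<lambda>s. C * (sqrt (1 + \<bar>s\<bar>) / (1 + s\<^sup>2)))"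
    by (intro integrable_mult_right integrable_sqrt_weight)
  fix s
  have "norm (m s) / (1 + s\<^sup>2) \<le> C * sqrt (1 + \<bar>s\<bar>) / (1 + s\<^sup>2)"
    by (intro divide_right_mono b) auto
  then show "norm (norm (m s) / (1 + s\<^sup>2)) \<le> C * (sqrt (1 + \<bar>s\<bar>) / (1 + s\<^sup>2))" by simp
qed measurable

text \<open>The number \<open>\<gamma> = \<alpha> (1 - 2\<rho>)\<close> satisfies \<open>\<bar>\<gamma>\<bar> < 1\<close>: for \<open>\<alpha> > 1\<close> the restriction on \<open>\<rho>\<close> gives
\<open>\<bar>\<gamma>\<bar> \<le> 2 - \<alpha>\<close>. So \<open>\<Psi>\<close> has nonnegative real part, and \<open>1 + \<Psi>\<close> avoids the cut of the logarithm.\<close>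

lemma stable_skewness_bound:
  assumes "(\<alpha>, \<rho>) \<in> admissible"
  shows "\<bar>\<alpha> * (1 - 2 * \<rho>)\<bar> < 1" and "0 < \<alpha>" and "\<alpha> \<le> 2" and "0 < \<rho>" and "\<rho> < 1"
proof -
  show b: "0 < \<alpha>" "0 < \<rho>" "\<rho> < 1" using admissible_bounds[OF assms] by auto
  show "\<alpha> \<le> 2" using assms by (auto simp: admissible_def)
  consider "\<alpha> < 1" | "\<alpha> = 1" "\<rho> = 1/2" | "1 < \<alpha>" "1 - 1 / \<alpha> \<le> \<rho>" "\<rho> \<le> 1 / \<alpha>"
    using assms by (auto simp: admissible_def)
  then show "\<bar>\<alpha> * (1 - 2 * \<rho>)\<bar> < 1"
  proof cases
    case 1
    have "\<bar>\<alpha> * (1 - 2 * \<rho>)\<bar> = \<alpha> * \<bar>1 - 2 * \<rho>\<bar>" using b by (simp add: abs_mult)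
    also have "\<dots> \<le> \<alpha> * 1" using b by (intro mult_left_mono) auto
    finally show ?thesis using 1 by simp
  next
    case 3
    have "\<alpha> * \<rho> \<le> 1" "\<alpha> - 1 \<le> \<alpha> * \<rho>" using 3 b by (auto simp: field_simps)
    then show ?thesis using 3 by (auto simp: abs_less_iff algebra_simps)
  qed simp
qed

lemma stable_exponent_Re_nonneg:
  assumes "(\<alpha>, \<rho>) \<in> admissible"
  shows "0 \<le> Re (stable_exponent \<alpha> \<rho> s)"
proof -
  have "pi * (\<alpha> * (1 - 2 * \<rho>)) \<le> pi * 1" "pi * (- 1) \<le> pi * (\<alpha> * (1 - 2 * \<rho>))"
    using stable_skewness_bound(1)[OF assms] by (intro mult_left_mono; simp add: abs_less_iff)+
  then have "0 \<le> cos (pi * (\<alpha> * (1 - 2 * \<rho>)) / 2)" by (intro cos_ge_zero) linarith+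
  then show ?thesis by (simp add: stable_exponent_def Let_def Re_exp mult_ac)
qed

lemma stable_exponent_norm: "0 < \<alpha> \<Longrightarrow> norm (stable_exponent \<alpha> \<rho> s) = \<bar>s\<bar> powr \<alpha>"
  by (auto simp: stable_exponent_def Let_def norm_mult)

lemma stable_exponent_measurable [measurable]: "stable_exponent \<alpha> \<rho> \<in> borel_measurable borel"
  unfolding stable_exponent_def[abs_def] Let_def by measurable

lemma norm_Ln_le:
  assumes "u \<noteq> 0"
  shows "norm (Ln u) \<le> \<bar>ln (norm u)\<bar> + pi"
proof -
  have "norm (Ln u) \<le> \<bar>Re (Ln u)\<bar> + \<bar>Im (Ln u)\<bar>" by (rule cmod_le)
  moreover have "\<bar>Im (Ln u)\<bar> \<le> pi" using mpi_less_Im_Ln[OF assms] Im_Ln_le_pi[OF assms] by auto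
  ultimately show ?thesis using assms by simp
qed

lemma ln_one_plus_powr_le:
  assumes "0 < \<alpha>" "\<alpha> \<le> (2::real)"
  shows "ln (1 + \<bar>s\<bar> powr \<alpha>) \<le> (ln 2 + 4) * sqrt (1 + \<bar>s\<bar>)"
proof -
  have "\<bar>s\<bar> powr \<alpha> \<le> (1 + \<bar>s\<bar>) powr \<alpha>" using assms by (intro powr_mono2) auto
  also have "\<dots> \<le> (1 + \<bar>s\<bar>) powr 2" using assms by (intro powr_mono) auto
  also have "\<dots> = (1 + \<bar>s\<bar>)\<^sup>2" by simp
  finally have "\<bar>s\<bar> powr \<alpha> \<le> (1 + \<bar>s\<bar>)\<^sup>2" .
  moreover have "1 \<le> (1 + \<bar>s\<bar>)\<^sup>2" by (intro one_le_power) simp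
  ultimately have "1 + \<bar>s\<bar> powr \<alpha> \<le> 2 * (1 + \<bar>s\<bar>)\<^sup>2" by linarith
  then have "ln (1 + \<bar>s\<bar> powr \<alpha>) \<le> ln (2 * (1 + \<bar>s\<bar>)\<^sup>2)" by (subst ln_le_cancel_iff) (auto intro: add_pos_nonneg)
  also have "\<dots> = ln 2 + 2 * ln (1 + \<bar>s\<bar>)" by (simp add: ln_mult ln_realpow)
  also have "ln (1 + \<bar>s\<bar>) = 2 * ln (sqrt (1 + \<bar>s\<bar>))" by (simp add: ln_sqrt)
  also have "ln (sqrt (1 + \<bar>s\<bar>)) \<le> sqrt (1 + \<bar>s\<bar>)"
  proof -
    have "0 < sqrt (1 + \<bar>s\<bar>)" by (simp add: add_pos_nonneg)
    from ln_le_minus_one[OF this] show ?thesis by linarith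
  qed
  finally have "ln (1 + \<bar>s\<bar> powr \<alpha>) \<le> ln 2 + 4 * sqrt (1 + \<bar>s\<bar>)" by simp
  moreover have "ln 2 * 1 \<le> ln 2 * sqrt (1 + \<bar>s\<bar>)" by (intro mult_left_mono) auto
  ultimately show ?thesis unfolding distrib_right by linarith
qed

lemma norm_one_minus_exp_le:
  fixes v :: complex
  assumes "0 \<le> Re v"
  shows "norm (1 - exp (- v)) \<le> norm v"
proof -
  have "norm ((\<lambda>v. exp (- v)) v - (\<lambda>v. exp (- v)) 0) \<le> 1 * norm (v - 0)"
  proof (rule field_differentiable_bound[where S = "{v. 0 \<le> Re v}" and f' = "\<lambda>v. - exp (- v)"])
    show "convex {v. 0 \<le> Re v}" by (rule convex_halfspace_Re_ge)
  qed (use assms in \<open>auto intro!: derivative_eq_intros\<close>)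
  then show ?thesis by (simp add: norm_minus_commute)
qed

text \<open>The modulus of \<open>(1 - exp (- hw)) / h\<close> lies between \<open>1/2\<close> and \<open>\<bar>w\<bar>\<close>, uniformly in the mesh \<open>h \<le> 1\<close>; this
yields the majorant for the limit \<open>h \<rightarrow> 0\<close>.\<close>

lemma discretised_log_bound:
  assumes w: "1 \<le> Re w" and h: "0 < h" "h \<le> 1"
  shows "norm (Ln ((1 - exp (- of_real h * w)) / of_real h)) \<le> pi + ln 2 + ln (norm w)"
    and "1 - exp (- of_real h * w) \<noteq> 0"
proof -
  let ?u = "(1 - exp (- of_real h * w)) / of_real h"
  have nw: "1 \<le> norm w" using w complex_Re_le_cmod[of w] by simp
  have "norm (1 - exp (- (of_real h * w))) \<le> norm (of_real h * w)"
    using w h by (intro norm_one_minus_exp_le) (auto simp: mult_nonneg_nonneg)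
  then have up: "norm ?u \<le> norm w" using h by (simp add: norm_divide norm_mult divide_le_eq mult.commute)
  have "exp (- h) * (1 + h) \<le> exp (- h) * exp h" by (intro mult_left_mono exp_ge_add_one_self) auto
  then have e1: "exp (- h) * (1 + h) \<le> 1" by (simp add: exp_minus)
  have "h * h \<le> h * 1" using h by (intro mult_left_mono) auto
  then have "(1 - h / 2) * (1 + h) \<ge> 1" by (simp add: algebra_simps)
  then have "exp (- h) * (1 + h) \<le> (1 - h / 2) * (1 + h)" using e1 by simp
  then have e2: "exp (- h) \<le> 1 - h / 2" using h by (subst (asm) mult_le_cancel_right_pos) auto
  have "norm (exp (- of_real h * w)) = exp (- h * Re w)" by simp
  also have "\<dots> \<le> exp (- h)" using w h by (simp add: mult_le_cancel_left1)
  finally have "norm (exp (- of_real h * w)) \<le> 1 - h / 2" using e2 by linarith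
  then have low0: "h / 2 \<le> norm (1 - exp (- of_real h * w))"
    using norm_triangle_ineq2[of 1 "exp (- of_real h * w)"] by simp
  then show nz: "1 - exp (- of_real h * w) \<noteq> 0" using h by auto
  have low: "1 / 2 \<le> norm ?u" using low0 h by (simp add: norm_divide field_simps)
  then have u0: "?u \<noteq> 0" by auto
  have "ln (norm ?u) \<le> ln (norm w)" using up low by (subst ln_le_cancel_iff) auto
  moreover have "ln (1 / 2) \<le> ln (norm ?u)" using low by (subst ln_le_cancel_iff) auto
  moreover have "0 \<le> ln (norm w)" using nw by simp
  moreover have "0 \<le> ln (2::real)" "ln (1 / 2) = - ln (2::real)" by (simp_all add: ln_div)
  ultimately have "\<bar>ln (norm ?u)\<bar> \<le> ln 2 + ln (norm w)" by linarith
  with norm_Ln_le[OF u0] show "norm (Ln ?u) \<le> pi + ln 2 + ln (norm w)" by simp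
qed

lemma discretised_log_tendsto:
  assumes w: "1 \<le> Re w" and h: "\<And>m. 0 < h m" "h \<longlonglongrightarrow> 0"
  shows "(\<lambda>m. Ln ((1 - exp (- of_real (h m) * w)) / of_real (h m))) \<longlonglongrightarrow> Ln w"
proof -
  have "((\<lambda>v. (exp (- v * w) - exp (- 0 * w)) / (v - 0)) \<longlongrightarrow> - w) (at 0)"
  proof -
    have "((\<lambda>v. exp (- v * w)) has_field_derivative - w) (at 0)" by (auto intro!: derivative_eq_intros)
    then show ?thesis unfolding has_field_derivative_iff by simp
  qed
  moreover have "filterlim (\<lambda>m. complex_of_real (h m)) (at 0) sequentially"
    unfolding filterlim_at using h tendsto_of_real[OF h(2), where 'a = complex]
    by (auto intro!: always_eventually simp: less_imp_neq[symmetric])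
  ultimately have "(\<lambda>m. (exp (- of_real (h m) * w) - exp (- 0 * w)) / (of_real (h m) - 0)) \<longlonglongrightarrow> - w"
    by (rule filterlim_compose)
  then have "(\<lambda>m. - ((exp (- of_real (h m) * w) - exp (- 0 * w)) / (of_real (h m) - 0))) \<longlonglongrightarrow> - (- w)"
    by (rule tendsto_minus)
  then have "(\<lambda>m. (1 - exp (- of_real (h m) * w)) / of_real (h m)) \<longlonglongrightarrow> w"
    by (simp add: minus_divide_left)
  moreover have "w \<notin> \<real>\<^sub>\<le>\<^sub>0" using w by (auto simp: complex_nonpos_Reals_iff)
  ultimately show ?thesis by (rule tendsto_Ln)
qed

context killed_stable_process
begin

lemma Re_one_plus_psi: "1 \<le> Re (1 + \<Psi> s)"
  using stable_exponent_Re_nonneg[OF adm, of s] by simp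

lemma norm_one_plus_psi: "norm (1 + \<Psi> s) \<le> 1 + \<bar>s\<bar> powr \<alpha>"
  using norm_triangle_ineq[of 1 "\<Psi> s"] stable_exponent_norm[of \<alpha> \<rho> s] stable_skewness_bound(2)[OF adm] by simp

lemma log_weight_bound: "pi + ln 2 + ln (norm (1 + \<Psi> s)) \<le> (pi + 2 * ln 2 + 4) * sqrt (1 + \<bar>s\<bar>)"
proof -
  have "1 \<le> norm (1 + \<Psi> s)" using Re_one_plus_psi[of s] complex_Re_le_cmod[of "1 + \<Psi> s"] by simp
  then have "ln (norm (1 + \<Psi> s)) \<le> ln (1 + \<bar>s\<bar> powr \<alpha>)"
    using norm_one_plus_psi[of s] by (subst ln_le_cancel_iff) auto
  also have "\<dots> \<le> (ln 2 + 4) * sqrt (1 + \<bar>s\<bar>)"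
    using stable_skewness_bound(2,3)[OF adm] by (rule ln_one_plus_powr_le)
  finally have 1: "ln (norm (1 + \<Psi> s)) \<le> (ln 2 + 4) * sqrt (1 + \<bar>s\<bar>)" .
  have "(pi + ln 2) * 1 \<le> (pi + ln 2) * sqrt (1 + \<bar>s\<bar>)" by (intro mult_left_mono) auto
  with 1 show ?thesis by (simp add: algebra_simps)
qed

lemma Ln_one_plus_psi_bound: "norm (Ln (1 + \<Psi> s)) \<le> (pi + 2 * ln 2 + 4) * sqrt (1 + \<bar>s\<bar>)"
proof -
  have n: "1 \<le> norm (1 + \<Psi> s)" using Re_one_plus_psi[of s] complex_Re_le_cmod[of "1 + \<Psi> s"] by simp
  then have "norm (Ln (1 + \<Psi> s)) \<le> \<bar>ln (norm (1 + \<Psi> s))\<bar> + pi" by (intro norm_Ln_le) auto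
  also have "\<dots> \<le> pi + ln 2 + ln (norm (1 + \<Psi> s))" using n by simp
  also note log_weight_bound
  finally show ?thesis .
qed

lemma Ln_one_plus_psi_measurable [measurable]: "(\<lambda>s. Ln (1 + \<Psi> s)) \<in> borel_measurable borel"
  by measurable

lemma integrable_Ln_one_plus_psi: "integrable lborel (\<lambda>s. norm (Ln (1 + \<Psi> s)) / (1 + s\<^sup>2))"
  by (rule integrable_sqrt_bound[OF _ Ln_one_plus_psi_bound]) measurable

text \<open>The formula for the killed random walk with \<open>q = exp (- h)\<close> and \<open>\<chi> = exp (- h \<Psi>)\<close>, as \<open>h\<close> tends to
zero. Nonnegativity of the real part passes to the limit. The value at \<open>1\<close> is the expectation of a
positive variable.\<close>

theorem phi_log_formula:
  assumes z: "0 < Re z"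
  shows "phi M X e z = phi M X e 1 * exp (- (1 / of_real (2 * pi)) * (CLINT s|lborel. Ln (1 + \<Psi> s) * resolvent_diff z s))"
    and "0 \<le> Re (phi M X e z)" and "phi M X e 1 \<noteq> 0"
proof -
  define h where "h m = 1 / (real m + 1)" for m
  have h: "0 < h m" "h m \<le> 1" for m by (auto simp: h_def)
  have h0: "h \<longlonglongrightarrow> 0" unfolding h_def by real_asymp
  obtain R where R [measurable]: "R \<in> borel_measurable M" and R0: "AE \<omega> in M. 0 \<le> R \<omega>"
    and phi: "\<And>z. phi M X e z = (\<integral>\<omega>. exp (- z * of_real (R \<omega>)) \<partial>M)"
    and lim: "\<And>z. 0 \<le> Re z \<Longrightarrow> (\<lambda>m. \<integral>\<omega>. exp (- z * of_real (grid_max (h m) \<omega>)) \<partial>M) \<longlonglongrightarrow> phi M X e z"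
    using phi_as_limit[OF h(1) h0] by blast
  define K where "K m z = killed_random_walk.killed_max_transform M (grid_step (h m)) (exp (- h m)) z" for m z
  define D where "D m z = (CLINT s|lborel. Ln (1 - of_real (exp (- h m)) * random_walk.increment_char M (grid_step (h m)) s) * resolvent_diff z s)" for m z
  have krw: "killed_random_walk M (grid_step (h m)) (exp (- h m))" for m by (rule killed_grid_walk[OF h(1)])
  have K_formula: "K m z = K m 1 * exp (- (1 / of_real (2 * pi)) * D m z)" if "0 < Re z" for m z
    unfolding K_def D_def using killed_random_walk.killed_max_transform_formula[OF krw that] .
  have K_Re: "0 < Re (K m z)" if "0 \<le> Re z" for m z
    unfolding K_def using killed_random_walk.killed_max_transform_Re_pos[OF krw that] .
  have q0: "(\<lambda>m. exp (- h m)) \<longlonglongrightarrow> 1" using tendsto_exp[OF tendsto_minus[OF h0]] by simp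
  \<comment> \<open>By \<open>grid_max_transform\<close>, this is an affine function of the transform of the grid maximum whose
    coefficients tend to 1 and 0.\<close>
  have K_lim: "(\<lambda>m. of_real (1 - exp (- h m)) * K m z) \<longlonglongrightarrow> phi M X e z" if "0 \<le> Re z" for z
  proof -
    have "(\<lambda>m. of_real (exp (- h m)) * (\<integral>\<omega>. exp (- z * of_real (grid_max (h m) \<omega>)) \<partial>M) + of_real (1 - exp (- h m)))
       \<longlonglongrightarrow> of_real 1 * phi M X e z + of_real (1 - 1)"
      by (intro tendsto_add tendsto_mult tendsto_of_real q0 lim that tendsto_diff tendsto_const)
    moreover have "of_real (exp (- h m)) * (\<integral>\<omega>. exp (- z * of_real (grid_max (h m) \<omega>)) \<partial>M) + of_real (1 - exp (- h m))
       = of_real (1 - exp (- h m)) * K m z" for m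
      unfolding grid_max_transform[OF h(1) that] K_def by (simp add: field_simps)
    ultimately show ?thesis by simp
  qed
  have D_lim: "(\<lambda>m. D m z) \<longlonglongrightarrow> (CLINT s|lborel. Ln (1 + \<Psi> s) * resolvent_diff z s)"
  proof -
    let ?u = "\<lambda>m s. (1 - exp (- of_real (h m) * (1 + \<Psi> s))) / of_real (h m)"
    \<comment> \<open>Because the kernel has integral zero, the logarithm may be shifted by the constant \<open>ln (h m)\<close>,
      which diverges; the shifted logarithm converges.\<close>
    have zero: "(CLINT s|lborel. resolvent_diff z s) = 0"
      using integral_exp_resolvent_diff[OF z, of 0] by simp
    have u_bound: "norm (Ln (?u m s)) \<le> (pi + 2 * ln 2 + 4) * sqrt (1 + \<bar>s\<bar>)" for m s
      using discretised_log_bound(1)[OF Re_one_plus_psi h(1) h(2)] log_weight_bound order_trans by blast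
    have u_int: "integrable lborel (\<lambda>s. Ln (?u m s) * resolvent_diff z s)" for m
      by (intro integrable_mult_resolvent_diff z integrable_sqrt_bound[OF _ u_bound]) measurable
    have D_eq: "D m z = (CLINT s|lborel. Ln (?u m s) * resolvent_diff z s)" for m
    proof -
      have split: "Ln (1 - of_real (exp (- h m)) * random_walk.increment_char M (grid_step (h m)) s)
         = Ln (?u m s) + of_real (ln (h m))" for s
      proof -
        have "of_real (exp (- h m)) * random_walk.increment_char M (grid_step (h m)) s = exp (- of_real (h m) * (1 + \<Psi> s))"
          unfolding grid_increment_char[OF h(1)] exp_of_real[symmetric] exp_add[symmetric] by (simp add: algebra_simps)
        moreover have "1 - exp (- of_real (h m) * (1 + \<Psi> s)) \<noteq> 0"
          by (rule discretised_log_bound(2)[OF Re_one_plus_psi h(1) h(2)])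
        ultimately show ?thesis using Ln_divide_of_real[OF h(1)[of m]] by simp
      qed
      have "D m z = (CLINT s|lborel. Ln (?u m s) * resolvent_diff z s + of_real (ln (h m)) * resolvent_diff z s)"
        unfolding D_def split distrib_right ..
      also have "\<dots> = (CLINT s|lborel. Ln (?u m s) * resolvent_diff z s) + (CLINT s|lborel. of_real (ln (h m)) * resolvent_diff z s)"
        by (intro Bochner_Integration.integral_add u_int integrable_mult_right integrable_resolvent_diff z)
      also have "(CLINT s|lborel. of_real (ln (h m)) * resolvent_diff z s) = 0"
        unfolding integral_mult_right_zero zero by simp
      finally show ?thesis by simp
    qed
    have dom: "integrable lborel (\<lambda>s. (pi + 2 * ln 2 + 4) * (sqrt (1 + \<bar>s\<bar>)) * norm (resolvent_diff z s))"
    proof -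
      have "integrable lborel (\<lambda>s. complex_of_real ((pi + 2 * ln 2 + 4) * sqrt (1 + \<bar>s\<bar>)) * resolvent_diff z s)"
        by (intro integrable_mult_resolvent_diff z integrable_sqrt_bound[where C = "pi + 2 * ln 2 + 4"])
           (auto simp: norm_mult simp del: of_real_mult of_real_add)
      from integrable_norm[OF this] show ?thesis
        by (simp add: norm_mult del: of_real_mult of_real_add)
    qed
    show ?thesis unfolding D_eq
    proof (rule integral_dominated_convergence[OF _ _ dom])
      show "AE s in lborel. (\<lambda>m. Ln (?u m s) * resolvent_diff z s) \<longlonglongrightarrow> Ln (1 + \<Psi> s) * resolvent_diff z s"
        by (intro AE_I2 tendsto_mult tendsto_const discretised_log_tendsto[OF Re_one_plus_psi h(1) h0])
      show "AE s in lborel. norm (Ln (?u m s) * resolvent_diff z s) \<le> (pi + 2 * ln 2 + 4) * (sqrt (1 + \<bar>s\<bar>)) * norm (resolvent_diff z s)" for m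
        unfolding norm_mult by (intro AE_I2 mult_right_mono u_bound) auto
    qed measurable
  qed
  have "(\<lambda>m. of_real (1 - exp (- h m)) * K m 1 * exp (- (1 / of_real (2 * pi)) * D m z)) \<longlonglongrightarrow>
     phi M X e 1 * exp (- (1 / of_real (2 * pi)) * (CLINT s|lborel. Ln (1 + \<Psi> s) * resolvent_diff z s))"
    by (intro tendsto_mult tendsto_exp tendsto_const D_lim K_lim) simp
  moreover have "of_real (1 - exp (- h m)) * K m 1 * exp (- (1 / of_real (2 * pi)) * D m z) = of_real (1 - exp (- h m)) * K m z" for m
    unfolding K_formula[OF z, of m] by (simp only: mult.assoc)
  ultimately have "(\<lambda>m. of_real (1 - exp (- h m)) * K m z) \<longlonglongrightarrow>
     phi M X e 1 * exp (- (1 / of_real (2 * pi)) * (CLINT s|lborel. Ln (1 + \<Psi> s) * resolvent_diff z s))"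
    by (simp only:)
  with K_lim[of z] z show "phi M X e z = phi M X e 1 * exp (- (1 / of_real (2 * pi)) * (CLINT s|lborel. Ln (1 + \<Psi> s) * resolvent_diff z s))"
    by (intro LIMSEQ_unique[of "\<lambda>m. of_real (1 - exp (- h m)) * K m z"]) auto
  have "(\<lambda>m. Re (of_real (1 - exp (- h m)) * K m z)) \<longlonglongrightarrow> Re (phi M X e z)"
    using z by (intro tendsto_Re K_lim) simp
  moreover have "0 \<le> Re (of_real (1 - exp (- h m)) * K m z)" for m
    using K_Re[of z m] h(1)[of m] z by (simp del: of_real_diff)
  ultimately show "0 \<le> Re (phi M X e z)" by (auto intro: LIMSEQ_le_const)
  show "phi M X e 1 \<noteq> 0"
  proof
    assume "phi M X e 1 = 0"
    moreover have "phi M X e 1 = (\<integral>\<omega>. complex_of_real (exp (- R \<omega>)) \<partial>M)"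
      unfolding phi by (intro Bochner_Integration.integral_cong refl) (simp flip: exp_of_real)
    ultimately have eq0: "(\<integral>\<omega>. exp (- R \<omega>) \<partial>M) = 0" by simp
    have "integrable M (\<lambda>\<omega>. exp (- R \<omega>))"
      by (rule integrable_const_bound[of _ 1]) (use R0 in \<open>auto\<close>)
    then have "AE \<omega> in M. exp (- R \<omega>) = 0"
      using eq0 by (subst (asm) integral_nonneg_eq_0_iff_AE) auto
    then have "AE \<omega> in M. False" by eventually_elim simp
    then show False by simp
  qed
qed

end

section \<open>Rotating the contour of the function F\<close>

text \<open>For \<open>t = exp (Re w)\<close> and \<open>y = Im w\<close>, the square of the right-hand side is
\<open>(1 + t)\<^sup>2 cos\<^sup>2 (y/2) + (1 - t)\<^sup>2 sin\<^sup>2 (y/2)\<close>.\<close>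

lemma norm_one_plus_exp_ge:
  fixes w :: complex
  assumes "\<bar>Im w\<bar> \<le> b" "b < pi"
  shows "cos (b / 2) * (1 + exp (Re w)) \<le> norm (1 + exp w)" and "0 < cos (b / 2)"
proof -
  show pos: "0 < cos (b / 2)" using assms by (intro cos_gt_zero_pi) auto
  define t where "t = exp (Re w)"
  define y where "y = Im w"
  have t: "0 < t" by (simp add: t_def)
  have mono: "cos (b / 2) \<le> cos (y / 2)"
  proof -
    have "cos (b / 2) \<le> cos (\<bar>y\<bar> / 2)" using assms by (intro cos_monotone_0_pi_le) (auto simp: y_def)
    then show ?thesis by (cases "0 \<le> y") (auto simp: cos_minus[of "y / 2"] minus_divide_left[symmetric])
  qed
  have cy: "cos y = 2 * (cos (y / 2))\<^sup>2 - 1" using cos_double_cos[of "y / 2"] by simp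
  have c1: "(cos (y / 2))\<^sup>2 \<le> 1" using abs_cos_le_one[of "y / 2"] by (simp add: abs_square_le_1)
  have "(cos (y / 2) * (1 + t))\<^sup>2 \<le> (norm (1 + exp w))\<^sup>2"
  proof -
    have "(norm (1 + exp w))\<^sup>2 = (1 + t * cos y)\<^sup>2 + (t * sin y)\<^sup>2"
      by (simp add: cmod_power2 Re_exp Im_exp t_def y_def)
    also have "\<dots> = 1 + 2 * t * cos y + t\<^sup>2 * ((cos y)\<^sup>2 + (sin y)\<^sup>2)"
      by algebra
    also have "\<dots> = 1 + 2 * t * cos y + t\<^sup>2" by simp
    also have "\<dots> = (1 + t)\<^sup>2 * (cos (y / 2))\<^sup>2 + (1 - t)\<^sup>2 * (1 - (cos (y / 2))\<^sup>2)"
      unfolding cy by algebra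
    finally have "(norm (1 + exp w))\<^sup>2 = (1 + t)\<^sup>2 * (cos (y / 2))\<^sup>2 + (1 - t)\<^sup>2 * (1 - (cos (y / 2))\<^sup>2)" .
    moreover have "0 \<le> (1 - t)\<^sup>2 * (1 - (cos (y / 2))\<^sup>2)" using c1 by simp
    ultimately show ?thesis by (simp add: power_mult_distrib mult.commute)
  qed
  then have "cos (y / 2) * (1 + t) \<le> norm (1 + exp w)" by (rule power2_le_imp_le) simp
  moreover have "cos (b / 2) * (1 + t) \<le> cos (y / 2) * (1 + t)" using mono t by (intro mult_right_mono) auto
  ultimately show "cos (b / 2) * (1 + exp (Re w)) \<le> norm (1 + exp w)" by (simp add: t_def)
qed

text \<open>The size of the integrand of \<open>F\<close> on the real line, up to constants and in the variable \<open>y = - x / \<alpha>\<close>.\<close>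

definition two_sided_decay :: "real \<Rightarrow> real \<Rightarrow> real" where
  "two_sided_decay \<alpha> y = 1 / ((1 + exp y) * (1 + exp (- \<alpha> * y)))"

lemma two_sided_decay_pos: "0 < two_sided_decay \<alpha> y"
  by (auto simp: two_sided_decay_def intro!: divide_pos_pos mult_pos_pos add_pos_pos)

lemma one_plus_exp_harnack:
  fixes a x y :: real
  assumes "\<bar>x - y\<bar> \<le> 1"
  shows "1 + exp (a * x) \<le> exp \<bar>a\<bar> * (1 + exp (a * y))"
proof -
  have "a * (x - y) \<le> \<bar>a\<bar> * \<bar>x - y\<bar>" by (simp add: abs_mult[symmetric])
  also have "\<dots> \<le> \<bar>a\<bar> * 1" using assms by (intro mult_left_mono) auto
  finally have "a * x \<le> \<bar>a\<bar> + a * y" by (simp add: algebra_simps)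
  then have "exp (a * x) \<le> exp \<bar>a\<bar> * exp (a * y)" by (simp flip: exp_add)
  moreover have "1 \<le> exp \<bar>a\<bar>" by simp
  ultimately show ?thesis unfolding distrib_left by linarith
qed

lemma two_sided_decay_harnack:
  assumes "\<bar>x - y\<bar> \<le> 1"
  shows "two_sided_decay \<alpha> y \<le> exp (1 + \<bar>\<alpha>\<bar>) * two_sided_decay \<alpha> x"
proof -
  have p: "0 < 1 + exp u" for u :: real by (simp add: add_pos_pos)
  have "(1 + exp x) * (1 + exp (- \<alpha> * x)) \<le> (exp 1 * (1 + exp y)) * (exp \<bar>\<alpha>\<bar> * (1 + exp (- \<alpha> * y)))"
    using one_plus_exp_harnack[OF assms, of 1] one_plus_exp_harnack[OF assms, of "- \<alpha>"] p[THEN less_imp_le]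
    by (intro mult_mono) auto
  also have "\<dots> = exp (1 + \<bar>\<alpha>\<bar>) * ((1 + exp y) * (1 + exp (- \<alpha> * y)))" by (simp add: exp_add mult_ac)
  finally have le: "(1 + exp x) * (1 + exp (- \<alpha> * x)) \<le> exp (1 + \<bar>\<alpha>\<bar>) * ((1 + exp y) * (1 + exp (- \<alpha> * y)))" .
  have "0 < (1 + exp x) * (1 + exp (- \<alpha> * x))" "0 < (1 + exp y) * (1 + exp (- \<alpha> * y))" using p by auto
  with le show ?thesis unfolding two_sided_decay_def by (simp only: mult_1_right times_divide_eq_right) (simp only: divide_le_eq pos_divide_le_eq pos_le_divide_eq mult_1_left times_divide_eq_left if_True)
qed

text \<open>With \<open>c = min 1 \<alpha>\<close> it is at most \<open>2 / c\<close> times the derivative of the logistic function of \<open>c y\<close>.\<close>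

lemma integrable_two_sided_decay:
  assumes "0 < \<alpha>"
  shows "integrable lborel (two_sided_decay \<alpha>)"
proof -
  define c where "c = min 1 \<alpha>"
  have c: "0 < c" "c \<le> 1" "c \<le> \<alpha>" using assms by (auto simp: c_def)
  have p: "0 < 1 + exp u" for u :: real by (simp add: add_pos_pos)
  have p': "1 + exp u \<noteq> 0" for u :: real using p[of u] by simp
  let ?f = "\<lambda>y. c * exp (- c * y) / (1 + exp (- c * y))\<^sup>2"
  have "set_integrable lborel (einterval (-\<infinity>) \<infinity>) ?f"
  proof (rule interval_integral_FTC_nonneg(1))
    let ?F = "\<lambda>y. 1 / (1 + exp (- c * y))"
    show "DERIV ?F x :> ?f x" for x
      using p' by (auto intro!: derivative_eq_intros simp: power2_eq_square)
    show "isCont ?f x" for x using p' by (intro continuous_intros) auto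
    show "((?F \<circ> real_of_ereal) \<longlongrightarrow> 0) (at_right (-\<infinity>))"
      unfolding ereal_tendsto_simps using c by real_asymp
    show "((?F \<circ> real_of_ereal) \<longlongrightarrow> 1) (at_left \<infinity>)"
      unfolding ereal_tendsto_simps using c by real_asymp
  qed (use c in auto)
  then have "integrable lborel (\<lambda>y. (2 / c) * ?f y)" by (intro integrable_mult_right) (simp add: set_integrable_def)
  then show ?thesis
  proof (rule integrable_dominated)
    show "two_sided_decay \<alpha> \<in> borel_measurable lborel" unfolding two_sided_decay_def[abs_def] by measurable
      fix y :: real
      have f_eq: "(2 / c) * ?f y = 2 / ((1 + exp (c * y)) * (1 + exp (- c * y)))"
      proof -
        have "(1 + exp (- c * y)) = exp (- c * y) * (1 + exp (c * y))" by (simp add: distrib_left flip: exp_add)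
        then have "(1 + exp (- c * y))\<^sup>2 = exp (- c * y) * ((1 + exp (c * y)) * (1 + exp (- c * y)))"
          by (simp add: power2_eq_square)
        then show ?thesis using c by simp
      qed
      have "(1 + exp (c * y)) * (1 + exp (- c * y)) \<le> 2 * ((1 + exp y) * (1 + exp (- \<alpha> * y)))"
      proof (cases "0 \<le> y")
        case True
        have "c * y \<le> 1 * y" using c True by (intro mult_right_mono)
        then have "1 + exp (c * y) \<le> 1 + exp y" by simp
        moreover have "1 + exp (- c * y) \<le> 2 * (1 + exp (- \<alpha> * y))"
        proof -
          have "exp (- c * y) \<le> 1" using c True by simp
          then show ?thesis by (simp add: add_increasing2)
        qed
        ultimately have "(1 + exp (c * y)) * (1 + exp (- c * y)) \<le> (1 + exp y) * (2 * (1 + exp (- \<alpha> * y)))"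
          using p[THEN less_imp_le] by (intro mult_mono) auto
        then show ?thesis by (simp only: mult_ac)
      next
        case False
        have "\<alpha> * y \<le> c * y" using c False by (intro mult_right_mono_neg) auto
        then have "1 + exp (- c * y) \<le> 1 + exp (- \<alpha> * y)" by simp
        moreover have "1 + exp (c * y) \<le> 2 * (1 + exp y)"
        proof -
          have "exp (c * y) \<le> 1" using c False by (simp add: mult_nonneg_nonpos)
          then show ?thesis by (simp add: add_increasing2)
        qed
        ultimately have "(1 + exp (c * y)) * (1 + exp (- c * y)) \<le> (2 * (1 + exp y)) * (1 + exp (- \<alpha> * y))"
          using p[THEN less_imp_le] by (intro mult_mono) auto
        then show ?thesis by (simp only: mult_ac)
      qed
      moreover have "0 < (1 + exp (c * y)) * (1 + exp (- c * y))" "0 < (1 + exp y) * (1 + exp (- \<alpha> * y))"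
        using p by auto
      ultimately have "two_sided_decay \<alpha> y \<le> (2 / c) * ?f y"
        unfolding f_eq two_sided_decay_def by (subst frac_le_eq) (auto simp: divide_le_0_iff)
      then show "norm (two_sided_decay \<alpha> y) \<le> (2 / c) * ?f y"
        using two_sided_decay_pos[of \<alpha> y] by (simp only: real_norm_def abs_of_pos)
  qed
qed

text \<open>In the variable \<open>y = - x / \<alpha>\<close> the integrand of \<open>F\<close> is the function \<open>g\<close> of the proof on the real line. The line
is moved to height \<open>\<theta> = \<sigma> (\<pi>/2 - \<pi>\<rho>)\<close>, where the first exponential becomes \<open>i \<sigma> e\<^sup>y / z\<close>. The
three bounds on angles say that neither factor of the denominator vanishes between the two lines.\<close>

lemma F_integral_rotated:
  fixes z :: complex and \<sigma> \<alpha> \<rho> :: real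
  assumes \<alpha>: "0 < \<alpha>" and \<sigma>: "\<bar>\<sigma>\<bar> = 1" and z: "z \<noteq> 0"
    and a1: "\<bar>\<sigma> * pi * \<rho> - Arg z\<bar> < pi" and a2: "\<bar>\<sigma> * pi / 2 - Arg z\<bar> < pi"
    and a3: "\<bar>\<alpha> * (pi / 2 - pi * \<rho>)\<bar> < pi"
  shows "F_integral (of_real \<sigma> * pi * \<i> * \<rho> - Ln z) (\<i> / of_real \<alpha>)
    = of_real \<alpha> * z * (CLINT y|lborel. 1 / ((z + \<i> * of_real (\<sigma> * exp y)) * (1 + exp (- \<i> * of_real (\<sigma> * \<alpha> * (pi / 2 - pi * \<rho>))) * of_real (exp (- \<alpha> * y)))))"
proof -
  define \<theta> where "\<theta> = \<sigma> * (pi / 2 - pi * \<rho>)"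
  define g where "g w = 1 / ((1 + exp (of_real \<sigma> * pi * \<i> * \<rho> - Ln z + w)) * (1 + exp (- of_real \<alpha> * w)))" for w
  define b0 where "b0 = max \<bar>\<sigma> * pi * \<rho> - Arg z\<bar> \<bar>\<sigma> * pi / 2 - Arg z\<bar>"
  have b0: "b0 < pi" using a1 a2 by (simp add: b0_def)
  have abs_\<theta>: "\<bar>\<alpha> * \<theta>\<bar> < pi" using a3 \<sigma> by (simp add: \<theta>_def abs_mult mult.left_commute)
  \<comment> \<open>Half of the room that the angles leave below \<open>\<pi>\<close>, so that both lines lie inside an open strip.\<close>
  define d where "d = min ((pi - b0) / 2) ((pi - \<bar>\<alpha> * \<theta>\<bar>) / (2 * \<alpha>))"
  have d: "0 < d" "d \<le> (pi - b0) / 2" "\<alpha> * d \<le> (pi - \<bar>\<alpha> * \<theta>\<bar>) / 2"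
  proof -
    show "0 < d" using b0 abs_\<theta> \<alpha> by (auto simp: d_def)
    show "d \<le> (pi - b0) / 2" unfolding d_def by (rule min.cobounded1)
    have "\<alpha> * d \<le> \<alpha> * ((pi - \<bar>\<alpha> * \<theta>\<bar>) / (2 * \<alpha>))" using \<alpha> by (intro mult_left_mono) (auto simp: d_def)
    then show "\<alpha> * d \<le> (pi - \<bar>\<alpha> * \<theta>\<bar>) / 2" using \<alpha> by simp
  qed
  define b1 where "b1 = b0 + d"
  define b2 where "b2 = \<bar>\<alpha> * \<theta>\<bar> + \<alpha> * d"
  have b1: "b1 < pi" using d b0 by (simp add: b1_def)
  have b2: "b2 < pi" using d abs_\<theta> by (simp add: b2_def)
  define lo where "lo = min 0 \<theta> - d"
  define hi where "hi = max 0 \<theta> + d"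
  have ang1: "\<bar>Im (of_real \<sigma> * pi * \<i> * \<rho> - Ln z + w)\<bar> \<le> b1" if "lo < Im w" "Im w < hi" for w
  proof -
    have im: "Im (of_real \<sigma> * pi * \<i> * \<rho> - Ln z + w) = \<sigma> * pi * \<rho> - Arg z + Im w"
      using z by (simp add: Arg_eq_Im_Ln)
    have e: "\<sigma> * pi * \<rho> - Arg z + \<theta> = \<sigma> * pi / 2 - Arg z" by (simp add: \<theta>_def algebra_simps)
    have "\<bar>\<sigma> * pi * \<rho> - Arg z\<bar> \<le> b0" "\<bar>\<sigma> * pi * \<rho> - Arg z + \<theta>\<bar> \<le> b0" unfolding e by (auto simp: b0_def)
    then show ?thesis unfolding im b1_def using that unfolding lo_def hi_def by (auto simp: min_def max_def split: if_splits)
  qed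
  have ang2: "\<bar>Im (- of_real \<alpha> * w)\<bar> \<le> b2" if "lo < Im w" "Im w < hi" for w
  proof -
    have "\<bar>Im w\<bar> \<le> \<bar>\<theta>\<bar> + d" using that unfolding lo_def hi_def by (auto simp: min_def max_def split: if_splits)
    then have "\<alpha> * \<bar>Im w\<bar> \<le> \<alpha> * (\<bar>\<theta>\<bar> + d)" using \<alpha> by (intro mult_left_mono) auto
    then show ?thesis using \<alpha> by (simp add: b2_def abs_mult distrib_left)
  qed
  define k1 where "k1 = cos (b1 / 2) * min 1 (1 / norm z)"
  define k2 where "k2 = cos (b2 / 2)"
  have b1': "0 < cos (b1 / 2)" using norm_one_plus_exp_ge(2)[OF ang1[of 0] b1] d by (simp add: lo_def hi_def)
  have k2: "0 < k2" unfolding k2_def using norm_one_plus_exp_ge(2)[OF ang2[of 0] b2] d by (simp add: lo_def hi_def)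
  have k1: "0 < k1" using b1' z by (simp add: k1_def)
  have low1: "k1 * (1 + exp (Re w)) \<le> norm (1 + exp (of_real \<sigma> * pi * \<i> * \<rho> - Ln z + w))" if "lo < Im w" "Im w < hi" for w
  proof -
    have re: "exp (Re (of_real \<sigma> * pi * \<i> * \<rho> - Ln z + w)) = exp (Re w) / norm z"
      using z by (simp add: exp_diff exp_add exp_minus)
    have "min 1 (1 / norm z) * (1 + exp (Re w)) \<le> 1 + exp (Re w) / norm z"
    proof -
      have "min 1 (1 / norm z) * exp (Re w) \<le> 1 / norm z * exp (Re w)" by (intro mult_right_mono) auto
      then show ?thesis by (simp add: distrib_left add_mono)
    qed
    then have "cos (b1 / 2) * (min 1 (1 / norm z) * (1 + exp (Re w))) \<le> cos (b1 / 2) * (1 + exp (Re w) / norm z)"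
      using b1' by (intro mult_left_mono) auto
    also have "\<dots> \<le> norm (1 + exp (of_real \<sigma> * pi * \<i> * \<rho> - Ln z + w))"
      using norm_one_plus_exp_ge(1)[OF ang1[OF that] b1] unfolding re .
    finally show ?thesis by (simp add: k1_def mult.assoc)
  qed
  have low2: "k2 * (1 + exp (- \<alpha> * Re w)) \<le> norm (1 + exp (- of_real \<alpha> * w))" if "lo < Im w" "Im w < hi" for w
    using norm_one_plus_exp_ge(1)[OF ang2[OF that] b2] by (simp add: k2_def)
  have nz: "1 + exp (of_real \<sigma> * pi * \<i> * \<rho> - Ln z + w) \<noteq> 0" "1 + exp (- of_real \<alpha> * w) \<noteq> 0"
    if "lo < Im w" "Im w < hi" for w
  proof -
    have "0 < k1 * (1 + exp (Re w))" "0 < k2 * (1 + exp (- \<alpha> * Re w))"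
      using k1 k2 by (auto intro!: mult_pos_pos add_pos_pos)
    with low1[OF that] low2[OF that] show "1 + exp (of_real \<sigma> * pi * \<i> * \<rho> - Ln z + w) \<noteq> 0" "1 + exp (- of_real \<alpha> * w) \<noteq> 0"
      by (auto simp only: norm_zero)
  qed
  have shift: "(CLINT y|lborel. g (of_real y + \<i> * of_real 0)) = (CLINT y|lborel. g (of_real y + \<i> * of_real \<theta>))"
  proof (rule integral_horizontal_line_invariant[where a = lo and b = hi
        and B = "\<lambda>x. 1 / (k1 * k2) * two_sided_decay \<alpha> x" and K = "exp (1 + \<bar>\<alpha>\<bar>)"])
    show "g holomorphic_on {w. lo < Im w \<and> Im w < hi}"
      unfolding g_def using nz by (intro holomorphic_intros) auto
    show "norm (g w) \<le> 1 / (k1 * k2) * two_sided_decay \<alpha> (Re w)" if w: "lo < Im w" "Im w < hi" for w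
    proof -
      have "0 < k1 * (1 + exp (Re w))" "0 < k2 * (1 + exp (- \<alpha> * Re w))"
        using k1 k2 by (auto intro!: mult_pos_pos add_pos_pos)
      note pos = this
      have "0 < (k1 * (1 + exp (Re w))) * (k2 * (1 + exp (- \<alpha> * Re w)))" by (rule mult_pos_pos[OF pos])
      moreover have "(k1 * (1 + exp (Re w))) * (k2 * (1 + exp (- \<alpha> * Re w)))
          \<le> norm (1 + exp (of_real \<sigma> * pi * \<i> * \<rho> - Ln z + w)) * norm (1 + exp (- of_real \<alpha> * w))"
        by (rule mult_mono[OF low1[OF w] low2[OF w] norm_ge_zero less_imp_le[OF pos(2)]])
      ultimately have "norm (g w) \<le> 1 / ((k1 * (1 + exp (Re w))) * (k2 * (1 + exp (- \<alpha> * Re w))))"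
        unfolding g_def norm_divide norm_mult norm_one by (intro frac_le) auto
      then show ?thesis by (simp add: two_sided_decay_def mult_ac)
    qed
    show "integrable lborel (\<lambda>x. 1 / (k1 * k2) * two_sided_decay \<alpha> x)"
      by (intro integrable_mult_right integrable_two_sided_decay \<alpha>)
    show "1 / (k1 * k2) * two_sided_decay \<alpha> y \<le> exp (1 + \<bar>\<alpha>\<bar>) * (1 / (k1 * k2) * two_sided_decay \<alpha> x)"
      if "\<bar>x - y\<bar> \<le> 1" for x y
    proof -
      have "1 / (k1 * k2) * two_sided_decay \<alpha> y \<le> 1 / (k1 * k2) * (exp (1 + \<bar>\<alpha>\<bar>) * two_sided_decay \<alpha> x)"
        using two_sided_decay_harnack[OF that] k1 k2 by (intro mult_left_mono) auto
      then show ?thesis by (simp only: mult_ac)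
    qed
  qed (use d in \<open>auto simp: lo_def hi_def\<close>)
  have "F_integral (of_real \<sigma> * pi * \<i> * \<rho> - Ln z) (\<i> / of_real \<alpha>)
     = \<bar>- \<alpha>\<bar> *\<^sub>R (CLINT y|lborel. 1 / ((1 + exp (of_real \<sigma> * pi * \<i> * \<rho> - Ln z + \<i> * (\<i> / of_real \<alpha>) * of_real (0 + (- \<alpha>) * y))) * (1 + exp (of_real (0 + (- \<alpha>) * y)))))"
    unfolding F_integral_def using \<alpha> by (intro lborel_integral_real_affine) auto
  also have "\<dots> = of_real \<alpha> * (CLINT y|lborel. g (of_real y + \<i> * of_real 0))"
  proof -
    have "\<i> * (\<i> / of_real \<alpha>) * of_real (0 + (- \<alpha>) * y) = of_real y" for y
      using \<alpha> by (simp add: field_simps)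
    then show ?thesis using \<alpha> unfolding g_def by (simp add: scaleR_conv_of_real)
  qed
  also have "\<dots> = of_real \<alpha> * (CLINT y|lborel. z * (1 / ((z + \<i> * of_real (\<sigma> * exp y)) * (1 + exp (- \<i> * of_real (\<sigma> * \<alpha> * (pi / 2 - pi * \<rho>))) * of_real (exp (- \<alpha> * y))))))"
  proof -
    have "g (of_real y + \<i> * of_real \<theta>) = z * (1 / ((z + \<i> * of_real (\<sigma> * exp y)) * (1 + exp (- \<i> * of_real (\<sigma> * \<alpha> * (pi / 2 - pi * \<rho>))) * of_real (exp (- \<alpha> * y)))))" for y
    proof -
      have s: "\<sigma> = 1 \<or> \<sigma> = - 1" using \<sigma> by auto
      have i\<sigma>: "exp (\<i> * of_real (\<sigma> * pi / 2)) = \<i> * of_real \<sigma>"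
        unfolding cis_conv_exp[symmetric] using s by (auto simp: complex_eq_iff)
      have "of_real \<sigma> * pi * \<i> * \<rho> - Ln z + (of_real y + \<i> * of_real \<theta>) = \<i> * of_real (\<sigma> * pi / 2) + of_real y - Ln z"
        by (simp add: \<theta>_def algebra_simps)
      then have e1: "exp (of_real \<sigma> * pi * \<i> * \<rho> - Ln z + (of_real y + \<i> * of_real \<theta>)) = \<i> * of_real (\<sigma> * exp y) / z"
        using z i\<sigma> by (simp only: exp_diff exp_add exp_Ln) (simp add: exp_of_real)
      have "- of_real \<alpha> * (of_real y + \<i> * of_real \<theta>) = - \<i> * of_real (\<sigma> * \<alpha> * (pi / 2 - pi * \<rho>)) + of_real (- \<alpha> * y)"
        by (simp add: \<theta>_def algebra_simps)
      then have e2: "exp (- of_real \<alpha> * (of_real y + \<i> * of_real \<theta>)) = exp (- \<i> * of_real (\<sigma> * \<alpha> * (pi / 2 - pi * \<rho>))) * of_real (exp (- \<alpha> * y))"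
        by (simp only: exp_add exp_of_real)
      have e3: "1 + \<i> * of_real (\<sigma> * exp y) / z = (z + \<i> * of_real (\<sigma> * exp y)) / z" using z by (simp add: field_simps)
      show ?thesis unfolding g_def e1 e2 e3 using z by simp
    qed
    then show ?thesis unfolding shift by simp
  qed
  finally show ?thesis by (simp only: integral_mult_right_zero mult.assoc)
qed

section \<open>Integration by parts on a half-line\<close>

text \<open>Integration by parts moves the derivative from \<open>1 / (z + i\<sigma>s)\<close> to the logarithm, whose derivative times
\<open>s\<close> is \<open>\<alpha> / (1 + \<kappa>\<^sup>-\<^sup>1 s\<^sup>-\<^sup>\<alpha>)\<close> with \<open>\<kappa> = exp (ic)\<close>; then \<open>s = e\<^sup>y\<close>. The boundary terms vanish
because the logarithm tends to \<open>0\<close> at \<open>0\<close> and grows at most like the square root of \<open>s\<close> at infinity.\<close>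

lemma log_kernel_half_line:
  fixes z :: complex and \<alpha> c \<sigma> :: real
  assumes \<alpha>: "0 < \<alpha>" "\<alpha> \<le> 2" and \<sigma>: "\<bar>\<sigma>\<bar> = 1" and c: "\<bar>c\<bar> < pi / 2" and z: "0 < Re z"
  shows "(LBINT s=ereal 0..\<infinity>. Ln (1 + exp (\<i> * of_real c) * of_real (s powr \<alpha>)) / (z + \<i> * of_real (\<sigma> * s))\<^sup>2)
     = - \<i> * of_real \<sigma> * of_real \<alpha> * (CLINT y|lborel. 1 / ((z + \<i> * of_real (\<sigma> * exp y)) * (1 + exp (- \<i> * of_real c) * of_real (exp (- \<alpha> * y)))))"
proof -
  define \<kappa> where "\<kappa> = exp (\<i> * of_real c)"
  define P where "P s = 1 + \<kappa> * of_real (s powr \<alpha>)" for s :: real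
  define Z where "Z s = z + \<i> * of_real (\<sigma> * s)" for s :: real
  define f1 where "f1 s = \<kappa> * of_real (\<alpha> * s powr (\<alpha> - 1)) / P s / Z s" for s
  define f2 where "f2 s = Ln (P s) / (Z s)\<^sup>2" for s
  define k where "k = cos (\<bar>c\<bar> / 2)"
  \<comment> \<open>An integrable majorant of \<open>f1\<close> up to constants; under \<open>s = exp y\<close> it becomes \<open>two_sided_decay\<close>.\<close>
  define b where "b s = s powr (\<alpha> - 1) / ((1 + s powr \<alpha>) * (1 + s))" for s :: real
  have \<kappa>1: "norm \<kappa> = 1" by (simp add: \<kappa>_def)
  have Re\<kappa>: "0 < Re \<kappa>" using c by (simp add: \<kappa>_def Re_exp cos_gt_zero_pi abs_less_iff)
  have ReP: "1 \<le> Re (P s)" for s using Re\<kappa> by (simp add: P_def)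
  have P0: "P s \<noteq> 0" for s using ReP[of s] by auto
  have Pnn: "P s \<notin> \<real>\<^sub>\<le>\<^sub>0" for s using ReP[of s] by (auto simp: complex_nonpos_Reals_iff)
  have Z0: "Z s \<noteq> 0" for s unfolding Z_def by (rule resolvent_nonzero[OF z])
  have exp_powr: "exp (\<i> * of_real c + of_real (\<alpha> * y)) = \<kappa> * of_real (exp y powr \<alpha>)" for y
  proof -
    have "exp y powr \<alpha> = exp (\<alpha> * y)" by (simp add: powr_def)
    then show ?thesis by (simp only: exp_add exp_of_real \<kappa>_def)
  qed
  have k: "0 < k" and Plow: "k * (1 + s powr \<alpha>) \<le> norm (P s)" if "0 < s" for s
  proof -
    have "\<bar>Im (\<i> * of_real c + of_real (\<alpha> * ln s))\<bar> \<le> \<bar>c\<bar>" "\<bar>c\<bar> < pi" using c by auto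
    from norm_one_plus_exp_ge[OF this] show "0 < k" "k * (1 + s powr \<alpha>) \<le> norm (P s)"
      using that unfolding exp_powr by (simp_all add: k_def P_def powr_def)
  qed
  have k0: "0 < k" using k[of 1] by simp
  obtain S K where K: "z \<in> S" "0 < K"
    "\<And>w s. w \<in> S \<Longrightarrow> 1 + s\<^sup>2 \<le> K * (norm (w + \<i> * of_real s))\<^sup>2"
    using resolvent_bound_locally_uniform[OF z] by metis
  have \<sigma>2: "(\<sigma> * s)\<^sup>2 = s\<^sup>2" for s using \<sigma> by (simp add: power_mult_distrib flip: power2_abs[of \<sigma>])
  have ZK: "1 + s\<^sup>2 \<le> K * (norm (Z s))\<^sup>2" for s
    using K(3)[OF K(1), of "\<sigma> * s"] unfolding \<sigma>2 Z_def .
  define K1 where "K1 = sqrt (2 * K)"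
  have K1: "0 < K1" using K by (simp add: K1_def)
  have ZK1: "1 + s \<le> K1 * norm (Z s)" if "0 < s" for s
  proof (rule power2_le_imp_le)
    have "(1 + s)\<^sup>2 \<le> 2 * (1 + s\<^sup>2)" using zero_le_power2[of "1 - s"] by (simp add: power2_eq_square algebra_simps)
    also have "\<dots> \<le> 2 * (K * (norm (Z s))\<^sup>2)" by (intro mult_left_mono ZK) simp
    also have "\<dots> = (K1 * norm (Z s))\<^sup>2" using K by (simp add: K1_def power_mult_distrib)
    finally show "(1 + s)\<^sup>2 \<le> (K1 * norm (Z s))\<^sup>2" .
    show "0 \<le> K1 * norm (Z s)" using K1 by simp
  qed
  have LnP: "norm (Ln (P s)) \<le> (pi + ln 2 + 4) * sqrt (1 + \<bar>s\<bar>)" if "0 < s" for s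
  proof -
    have P1: "1 \<le> norm (P s)" using ReP[of s] complex_Re_le_cmod[of "P s"] by simp
    have "norm (P s) \<le> 1 + \<bar>s\<bar> powr \<alpha>"
      unfolding P_def using norm_triangle_ineq[of 1 "\<kappa> * of_real (s powr \<alpha>)"] \<kappa>1 that by (simp add: norm_mult)
    then have "ln (norm (P s)) \<le> ln (1 + \<bar>s\<bar> powr \<alpha>)" using P1 by (subst ln_le_cancel_iff) auto
    also have "\<dots> \<le> (ln 2 + 4) * sqrt (1 + \<bar>s\<bar>)" by (rule ln_one_plus_powr_le[OF \<alpha>])
    finally have "ln (norm (P s)) \<le> (ln 2 + 4) * sqrt (1 + \<bar>s\<bar>)" .
    moreover have "norm (Ln (P s)) \<le> ln (norm (P s)) + pi" using norm_Ln_le[OF P0[of s]] P1 by simp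
    moreover have "pi * 1 \<le> pi * sqrt (1 + \<bar>s\<bar>)" by (intro mult_left_mono) auto
    ultimately show ?thesis unfolding distrib_right by linarith
  qed
  have f2_int: "set_integrable lborel {0<..} f2"
    unfolding set_integrable_def
  proof (rule integrable_dominated)
    show "integrable lborel (\<lambda>s. ((pi + ln 2 + 4) * K) * (sqrt (1 + \<bar>s\<bar>) / (1 + s\<^sup>2)))"
      by (intro integrable_mult_right integrable_sqrt_weight)
    show "(\<lambda>s. indicator {0<..} s *\<^sub>R f2 s) \<in> borel_measurable lborel"
      unfolding f2_def P_def Z_def by measurable
    fix s :: real
    have p: "0 < 1 + s\<^sup>2" by (auto intro: add_pos_nonneg)
    show "norm (indicator {0<..} s *\<^sub>R f2 s) \<le> ((pi + ln 2 + 4) * K) * (sqrt (1 + \<bar>s\<bar>) / (1 + s\<^sup>2))"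
    proof (cases "0 < s")
      case True
      have "1 / (norm (Z s))\<^sup>2 \<le> K / (1 + s\<^sup>2)" using ZK[of s] Z0[of s] p by (simp add: field_simps)
      then have "norm (Ln (P s)) * (1 / (norm (Z s))\<^sup>2) \<le> ((pi + ln 2 + 4) * sqrt (1 + \<bar>s\<bar>)) * (K / (1 + s\<^sup>2))"
        using LnP[OF True] by (intro mult_mono) auto
      then show ?thesis using True by (simp add: f2_def norm_divide norm_power mult_ac)
    next
      case False
      then show ?thesis using K p by simp
    qed
  qed
  have b_exp: "b (exp y) * exp y = two_sided_decay \<alpha> y" for y
  proof -
    have p: "1 + exp u \<noteq> 0" for u :: real using add_pos_pos[OF zero_less_one exp_gt_zero[of u]] by simp
    have "exp y powr (\<alpha> - 1) * exp y = exp (\<alpha> * y)" by (simp add: powr_def algebra_simps flip: exp_add)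
    moreover have "exp y powr \<alpha> = exp (\<alpha> * y)" by (simp add: powr_def)
    ultimately have "b (exp y) * exp y = exp (\<alpha> * y) / ((1 + exp (\<alpha> * y)) * (1 + exp y))" by (simp add: b_def)
    also have "1 + exp (\<alpha> * y) = exp (\<alpha> * y) * (1 + exp (- \<alpha> * y))" by (simp add: distrib_left flip: exp_add)
    finally show ?thesis by (simp add: two_sided_decay_def mult_ac)
  qed
  have f1_bound: "norm (f1 s) \<le> (\<alpha> / k * K1) * b s" if "0 < s" for s
  proof -
    have p: "0 < 1 + s powr \<alpha>" "0 < 1 + s" using that by (auto intro: add_pos_nonneg)
    have 1: "1 / norm (P s) \<le> 1 / (k * (1 + s powr \<alpha>))"
      using Plow[OF that] k0 p by (intro frac_le mult_pos_pos) auto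
    have 2: "1 / norm (Z s) \<le> K1 / (1 + s)" using ZK1[OF that] Z0[of s] p by (simp add: field_simps)
    have "norm (f1 s) = \<alpha> * s powr (\<alpha> - 1) * ((1 / norm (P s)) * (1 / norm (Z s)))"
      using \<alpha> by (simp add: f1_def norm_divide norm_mult \<kappa>1)
    also have "\<dots> \<le> \<alpha> * s powr (\<alpha> - 1) * ((1 / (k * (1 + s powr \<alpha>))) * (K1 / (1 + s)))"
      using 1 2 \<alpha> k0 p K1 by (intro mult_left_mono mult_mono) auto
    also have "\<dots> = (\<alpha> / k * K1) * b s" by (simp add: b_def mult_ac)
    finally show ?thesis .
  qed
  have lim0: "((ereal \<circ> exp \<circ> real_of_ereal) \<longlongrightarrow> ereal 0) (at_right (-\<infinity>))"
  proof -
    have "((exp \<circ> real_of_ereal) \<longlongrightarrow> (0::real)) (at_right (-\<infinity>))"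
      unfolding ereal_tendsto_simps by (rule exp_at_bot)
    then show ?thesis by (auto dest: tendsto_ereal simp: comp_def)
  qed
  have liminf: "((ereal \<circ> exp \<circ> real_of_ereal) \<longlongrightarrow> \<infinity>) (at_left \<infinity>)"
    by (simp add: at_left_PInf filterlim_filtermap comp_def tendsto_PInfty_eq_at_top exp_at_top)
  have b_int: "set_integrable lborel (einterval (ereal 0) \<infinity>) b"
  proof (rule interval_integral_substitution_nonneg(1)[where g = exp and g' = exp and a = "-\<infinity>" and b = "\<infinity>"])
    show "isCont b (exp x)" for x
      unfolding b_def by (intro continuous_intros) (auto simp: add_pos_nonneg add_nonneg_eq_0_iff)
    show "0 \<le> b (exp x)" for x unfolding b_def by (intro divide_nonneg_nonneg mult_nonneg_nonneg) auto
    show "set_integrable lborel (einterval (-\<infinity>) \<infinity>) (\<lambda>x. b (exp x) * exp x)"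
      unfolding b_exp using integrable_two_sided_decay[OF \<alpha>(1)] by (simp add: set_integrable_def)
  qed (use lim0 liminf in \<open>auto intro!: derivative_eq_intros\<close>)
  have f1_meas: "f1 \<in> borel_measurable lborel" unfolding f1_def P_def Z_def by measurable
  have f1_int: "set_integrable lborel (einterval (ereal 0) \<infinity>) f1"
    unfolding set_integrable_def
  proof (rule integrable_dominated)
    show "integrable lborel (\<lambda>s. (\<alpha> / k * K1) * (indicator (einterval (ereal 0) \<infinity>) s *\<^sub>R b s))"
      using b_int unfolding set_integrable_def by (rule integrable_mult_right)
    show "(\<lambda>s. indicator (einterval (ereal 0) \<infinity>) s *\<^sub>R f1 s) \<in> borel_measurable lborel"
      using f1_meas by measurable
    show "norm (indicator (einterval (ereal 0) \<infinity>) s *\<^sub>R f1 s) \<le> (\<alpha> / k * K1) * (indicator (einterval (ereal 0) \<infinity>) s *\<^sub>R b s)" for s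
      using f1_bound[of s] by (cases "0 < s") (simp_all add: einterval_eq_Ici)
  qed
  let ?h = "\<lambda>y. 1 / ((z + \<i> * of_real (\<sigma> * exp y)) * (1 + exp (- \<i> * of_real c) * of_real (exp (- \<alpha> * y))))"
  have f1_exp: "exp y *\<^sub>R f1 (exp y) = of_real \<alpha> * ?h y" for y
  proof -
    let ?q = "1 + exp (- \<i> * of_real c) * of_real (exp (- \<alpha> * y))"
    have "exp (- \<i> * of_real c) * of_real (exp (- \<alpha> * y)) * (\<kappa> * of_real (exp y powr \<alpha>)) = 1"
      unfolding exp_powr[symmetric] exp_of_real[symmetric] exp_add[symmetric] by simp
    then have P_eq: "P (exp y) = \<kappa> * of_real (exp y powr \<alpha>) * ?q" by (simp add: P_def algebra_simps)
    have e: "exp y * exp y powr (\<alpha> - 1) = exp y powr \<alpha>" by (simp add: powr_def algebra_simps flip: exp_add)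
    have "exp y *\<^sub>R f1 (exp y) = of_real \<alpha> * (\<kappa> * of_real (exp y * exp y powr (\<alpha> - 1))) / P (exp y) / Z (exp y)"
      by (simp add: f1_def scaleR_conv_of_real)
    also have "\<dots> = of_real \<alpha> * (\<kappa> * of_real (exp y powr \<alpha>)) / (\<kappa> * of_real (exp y powr \<alpha>) * ?q) / Z (exp y)"
      unfolding e P_eq ..
    also have "\<dots> = of_real \<alpha> * ?h y" by (simp add: Z_def \<kappa>_def)
    finally show ?thesis .
  qed
  have sub: "(LBINT s=ereal 0..\<infinity>. f1 s) = (LBINT y=-\<infinity>..\<infinity>. exp y *\<^sub>R f1 (exp y))"
  proof (rule interval_integral_substitution_integrable)
    show "isCont f1 (exp x)" for x
    proof -
      have "isCont (\<lambda>s. \<kappa> * of_real (\<alpha> * s powr (\<alpha> - 1)) / (1 + \<kappa> * of_real (s powr \<alpha>)) / (z + \<i> * of_real (\<sigma> * s))) (exp x)"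
        using P0[of "exp x"] Z0[of "exp x"] unfolding P_def Z_def by (intro continuous_intros) auto
      then show ?thesis unfolding f1_def[abs_def] P_def Z_def .
    qed
    show "set_integrable lborel (einterval (-\<infinity>) \<infinity>) (\<lambda>x. exp x *\<^sub>R f1 (exp x))"
      unfolding set_integrable_def
    proof (rule integrable_dominated)
      show "integrable lborel (\<lambda>y. (\<alpha> / k * K1) * two_sided_decay \<alpha> y)"
        by (intro integrable_mult_right integrable_two_sided_decay \<alpha>)
      show "(\<lambda>y. indicator (einterval (-\<infinity>) \<infinity>) y *\<^sub>R exp y *\<^sub>R f1 (exp y)) \<in> borel_measurable lborel"
        using f1_meas by measurable
      fix y :: real
      have "exp y * norm (f1 (exp y)) \<le> exp y * ((\<alpha> / k * K1) * b (exp y))" by (intro mult_left_mono f1_bound) auto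
      also have "\<dots> = (\<alpha> / k * K1) * two_sided_decay \<alpha> y" unfolding b_exp[symmetric] by simp
      finally show "norm (indicator (einterval (-\<infinity>) \<infinity>) y *\<^sub>R exp y *\<^sub>R f1 (exp y)) \<le> (\<alpha> / k * K1) * two_sided_decay \<alpha> y"
        by simp
    qed
  qed (use lim0 liminf f1_int in \<open>auto intro!: derivative_eq_intros\<close>)
  have sub': "(LBINT s=ereal 0..\<infinity>. f1 s) = of_real \<alpha> * (CLINT y|lborel. ?h y)"
    unfolding sub f1_exp integral_mult_right_zero[symmetric]
    by (simp add: interval_lebesgue_integral_def set_lebesgue_integral_def)
  \<comment> \<open>An antiderivative of \<open>i \<sigma> f1 + f2\<close>, because \<open>- i \<sigma> / (Z s)\<^sup>2\<close> is the derivative of \<open>1 / Z\<close>.\<close>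
  define F where "F s = (\<i> * of_real \<sigma>) * (Ln (P s) * (1 / Z s))" for s
  have f2_int': "set_integrable lborel (einterval (ereal 0) \<infinity>) f2"
    using f2_int by (simp add: einterval_eq_Ici)
  have "(LBINT s=ereal 0..\<infinity>. \<i> * of_real \<sigma> * f1 s + f2 s) = 0 - 0"
  proof (rule interval_integral_FTC_integrable[where F = F])
    fix s :: real assume "ereal 0 < ereal s"
    then have s: "0 < s" by simp
    have dP: "(P has_vector_derivative \<kappa> * of_real (\<alpha> * s powr (\<alpha> - 1))) (at s)"
    proof -
      have "((\<lambda>s. s powr \<alpha>) has_real_derivative \<alpha> * s powr (\<alpha> - 1)) (at s)"
        using s by (auto intro!: derivative_eq_intros)
      then have "((\<lambda>s. complex_of_real (s powr \<alpha>)) has_vector_derivative of_real (\<alpha> * s powr (\<alpha> - 1))) (at s)"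
        by (rule has_vector_derivative_of_real)
      then have "((\<lambda>s. 1 + \<kappa> * complex_of_real (s powr \<alpha>)) has_vector_derivative 0 + \<kappa> * of_real (\<alpha> * s powr (\<alpha> - 1))) (at s)"
        by (intro has_vector_derivative_add has_vector_derivative_const has_vector_derivative_mult_right)
      then show ?thesis unfolding P_def[abs_def] by (simp only: add_0_left)
    qed
    have dLn: "((\<lambda>s. Ln (P s)) has_vector_derivative (\<kappa> * of_real (\<alpha> * s powr (\<alpha> - 1))) * inverse (P s)) (at s)"
      using field_vector_diff_chain_at[OF dP has_field_derivative_Ln[OF Pnn[of s]]] by (simp add: comp_def)
    have dZ: "((\<lambda>s. 1 / Z s) has_vector_derivative (\<i> * of_real \<sigma>) * (- (1 / (Z s)\<^sup>2))) (at s)"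
    proof -
      have Z_der: "(Z has_vector_derivative \<i> * of_real \<sigma>) (at s)"
      proof -
        have "((\<lambda>s. \<sigma> * s) has_real_derivative \<sigma>) (at s)" by (auto intro!: derivative_eq_intros)
        then have "((\<lambda>s. complex_of_real (\<sigma> * s)) has_vector_derivative of_real \<sigma>) (at s)"
          by (rule has_vector_derivative_of_real)
        then have "((\<lambda>s. z + \<i> * complex_of_real (\<sigma> * s)) has_vector_derivative 0 + \<i> * of_real \<sigma>) (at s)"
          by (intro has_vector_derivative_add has_vector_derivative_const has_vector_derivative_mult_right)
        then show ?thesis unfolding Z_def[abs_def] by (simp only: add_0_left)
      qed
      have inv_der: "((\<lambda>w. 1 / w) has_field_derivative - (1 / (Z s)\<^sup>2)) (at (Z s))"
        using Z0[of s] by (auto intro!: derivative_eq_intros simp: power2_eq_square)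
      from field_vector_diff_chain_at[OF Z_der inv_der] show ?thesis by (simp only: comp_def)
    qed
    have \<sigma>\<sigma>: "complex_of_real \<sigma> * of_real \<sigma> = 1" using \<sigma>2[of 1] by (simp add: power2_eq_square flip: of_real_mult)
    have "(F has_vector_derivative (\<i> * of_real \<sigma>) * (Ln (P s) * ((\<i> * of_real \<sigma>) * (- (1 / (Z s)\<^sup>2)))
        + (\<kappa> * of_real (\<alpha> * s powr (\<alpha> - 1))) * inverse (P s) * (1 / Z s))) (at s)"
      unfolding F_def[abs_def]
      by (intro has_vector_derivative_mult_right has_vector_derivative_mult dLn dZ)
    also have "(\<i> * of_real \<sigma>) * (Ln (P s) * ((\<i> * of_real \<sigma>) * (- (1 / (Z s)\<^sup>2)))
        + (\<kappa> * of_real (\<alpha> * s powr (\<alpha> - 1))) * inverse (P s) * (1 / Z s)) = \<i> * of_real \<sigma> * f1 s + f2 s"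
    proof -
      have "(\<i> * of_real \<sigma>) * (L * ((\<i> * of_real \<sigma>) * (- (1 / w\<^sup>2))) + a * inverse p * (1 / w)) = \<i> * of_real \<sigma> * (a / p / w) + L / w\<^sup>2" for L w a p :: complex
      proof -
        have "(\<i> * of_real \<sigma>) * (L * ((\<i> * of_real \<sigma>) * (- (1 / w\<^sup>2)))) = - (\<i> * \<i>) * (of_real \<sigma> * of_real \<sigma>) * (L / w\<^sup>2)"
          by (simp only: mult_ac) simp
        also have "\<dots> = L / w\<^sup>2" unfolding \<sigma>\<sigma> by simp
        finally have first: "(\<i> * of_real \<sigma>) * (L * ((\<i> * of_real \<sigma>) * (- (1 / w\<^sup>2)))) = L / w\<^sup>2" .
        have "a * inverse p * (1 / w) = a / p / w" by (simp add: divide_inverse)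
        then show ?thesis unfolding distrib_left first by (simp only: add.commute)
      qed
      then show ?thesis unfolding f1_def f2_def by blast
    qed
    finally show "(F has_vector_derivative \<i> * of_real \<sigma> * f1 s + f2 s) (at s)" .
    have cP: "isCont P s" using dP by (rule has_vector_derivative_continuous)
    have cZ: "isCont Z s" unfolding Z_def[abs_def] by (intro continuous_intros)
    have cpow: "isCont (\<lambda>s. \<kappa> * of_real (\<alpha> * s powr (\<alpha> - 1))) s" using s by (intro continuous_intros) auto
    have cLn: "isCont (\<lambda>s. Ln (P s)) s" using dLn by (rule has_vector_derivative_continuous)
    show "isCont (\<lambda>s. \<i> * of_real \<sigma> * f1 s + f2 s) s"
      unfolding f1_def f2_def
      by (intro continuous_add continuous_mult continuous_divide continuous_power continuous_const cP cZ cpow cLn)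
         (use P0[of s] Z0[of s] in auto)
  next
    show "set_integrable lborel (einterval (ereal 0) \<infinity>) (\<lambda>s. \<i> * of_real \<sigma> * f1 s + f2 s)"
      by (intro set_integral_add set_integrable_mult_right f1_int f2_int')
    show "((F \<circ> real_of_ereal) \<longlongrightarrow> 0) (at_right (ereal 0))"
      unfolding ereal_tendsto_simps
    proof -
      have "((\<lambda>s::real. s powr \<alpha>) \<longlongrightarrow> 0) (at_right 0)" using \<alpha> by real_asymp
      then have "(P \<longlongrightarrow> 1 + \<kappa> * of_real 0) (at_right 0)" unfolding P_def[abs_def] by (intro tendsto_intros)
      then have Ln_lim: "((\<lambda>s. Ln (P s)) \<longlongrightarrow> Ln (1 + \<kappa> * of_real 0)) (at_right 0)" by (rule tendsto_Ln) auto
      have Z_lim: "(Z \<longlongrightarrow> z + \<i> * of_real (\<sigma> * 0)) (at_right 0)" unfolding Z_def[abs_def] by (intro tendsto_intros)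
      have "(F \<longlongrightarrow> (\<i> * of_real \<sigma>) * (Ln (1 + \<kappa> * of_real 0) * (1 / (z + \<i> * of_real (\<sigma> * 0))))) (at_right 0)"
        unfolding F_def[abs_def] using z by (intro tendsto_mult tendsto_divide tendsto_const Ln_lim Z_lim) auto
      then show "(F \<longlongrightarrow> 0) (at_right 0)" by simp
    qed
    show "((F \<circ> real_of_ereal) \<longlongrightarrow> 0) (at_left \<infinity>)"
      unfolding ereal_tendsto_simps
    proof (rule Lim_null_comparison)
      show "eventually (\<lambda>s. norm (F s) \<le> (pi + ln 2 + 4) * K1 * (sqrt (1 + s) / (1 + s))) at_top"
        using eventually_gt_at_top[of 0]
      proof eventually_elim
        case (elim s)
        have "1 / norm (Z s) \<le> K1 / (1 + s)" using ZK1[OF elim] Z0[of s] elim by (simp add: field_simps)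
        then have "norm (Ln (P s)) * (1 / norm (Z s)) \<le> ((pi + ln 2 + 4) * sqrt (1 + \<bar>s\<bar>)) * (K1 / (1 + s))"
          using LnP[OF elim] by (intro mult_mono) auto
        then show ?case using \<sigma> elim by (simp add: F_def norm_mult norm_divide mult_ac)
      qed
      have "((\<lambda>s::real. sqrt (1 + s) / (1 + s)) \<longlongrightarrow> 0) at_top" by real_asymp
      from tendsto_mult[OF tendsto_const this] show "((\<lambda>s. (pi + ln 2 + 4) * K1 * (sqrt (1 + s) / (1 + s))) \<longlongrightarrow> 0) at_top"
        by simp
    qed
  qed simp
  moreover have "(LBINT s=ereal 0..\<infinity>. \<i> * of_real \<sigma> * f1 s + f2 s)
     = \<i> * of_real \<sigma> * (LBINT s=ereal 0..\<infinity>. f1 s) + (LBINT s=ereal 0..\<infinity>. f2 s)"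
  proof -
    have i1: "interval_lebesgue_integrable lborel (ereal 0) \<infinity> f1" "interval_lebesgue_integrable lborel (ereal 0) \<infinity> f2"
      using f1_int f2_int' by (simp_all add: interval_lebesgue_integrable_def)
    then show ?thesis by simp
  qed
  ultimately have "(LBINT s=ereal 0..\<infinity>. f2 s) = - \<i> * of_real \<sigma> * of_real \<alpha> * (CLINT y|lborel. ?h y)"
    unfolding sub' by (simp add: eq_neg_iff_add_eq_0 add.commute mult.assoc)
  then show ?thesis
    by (simp only: f2_def P_def Z_def \<kappa>_def)
qed

lemma integral_two_half_lines:
  fixes f :: "real \<Rightarrow> complex"
  assumes f: "integrable lborel f"
  shows "(CLINT s|lborel. f s) = (LBINT s=ereal 0..\<infinity>. f s) + (LBINT s=ereal 0..\<infinity>. f (- s))"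
proof -
  have pos: "integrable lborel (\<lambda>s. indicator {0<..} s *\<^sub>R f s)"
    by (rule integrable_mult_indicator[OF _ f]) simp
  have neg: "integrable lborel (\<lambda>s. indicator {..<0} s *\<^sub>R f s)"
    by (rule integrable_mult_indicator[OF _ f]) simp
  have "(CLINT s|lborel. indicator {0<..} s *\<^sub>R f (- s)) = \<bar>- 1\<bar> *\<^sub>R (CLINT s|lborel. indicator {0<..} (0 + (- 1) * s) *\<^sub>R f (- (0 + (- 1) * s)))"
    by (rule lborel_integral_real_affine) simp
  also have "\<dots> = (CLINT s|lborel. indicator {..<0} s *\<^sub>R f s)"
    by (simp add: indicator_def)
  finally have refl: "(CLINT s|lborel. indicator {0<..} s *\<^sub>R f (- s)) = (CLINT s|lborel. indicator {..<0} s *\<^sub>R f s)" .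
  have "(CLINT s|lborel. f s) = (CLINT s|lborel. indicator {0<..} s *\<^sub>R f s + indicator {..<0} s *\<^sub>R f s)"
  proof (rule integral_cong_AE)
    show "f \<in> borel_measurable lborel" using f by simp
    show "(\<lambda>s. indicator {0<..} s *\<^sub>R f s + indicator {..<0} s *\<^sub>R f s) \<in> borel_measurable lborel"
      using pos neg by (intro borel_measurable_add borel_measurable_integrable)
    show "AE s in lborel. f s = indicator {0<..} s *\<^sub>R f s + indicator {..<0} s *\<^sub>R f s"
      using AE_lborel_singleton[of 0] by eventually_elim (auto simp: indicator_def)
  qed
  also have "\<dots> = (CLINT s|lborel. indicator {0<..} s *\<^sub>R f s) + (CLINT s|lborel. indicator {..<0} s *\<^sub>R f s)"
    using pos neg by (rule Bochner_Integration.integral_add)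
  finally show ?thesis
    unfolding refl[symmetric] by (simp add: interval_lebesgue_integral_def set_lebesgue_integral_def einterval_eq_Ici)
qed

section \<open>The logarithmic derivative\<close>

context killed_stable_process
begin

text \<open>The half-line with sign \<open>\<sigma>\<close> contributes \<open>\<sigma> / (iz)\<close> times the value of \<open>F\<close> at \<open>\<sigma> \<pi> i \<rho> - ln z\<close>.\<close>

lemma log_derivative_formula:
  assumes z: "z \<noteq> 0" "\<bar>Arg z\<bar> < pi * min (1 - \<rho>) (1/2)"
  shows "1 / of_real (2 * pi) * (CLINT s|lborel. Ln (1 + \<Psi> s) / (z + \<i> * of_real s)\<^sup>2)
    = 1 / (2 * pi * \<i> * z) *
             (F_integral (pi * \<i> * \<rho> - Ln z) (\<i> / of_real \<alpha>)
              - F_integral (- pi * \<i> * \<rho> - Ln z) (\<i> / of_real \<alpha>))"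
proof -
  note p = stable_skewness_bound[OF adm]
  have ang: "\<bar>Arg z\<bar> < pi * (1 - \<rho>)" "\<bar>Arg z\<bar> < pi / 2"
  proof -
    have "pi * min (1 - \<rho>) (1/2) \<le> pi * (1 - \<rho>)" by (intro mult_left_mono min.cobounded1) simp
    moreover have "pi * min (1 - \<rho>) (1/2) \<le> pi * (1 / 2)" by (intro mult_left_mono min.cobounded2) simp
    ultimately show "\<bar>Arg z\<bar> < pi * (1 - \<rho>)" "\<bar>Arg z\<bar> < pi / 2" using z(2) by linarith+
  qed
  have Rez: "0 < Re z" using z(1) ang(2) Arg_Re_pos[of z] by simp
  define c where "c = \<alpha> * (pi / 2 - pi * \<rho>)"
  have c_eq: "c = pi * (\<alpha> * (1 - 2 * \<rho>)) / 2" by (simp add: c_def algebra_simps)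
  have c: "\<bar>c\<bar> < pi / 2"
  proof -
    have "\<bar>c\<bar> = pi / 2 * \<bar>\<alpha> * (1 - 2 * \<rho>)\<bar>" unfolding c_eq by (simp add: abs_mult)
    also have "\<dots> < pi / 2 * 1" using p(1) by (intro mult_strict_left_mono) auto
    finally show ?thesis by simp
  qed
  let ?f = "\<lambda>s. Ln (1 + \<Psi> s) / (z + \<i> * of_real s)\<^sup>2"
  let ?J = "\<lambda>\<sigma>. CLINT y|lborel. 1 / ((z + \<i> * of_real (\<sigma> * exp y)) * (1 + exp (- \<i> * of_real (\<sigma> * c)) * of_real (exp (- \<alpha> * y))))"
  have f_int: "integrable lborel ?f"
    by (rule integrable_mult_resolvent_sq[OF Rez _ integrable_Ln_one_plus_psi]) measurable
  have half: "(LBINT s=ereal 0..\<infinity>. ?f (\<sigma> * s)) = of_real \<sigma> / (\<i> * z) * F_integral (of_real \<sigma> * pi * \<i> * \<rho> - Ln z) (\<i> / of_real \<alpha>)"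
    if \<sigma>: "\<sigma> = 1 \<or> \<sigma> = - 1" for \<sigma> :: real
  proof -
    have abs\<sigma>: "\<bar>\<sigma>\<bar> = 1" using \<sigma> by auto
    have psi: "\<Psi> (\<sigma> * s) = exp (\<i> * of_real (\<sigma> * c)) * of_real (s powr \<alpha>)" if "0 < s" for s
      using \<sigma>
    proof
      assume "\<sigma> = 1"
      have "complex_of_real pi * \<i> * of_real (\<alpha> * (1 - 2 * \<rho>)) / 2 = \<i> * of_real (\<sigma> * c)"
        by (simp add: c_eq \<open>\<sigma> = 1\<close> mult_ac)
      moreover have "\<Psi> (\<sigma> * s) = exp (complex_of_real pi * \<i> * of_real (\<alpha> * (1 - 2 * \<rho>)) / 2) * of_real (s powr \<alpha>)"
        using that by (simp add: stable_exponent_def \<open>\<sigma> = 1\<close>)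
      ultimately show ?thesis by (simp only:)
    next
      assume "\<sigma> = - 1"
      have "- complex_of_real pi * \<i> * of_real (\<alpha> * (1 - 2 * \<rho>)) / 2 = \<i> * of_real (\<sigma> * c)"
        by (simp add: c_eq \<open>\<sigma> = - 1\<close> complex_eq_iff)
      moreover have "\<Psi> (\<sigma> * s) = exp (- complex_of_real pi * \<i> * of_real (\<alpha> * (1 - 2 * \<rho>)) / 2) * of_real (s powr \<alpha>)"
        using that by (simp add: stable_exponent_def \<open>\<sigma> = - 1\<close>)
      ultimately show ?thesis by (simp only:)
    qed
    have "(LBINT s=ereal 0..\<infinity>. ?f (\<sigma> * s)) = (LBINT s=ereal 0..\<infinity>. Ln (1 + exp (\<i> * of_real (\<sigma> * c)) * of_real (s powr \<alpha>)) / (z + \<i> * of_real (\<sigma> * s))\<^sup>2)"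
      by (rule interval_integral_cong) (auto simp: einterval_def min_def psi)
    also have "\<dots> = - \<i> * of_real \<sigma> * of_real \<alpha> * ?J \<sigma>"
    proof (rule log_kernel_half_line[OF p(2,3) abs\<sigma> _ Rez])
      show "\<bar>\<sigma> * c\<bar> < pi / 2" using c abs\<sigma> by (simp add: abs_mult)
    qed
    also have "\<dots> = of_real \<sigma> / (\<i> * z) * F_integral (of_real \<sigma> * pi * \<i> * \<rho> - Ln z) (\<i> / of_real \<alpha>)"
    proof -
      have a1: "\<bar>\<sigma> * pi * \<rho> - Arg z\<bar> < pi"
      proof -
        have "pi * (1 - \<rho>) + pi * \<rho> = pi" "0 < pi * \<rho>" using p by (simp_all add: algebra_simps)
        then show ?thesis using \<sigma> ang(1) by auto
      qed
      have a2: "\<bar>\<sigma> * pi / 2 - Arg z\<bar> < pi" using \<sigma> ang(2) by auto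
      have a3: "\<bar>\<alpha> * (pi / 2 - pi * \<rho>)\<bar> < pi" 
      proof -
        have "\<bar>c\<bar> < pi" using c pi_gt_zero by linarith
        then show ?thesis by (simp only: c_def)
      qed
      have "F_integral (of_real \<sigma> * pi * \<i> * \<rho> - Ln z) (\<i> / of_real \<alpha>) = of_real \<alpha> * z * ?J \<sigma>"
        unfolding F_integral_rotated[OF p(2) abs\<sigma> z(1) a1 a2 a3] c_def by (simp only: mult.assoc)
      then show ?thesis using z(1) by (simp add: field_simps)
    qed
    finally show ?thesis .
  qed
  have "(CLINT s|lborel. ?f s) = (LBINT s=ereal 0..\<infinity>. ?f s) + (LBINT s=ereal 0..\<infinity>. ?f (- s))"
    by (rule integral_two_half_lines[OF f_int])
  also have "\<dots> = 1 / (\<i> * z) * F_integral (pi * \<i> * \<rho> - Ln z) (\<i> / of_real \<alpha>)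
       - 1 / (\<i> * z) * F_integral (- pi * \<i> * \<rho> - Ln z) (\<i> / of_real \<alpha>)"
    using half[of 1] half[of "- 1"] by simp
  finally have "(CLINT s|lborel. ?f s) = 1 / (\<i> * z) * (F_integral (pi * \<i> * \<rho> - Ln z) (\<i> / of_real \<alpha>)
       - F_integral (- pi * \<i> * \<rho> - Ln z) (\<i> / of_real \<alpha>))"
    by (simp only: right_diff_distrib)
  then show ?thesis by simp
qed

text \<open>Since \<open>\<phi>\<close> has nonnegative real part and no zeros, its values avoid the cut of the principal logarithm,
which is therefore differentiable along \<open>\<phi>\<close>.\<close>

lemma phi_log_derivative:
  assumes z: "0 < Re z"
  shows "((\<lambda>w. Ln (phi M X e w)) has_field_derivative
     1 / of_real (2 * pi) * (CLINT s|lborel. Ln (1 + \<Psi> s) / (z + \<i> * of_real s)\<^sup>2)) (at z)"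
proof -
  let ?L = "\<lambda>w. CLINT s|lborel. Ln (1 + \<Psi> s) * resolvent_diff w s"
  let ?D = "1 / of_real (2 * pi) * (CLINT s|lborel. Ln (1 + \<Psi> s) / (z + \<i> * of_real s)\<^sup>2)"
  let ?\<phi> = "\<lambda>w. phi M X e 1 * exp (- (1 / of_real (2 * pi)) * ?L w)"
  have L: "(?L has_field_derivative - (CLINT s|lborel. Ln (1 + \<Psi> s) / (z + \<i> * of_real s)\<^sup>2)) (at z)"
    by (rule cauchy_transform_deriv[OF z _ integrable_Ln_one_plus_psi]) measurable
  have "((\<lambda>w. - (1 / of_real (2 * pi)) * ?L w) has_field_derivative ?D) (at z)"
    using DERIV_cmult[OF L, of "- (1 / of_real (2 * pi))"] by simp
  then have "((\<lambda>w. exp (- (1 / of_real (2 * pi)) * ?L w)) has_field_derivative exp (- (1 / of_real (2 * pi)) * ?L z) * ?D) (at z)"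
    by (rule DERIV_chain2[OF DERIV_exp])
  then have "(?\<phi> has_field_derivative phi M X e 1 * (exp (- (1 / of_real (2 * pi)) * ?L z) * ?D)) (at z)"
    by (rule DERIV_cmult)
  then have "(?\<phi> has_field_derivative phi M X e z * ?D) (at z)"
    unfolding phi_log_formula(1)[OF z] by (simp only: mult.assoc)
  then have phi_der: "(phi M X e has_field_derivative phi M X e z * ?D) (at z)"
  proof (rule has_field_derivative_transform_within_open)
    show "open {w. 0 < Re w}" by (rule open_halfspace_Re_gt)
    show "?\<phi> w = phi M X e w" if "w \<in> {w. 0 < Re w}" for w
      using phi_log_formula(1)[of w] that by simp
  qed (use z in simp)
  have nz: "phi M X e z \<noteq> 0"
    unfolding phi_log_formula(1)[OF z] using phi_log_formula(3)[OF z] by simp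
  have slit: "phi M X e z \<notin> \<real>\<^sub>\<le>\<^sub>0"
  proof
    assume "phi M X e z \<in> \<real>\<^sub>\<le>\<^sub>0"
    then have "Re (phi M X e z) \<le> 0" "Im (phi M X e z) = 0" by (auto simp: complex_nonpos_Reals_iff)
    with phi_log_formula(2)[OF z] nz show False by (auto simp: complex_eq_iff)
  qed
  have "((\<lambda>w. Ln (phi M X e w)) has_field_derivative inverse (phi M X e z) * (phi M X e z * ?D)) (at z)"
    by (rule DERIV_chain2[OF has_field_derivative_Ln[OF slit] phi_der])
  moreover have "inverse (phi M X e z) * (phi M X e z * ?D) = ?D"
    unfolding mult.assoc[symmetric, of "inverse (phi M X e z)"] left_inverse[OF nz] by (rule mult_1_left)
  ultimately show ?thesis by (simp only:)
qed

end

theorem proposition1: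
  fixes \<alpha> \<rho> :: real
    and M :: "'a measure" and X :: "real \<Rightarrow> 'a \<Rightarrow> real" and e :: "'a \<Rightarrow> real"
    and z :: complex
  assumes "(\<alpha>, \<rho>) \<in> admissible"
    and "stable_process \<alpha> \<rho> M X"
    and "distributed M lborel e (exponential_density 1)"
    and "indep_of_process M e X"
    and "z \<noteq> 0"
    and "\<bar>Arg z\<bar> < pi * min (1 - \<rho>) (1/2)"
  shows "((\<lambda>w. Ln (phi M X e w)) has_field_derivative
           1 / (2 * pi * \<i> * z) *
             (F_integral (pi * \<i> * \<rho> - Ln z) (\<i> / of_real \<alpha>)
              - F_integral (- pi * \<i> * \<rho> - Ln z) (\<i> / of_real \<alpha>))) (at z)"
proof -
  interpret killed_stable_process \<alpha> \<rho> M X e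
    using assms(1-4) by unfold_locales
  have "pi * min (1 - \<rho>) (1/2) \<le> pi * (1 / 2)" by (intro mult_left_mono min.cobounded2) simp
  then have "\<bar>Arg z\<bar> < pi / 2" using assms(6) by linarith
  then have "0 < Re z"
    using assms(5) Arg_Re_pos[of z] by simp
  then show ?thesis
    using phi_log_derivative[of z] unfolding log_derivative_formula[OF assms(5,6)] by simp
qed

end
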